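(* For every $n\ge4$, the number of coherent lattice paths of size $n$ (equivalently, of coherent monotone paths on the hypersimplex $\Delta(n,2)$ for a generic direction, i.e. of vertices of its monotone path polytope) is $\frac13\bigl(25\cdot 4^{\,n-4}-1\bigr)$.
   Context: A diagonal-avoiding lattice path of size $n$ (dimension 2) is a sequence of points $\boldsymbol\ell_1,\dots,\boldsymbol\ell_r\in[n]^2$ with $\boldsymbol\ell_1=(2,1)$, $\boldsymbol\ell_r\in\{(n-1,n),(n,n-1)\}$, the two coordinates of each point distinct, and consecutive points differing in exactly one coordinate, which strictly increases. Its $i$-th enhanced step is $(a\to b;z)$ where the changing coordinate goes from $a$ to $b$ and the fixed coordinate equals $z$; $\prec$ denotes the order of steps along the path. It is a coherent lattice path if for all enhanced steps $(i\to j;a)\prec(x\to y;z)$ with $x<j$ one has $j=z$ or $x=a$. Here $\Delta(n,2)=\{\mathbf x\in[0,1]^n:\sum x_i=2\}$, a generic direction is $\mathbf c$ with pairwise distinct coordinates, and a monotone path is coherent if some $\boldsymbol\omega\in\mathbb R^n$ makes its edges exactly the preimages of the upper edges of the polygon $\{(\langle\mathbf x,\mathbf c\rangle,\langle\mathbf x,\boldsymbol\omega\rangle):\mathbf x\in\Delta(n,2)\}$. *)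

theory Defs
  imports "HOL-Analysis.Analysis"
begin

definition lattice_step :: "nat \<times> nat \<Rightarrow> nat \<times> nat \<Rightarrow> bool" where
  "lattice_step p q \<longleftrightarrow>
     (fst p < fst q \<and> snd p = snd q) \<or> (fst p = fst q \<and> snd p < snd q)"

definition diagonal_avoiding_path :: "nat \<Rightarrow> (nat \<times> nat) list \<Rightarrow> bool" where
  "diagonal_avoiding_path n ls \<longleftrightarrow>
     ls \<noteq> [] \<and>
     set ls \<subseteq> {1..n} \<times> {1..n} \<and>
     hd ls = (2, 1) \<and>
     last ls \<in> {(n - 1, n), (n, n - 1)} \<and>
     (\<forall>(a, b) \<in> set ls. a \<noteq> b) \<and>
     (\<forall>k. Suc k < length ls \<longrightarrow> lattice_step (ls ! k) (ls ! Suc k))"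

text \<open>The enhanced step \<open>(a \<rightarrow> b; z)\<close> is encoded as the triple \<open>(a, b, z)\<close>; as in the
  notation, it does not record which of the two coordinates changes.\<close>

definition enhanced_step :: "nat \<times> nat \<Rightarrow> nat \<times> nat \<Rightarrow> nat \<times> nat \<times> nat" where
  "enhanced_step p q =
     (if fst p \<noteq> fst q then (fst p, fst q, snd p) else (snd p, snd q, fst p))"

definition coherent_lattice_path :: "nat \<Rightarrow> (nat \<times> nat) list \<Rightarrow> bool" where
  "coherent_lattice_path n ls \<longleftrightarrow>
     diagonal_avoiding_path n ls \<and>
     (\<forall>k l i j a x y z.
        k < l \<and> Suc l < length ls \<and>
        enhanced_step (ls ! k) (ls ! Suc k) = (i, j, a) \<and>
        enhanced_step (ls ! l) (ls ! Suc l) = (x, y, z) \<and>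
        x < j \<longrightarrow> j = z \<or> x = a)"

text \<open>A path on a polytope is given by the list of vertices it visits.\<close>

definition monotone_path :: "'a::euclidean_space set \<Rightarrow> 'a \<Rightarrow> 'a list \<Rightarrow> bool" where
  "monotone_path P c vs \<longleftrightarrow>
     vs \<noteq> [] \<and>
     (\<forall>v \<in> set vs. v extreme_point_of P) \<and>
     (\<forall>x \<in> P. hd vs \<bullet> c \<le> x \<bullet> c) \<and>
     (\<forall>x \<in> P. x \<bullet> c \<le> last vs \<bullet> c) \<and>
     (\<forall>k. Suc k < length vs \<longrightarrow>
        closed_segment (vs ! k) (vs ! Suc k) edge_of P \<and> vs ! k \<bullet> c < vs ! Suc k \<bullet> c)"

definition path_edges :: "'a::real_vector list \<Rightarrow> 'a set set" where
  "path_edges vs = {closed_segment (vs ! k) (vs ! Suc k) |k. Suc k < length vs}"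

text \<open>An edge of a planar convex set is upper if no point of the set lies vertically above
  a point of the edge. In particular vertical edges are not upper.\<close>

definition upper_edge_of :: "(real \<times> real) set \<Rightarrow> (real \<times> real) set \<Rightarrow> bool" where
  "upper_edge_of F Q \<longleftrightarrow>
     F edge_of Q \<and> (\<forall>s t t'. (s, t) \<in> F \<longrightarrow> (s, t') \<in> Q \<longrightarrow> t' \<le> t)"

definition shadow_map :: "'a::euclidean_space \<Rightarrow> 'a \<Rightarrow> 'a \<Rightarrow> real \<times> real" where
  "shadow_map c \<omega> x = (x \<bullet> c, x \<bullet> \<omega>)"

definition coherent_monotone_path :: "'a::euclidean_space set \<Rightarrow> 'a \<Rightarrow> 'a list \<Rightarrow> bool" where
  "coherent_monotone_path P c vs \<longleftrightarrow>
     monotone_path P c vs \<and>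
     (\<exists>\<omega>. path_edges vs =
        {{x \<in> P. shadow_map c \<omega> x \<in> F} |F. upper_edge_of F (shadow_map c \<omega> ` P)})"

text \<open>The monotone path polytope is the fiber polytope (Billera--Sturmfels) of the projection
  \<open>x \<mapsto> \<langle>x, c\<rangle>\<close> of \<open>P\<close> onto the segment \<open>Q\<close>: the set of average values of the continuous
  sections of this projection. Without the normalisation by the length of \<open>Q\<close> one obtains a
  dilated copy.\<close>

definition section_over :: "'a::euclidean_space set \<Rightarrow> 'a \<Rightarrow> (real \<Rightarrow> 'a) \<Rightarrow> bool" where
  "section_over P c \<gamma> \<longleftrightarrow>
     continuous_on ((\<lambda>x. x \<bullet> c) ` P) \<gamma> \<and>
     (\<forall>t \<in> (\<lambda>x. x \<bullet> c) ` P. \<gamma> t \<in> P \<and> \<gamma> t \<bullet> c = t)"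

definition monotone_path_polytope :: "'a::euclidean_space set \<Rightarrow> 'a \<Rightarrow> 'a set" where
  "monotone_path_polytope P c =
     (let Q = (\<lambda>x. x \<bullet> c) ` P
      in {(1 / measure lborel Q) *\<^sub>R integral Q \<gamma> |\<gamma>. section_over P c \<gamma>})"

definition hypersimplex :: "nat \<Rightarrow> (real ^ 'n) set" where
  "hypersimplex k = {x. (\<forall>i. 0 \<le> x $ i \<and> x $ i \<le> 1) \<and> (\<Sum>i\<in>UNIV. x $ i) = real k}"

definition generic_direction :: "real ^ 'n \<Rightarrow> bool" where
  "generic_direction c \<longleftrightarrow> (\<forall>i j. i \<noteq> j \<longrightarrow> c $ i \<noteq> c $ j)"

end

theory Submission
  imports Defs
begin

text \<open>Forget which coordinate is which: a lattice path becomes a sequence of pairs \<open>s < l\<close>, and the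
  coherence condition says that such a sequence is recognised by an automaton whose state, besides
  the pair, is one bit and one number. This gives linear recurrences with the solution
  \<open>(25 * 4 ^ (n - 4) - 1) / 3\<close>.

  For the hypersimplex, order the coordinates by \<open>c\<close> and let coordinate \<open>x\<close> with weight \<open>\<omega> $ x\<close>
  be the line \<open>\<mu> \<mapsto> \<omega> $ x + \<mu> * c $ x\<close>. Maximising \<open>\<omega> + \<mu> *\<^sub>R c\<close> on \<open>\<Delta>(n, 2)\<close> selects the two
  topmost lines at time \<open>\<mu>\<close>, so the coherent path of \<open>\<omega>\<close> records the crossings at the second level
  of this line arrangement. A steeper line stays above once it is above, which makes the recorded
  sequence a coherent lattice path. Conversely, an accepted sequence is realised by
  inserting the lines one at a time, each at a suitably chosen crossing time.

  For the monotone path polytope, the section along a coherent path of \<open>\<omega>\<close> is the only section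
  that maximises \<open>\<omega>\<close> on every fibre. So its average is a vertex, and by separation along generic
  directions there are no further vertices.\<close>

section \<open>Paths of pairs\<close>

text \<open>Compatibility concerns all pairs of steps, yet one bit and one number suffice as memory:
  entries only grow, and whatever earlier steps still demand of later ones follows from two demands
  on the current pair. Once the smaller entry has moved, the larger one is frozen until it is
  overtaken. So the count splits into paths on which the larger entry moves first, and paths on
  which the smaller entry visits a subset of the entries in between and then overtakes. The powers
  of two come from these subsets, and the constant is \<open>25 / 3 = 5 + 10 / 3\<close>.

  The obstacle in realising a sequence is that a line inserted for one crossing also exists in the
  past, where it must stay below all recorded crossings. It is steeper than the line it crosses, so
  a very late crossing is safe. The new line then crosses just before \<open>j\<close> does and is
  kept low in the past because \<open>j\<close> itself was low. This needs a line steeper than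
  \<open>j\<close>, which matches the bound in the automaton.\<close>

definition pair_move :: "nat \<times> nat \<Rightarrow> nat \<times> nat \<Rightarrow> bool" where
  "pair_move p q \<longleftrightarrow> fst p < snd p \<and> fst q < snd q \<and>
     (fst q = fst p \<and> snd p < snd q \<or> snd q = snd p \<and> fst p < fst q \<or> fst q = snd p)"

definition pair_step :: "nat \<times> nat \<Rightarrow> nat \<times> nat \<Rightarrow> nat \<times> nat \<times> nat" where
  "pair_step p q =
     (if fst q = fst p then (snd p, snd q, fst p)
      else if snd q = snd p then (fst p, fst q, snd p)
      else (fst p, snd q, snd p))"

text \<open>This is not an order. With it, \<open>sorted_wrt\<close> is merely the test of every
  earlier step against every later one.\<close>

fun compatible :: "nat \<times> nat \<times> nat \<Rightarrow> nat \<times> nat \<times> nat \<Rightarrow> bool" where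
  "compatible (i, j, a) (x, y, z) \<longleftrightarrow> (x < j \<longrightarrow> j = z \<or> x = a)"

fun consec :: "('a \<Rightarrow> 'a \<Rightarrow> 'b) \<Rightarrow> 'a list \<Rightarrow> 'b list" where
  "consec f (x # y # xs) = f x y # consec f (y # xs)"
| "consec f [x] = []"
| "consec f [] = []"

lemma length_consec: "length (consec f xs) = length xs - 1"
  by (induction f xs rule: consec.induct) auto

lemma nth_consec: "Suc k < length xs \<Longrightarrow> consec f xs ! k = f (xs ! k) (xs ! Suc k)"
  by (induction f xs arbitrary: k rule: consec.induct) (auto simp: nth_Cons split: nat.split)

text \<open>The automaton state is the pair \<open>p\<close> together with \<open>b\<close> and \<open>j\<close>. If the larger entry was entered
  next to a smaller one that has moved since, then \<open>b\<close> holds and the larger entry has to wait until it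
  is overtaken. If the last step was \<open>(j \<rightarrow> snd p; fst p)\<close>, then the smaller entry must not move to an
  entry below \<open>j\<close>. Otherwise \<open>j\<close> is \<open>0\<close>.\<close>

fun accepts :: "nat \<Rightarrow> bool \<Rightarrow> nat \<Rightarrow> nat \<times> nat \<Rightarrow> (nat \<times> nat) list \<Rightarrow> bool" where
  "accepts n b j p [] \<longleftrightarrow> p = (n - 1, n)"
| "accepts n b j p (q # ps) \<longleftrightarrow> fst q < snd q \<and> snd q \<le> n \<and>
     (\<not> b \<and> fst q = fst p \<and> snd p < snd q \<and> accepts n False (snd p) q ps \<or>
      snd q = snd p \<and> fst p < fst q \<and> j \<le> fst q \<and> accepts n True 0 q ps \<or>
      fst q = snd p \<and> accepts n False 0 q ps)"

text \<open>The state read as a promise about the whole future. The induction works because each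
  case of \<open>accepts\<close> hands on a state whose promise, together with the lower bound on
  \<open>x\<close>, implies the old promise for the remaining steps.\<close>

lemma accepts_steps:
  assumes "accepts n b j p ps" "fst p < snd p" "j \<le> snd p" "(x, y, z) \<in> set (consec pair_step (p # ps))"
  shows "fst p \<le> x \<and> (x < snd p \<longrightarrow> z = snd p \<or> \<not> b \<and> x = fst p) \<and> (x < j \<longrightarrow> x = fst p)"
  using assms
proof (induction ps arbitrary: b j p)
  case Nil
  then show ?case by simp
next
  case (Cons q ps)
  consider (head) "(x, y, z) = pair_step p q" | (tail) "(x, y, z) \<in> set (consec pair_step (q # ps))"
    using Cons.prems(4) by auto
  then show ?case
  proof cases
    case head
    then show ?thesis using Cons.prems by (auto simp: pair_step_def split: if_splits)
  next
    case tail
    note IH = Cons.IH[OF _ _ _ tail]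
    show ?thesis
      using Cons.prems IH[of False "snd p"] IH[of True 0] IH[of False 0] by auto
  qed
qed

lemma accepts_imp_sorted_wrt:
  assumes "accepts n b j p ps" "fst p < snd p" "j \<le> snd p"
  shows "sorted_wrt compatible (consec pair_step (p # ps))"
  using assms
proof (induction ps arbitrary: b j p)
  case Nil
  then show ?case by simp
next
  case (Cons q ps)
  have "sorted_wrt compatible (consec pair_step (q # ps))"
    using Cons.prems Cons.IH[of False "snd p" q] Cons.IH[of True 0 q] Cons.IH[of False 0 q] by auto
  moreover have "compatible (pair_step p q) e" if "e \<in> set (consec pair_step (q # ps))" for e
  proof -
    obtain x y z where e: "e = (x, y, z)" by (cases e)
    note IH = accepts_steps[OF _ _ _ that[unfolded e]]
    show ?thesis
      using Cons.prems IH[of n False "snd p"] IH[of n True 0] IH[of n False 0]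
      by (auto simp: e pair_step_def)
  qed
  ultimately show ?case by auto
qed

lemma accepts_imp_path:
  assumes "accepts n b j p ps" "fst p < snd p"
  shows "successively pair_move (p # ps) \<and> last (p # ps) = (n - 1, n)"
  using assms
proof (induction ps arbitrary: b j p)
  case Nil
  then show ?case by simp
next
  case (Cons q ps)
  have "pair_move p q" using Cons.prems by (auto simp: pair_move_def)
  then show ?case
    using Cons.prems Cons.IH[of False "snd p" q] Cons.IH[of True 0 q] Cons.IH[of False 0 q] by auto
qed

lemma pair_path_mono:
  assumes "successively pair_move (p # ps)" "q \<in> set (p # ps)"
  shows "fst p \<le> fst q \<and> snd p \<le> snd q \<and> snd q \<le> snd (last (p # ps))"
  using assms
proof (induction ps arbitrary: p q)
  case Nil
  then show ?case by simp
next
  case (Cons r ps)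
  have *: "fst p \<le> fst r" "snd p \<le> snd r" "successively pair_move (r # ps)"
    using Cons.prems by (auto simp: pair_move_def)
  show ?case
    using Cons.IH[OF *(3), of r] Cons.IH[OF *(3), of q] * Cons.prems(2) by (cases "q = p") auto
qed

text \<open>The numbers \<open>x\<close> and \<open>z\<close> form the pair that the step leaves,
  and both entries of a pair can only grow along a path.\<close>

lemma pair_path_steps_max:
  assumes "successively pair_move (p # ps)" "(x, y, z) \<in> set (consec pair_step (p # ps))"
  shows "fst p \<le> x \<and> fst p \<le> z \<and> snd p \<le> max x z \<and> x < y"
  using assms
proof (induction ps arbitrary: p)
  case Nil
  then show ?case by simp
next
  case (Cons r ps)
  have *: "pair_move p r" "successively pair_move (r # ps)"
    using Cons.prems by auto
  consider "(x, y, z) = pair_step p r" | "(x, y, z) \<in> set (consec pair_step (r # ps))"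
    using Cons.prems(2) by auto
  then show ?case
  proof cases
    case 1
    then show ?thesis using *(1) by (auto simp: pair_step_def pair_move_def split: if_splits)
  next
    case 2
    then show ?thesis using *(1) Cons.IH[OF *(2) 2] by (auto simp: pair_move_def)
  qed
qed

text \<open>The smaller entry has to reach \<open>n - 1\<close>, so it is left at some later time,
  next to a larger entry that has not decreased. This later step is the witness against moves that
  the automaton forbids.\<close>

lemma pair_path_leaves_fst:
  assumes "successively pair_move (p # ps)" "last (p # ps) = (n - 1, n)" "fst p < n - 1"
  shows "\<exists>y z. (fst p, y, z) \<in> set (consec pair_step (p # ps)) \<and> snd p \<le> z"
  using assms
proof (induction ps arbitrary: p)
  case Nil
  then show ?case by simp
next
  case (Cons q ps)
  show ?case
  proof (cases "fst q = fst p")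
    case True
    then obtain y z where "(fst p, y, z) \<in> set (consec pair_step (q # ps))" "snd q \<le> z"
      using Cons.IH[of q] Cons.prems by auto
    moreover have "snd p \<le> snd q" using Cons.prems by (auto simp: pair_move_def)
    ultimately show ?thesis by force
  next
    case False
    then show ?thesis by (auto simp: pair_step_def)
  qed
qed

text \<open>The assumption on the steps is the promise of \<open>accepts_steps\<close> without its
  lower bound. Together the two lemmas show that \<open>b\<close> and \<open>j\<close> record
  precisely what the past demands of the future.\<close>

lemma path_imp_accepts:
  assumes "successively pair_move (p # ps)" "last (p # ps) = (n - 1, n)"
    and "sorted_wrt compatible (consec pair_step (p # ps))"
    and "\<And>x y z. (x, y, z) \<in> set (consec pair_step (p # ps)) \<Longrightarrow>
      (x < snd p \<longrightarrow> z = snd p \<or> \<not> b \<and> x = fst p) \<and> (x < j \<longrightarrow> x = fst p)"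
    and "j < snd p"
  shows "accepts n b j p ps"
  using assms
proof (induction ps arbitrary: b j p)
  case Nil
  then show ?case by simp
next
  case (Cons q ps)
  have path: "successively pair_move (q # ps)" "last (q # ps) = (n - 1, n)"
    and move: "pair_move p q" using Cons.prems by auto
  have sorted: "sorted_wrt compatible (consec pair_step (q # ps))"
    and comp: "\<And>e. e \<in> set (consec pair_step (q # ps)) \<Longrightarrow> compatible (pair_step p q) e"
    using Cons.prems(3) by auto
  have A: "(x < snd p \<longrightarrow> z = snd p \<or> \<not> b \<and> x = fst p) \<and> (x < j \<longrightarrow> x = fst p)"
    if "(x, y, z) \<in> set (consec pair_step (q # ps))" for x y z
    using Cons.prems(4) that by auto
  note mx = pair_path_steps_max[OF path(1), THEN conjunct1] pair_path_steps_max[OF path(1), THEN conjunct2, THEN conjunct2, THEN conjunct1]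
  have qn: "snd q \<le> n" using pair_path_mono[OF path(1), of q] path(2) by simp
  have lt: "fst p < snd p" "fst q < snd q" using move by (auto simp: pair_move_def)
  consider (1) "fst q = fst p" "snd p < snd q" | (2) "snd q = snd p" "fst p < fst q"
    | (3) "fst q = snd p" using move by (auto simp: pair_move_def)
  then show ?case
  proof cases
    case 1
    then have st: "pair_step p q = (snd p, snd q, fst p)" by (simp add: pair_step_def)
    \<comment> \<open>If the larger entry moved although \<open>b\<close> holds, the smaller entry
      would later be left next to something above \<open>snd p\<close>, against the promise.\<close>
    have "\<not> b"
    proof
      assume b
      have "fst q < n - 1" using 1 lt qn by linarith
      from pair_path_leaves_fst[OF path this] obtain y z where
        yz: "(fst q, y, z) \<in> set (consec pair_step (q # ps))" "snd q \<le> z" by auto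
      show False using A[OF yz(1)] yz(2) 1 lt \<open>b\<close> by auto
    qed
    moreover have "accepts n False (snd p) q ps"
    proof (rule Cons.IH[OF path sorted])
      fix x y z assume e: "(x, y, z) \<in> set (consec pair_step (q # ps))"
      \<comment> \<open>The alternative \<open>z = snd p\<close> of the old promise disappears for
        \<open>x < snd p\<close>: the pair left by a later step has an entry of at least
        \<open>snd q\<close>.\<close>
      show "(x < snd q \<longrightarrow> z = snd q \<or> \<not> False \<and> x = fst q) \<and> (x < snd p \<longrightarrow> x = fst q)"
        using comp[OF e] st A[OF e] mx(2)[OF e] 1 lt by auto
    qed (use 1 in simp)
    ultimately show ?thesis using 1 lt qn by simp
  next
    case 2
    \<comment> \<open>An entry below \<open>j\<close> would have to be left again, but below
      \<open>j\<close> the promise allows only steps that start at \<open>fst p\<close>.\<close>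
    have "j \<le> fst q"
    proof (rule ccontr)
      assume "\<not> j \<le> fst q"
      then have "fst q < n - 1" using Cons.prems(5) 2 qn lt by linarith
      from pair_path_leaves_fst[OF path this] obtain y z where
        yz: "(fst q, y, z) \<in> set (consec pair_step (q # ps))" by auto
      show False using A[OF yz(1)] 2 \<open>\<not> j \<le> fst q\<close> by auto
    qed
    moreover have "accepts n True 0 q ps"
    proof (rule Cons.IH[OF path sorted])
      fix x y z assume e: "(x, y, z) \<in> set (consec pair_step (q # ps))"
      show "(x < snd q \<longrightarrow> z = snd q \<or> \<not> True \<and> x = fst q) \<and> (x < 0 \<longrightarrow> x = fst q)"
        using A[OF e] mx(1)[OF e] 2 by auto
    qed (use lt in simp)
    ultimately show ?thesis using 2 lt qn by simp
  next
    case 3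
    then have st: "pair_step p q = (fst p, snd q, snd p)" using lt by (auto simp: pair_step_def)
    have "accepts n False 0 q ps"
    proof (rule Cons.IH[OF path sorted])
      fix x y z assume e: "(x, y, z) \<in> set (consec pair_step (q # ps))"
      show "(x < snd q \<longrightarrow> z = snd q \<or> \<not> False \<and> x = fst q) \<and> (x < 0 \<longrightarrow> x = fst q)"
        using comp[OF e] st 3 by auto
    qed (use lt in simp)
    then show ?thesis using 3 lt qn by simp
  qed
qed

lemma accepts_iff:
  "accepts n False 0 (1, 2) ps \<longleftrightarrow>
     successively pair_move ((1, 2) # ps) \<and> last ((1, 2) # ps) = (n - 1, n) \<and>
     sorted_wrt compatible (consec pair_step ((1, 2) # ps))"
proof (intro iffI conjI; (elim conjE)?)
  assume "accepts n False 0 (1, 2) ps"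
  then show "successively pair_move ((1, 2) # ps)" "last ((1, 2) # ps) = (n - 1, n)"
    "sorted_wrt compatible (consec pair_step ((1, 2) # ps))"
    using accepts_imp_path[of n False 0 "(1,2)" ps] accepts_imp_sorted_wrt[of n False 0 "(1,2)" ps] by auto
next
  assume *: "successively pair_move ((1, 2) # ps)" "last ((1, 2) # ps) = (n - 1, n)"
    "sorted_wrt compatible (consec pair_step ((1, 2) # ps))"
  show "accepts n False 0 (1, 2) ps"
  proof (rule path_imp_accepts[OF *])
    fix x y z assume "(x, y, z) \<in> set (consec pair_step ((1, 2) # ps))"
    from pair_path_steps_max[OF *(1) this]
    show "(x < snd (1, 2) \<longrightarrow> z = snd (1, 2) \<or> \<not> False \<and> x = fst (1::nat, 2::nat)) \<and>
      (x < 0 \<longrightarrow> x = fst (1::nat, 2::nat))" by auto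
  qed simp
qed

section \<open>Counting\<close>

definition accepted :: "nat \<Rightarrow> bool \<Rightarrow> nat \<Rightarrow> nat \<times> nat \<Rightarrow> (nat \<times> nat) list set" where
  "accepted n b j p = {ps. accepts n b j p ps}"

lemma card_Cons_family:
  assumes "finite Q" "\<And>q. q \<in> Q \<Longrightarrow> finite (T q)"
  shows "finite (\<Union>q\<in>Q. Cons q ` T q)" "card (\<Union>q\<in>Q. Cons q ` T q) = (\<Sum>q\<in>Q. card (T q))"
proof -
  have "card (\<Union>q\<in>Q. Cons q ` T q) = (\<Sum>q\<in>Q. card (Cons q ` T q))"
    using assms by (intro card_UN_disjoint) auto
  also have "\<dots> = (\<Sum>q\<in>Q. card (T q))"
    by (intro sum.cong refl card_image) (auto simp: inj_on_def)
  finally show "card (\<Union>q\<in>Q. Cons q ` T q) = (\<Sum>q\<in>Q. card (T q))" .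
qed (use assms in auto)

lemma accepted_unfold:
  fixes n s l j :: nat and b :: bool
  assumes "s < l" "l \<le> n"
  defines "I1 \<equiv> (if b then {} else Pair s ` {l<..n})"
    and "I2 \<equiv> (\<lambda>s'. (s', l)) ` {max (Suc s) j..<l}"
    and "I3 \<equiv> Pair l ` {l<..n}"
  shows "accepted n b j (s, l) =
     (if s = n - 1 then {[]} else {}) \<union> (\<Union>q\<in>I1. Cons q ` accepted n False l q) \<union>
     (\<Union>q\<in>I2. Cons q ` accepted n True 0 q) \<union> (\<Union>q\<in>I3. Cons q ` accepted n False 0 q)"
    (is "_ = ?R")
proof (intro set_eqI iffI)
  fix ps assume ps: "ps \<in> accepted n b j (s, l)"
  show "ps \<in> ?R"
  proof (cases ps)
    case Nil
    with ps show ?thesis by (auto simp: accepted_def)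
  next
    case (Cons q qs)
    obtain u v where q: "q = (u, v)" by (cases q)
    from ps have "u < v" "v \<le> n" and
      "\<not> b \<and> u = s \<and> l < v \<and> accepts n False l q qs \<or>
       v = l \<and> s < u \<and> j \<le> u \<and> accepts n True 0 q qs \<or> u = l \<and> accepts n False 0 q qs"
      by (auto simp: accepted_def Cons q)
    then show ?thesis
      unfolding Cons I1_def I2_def I3_def accepted_def q by auto
  qed
next
  fix ps assume "ps \<in> ?R"
  then show "ps \<in> accepted n b j (s, l)"
    using assms(1,2) by (auto simp: accepted_def I1_def I2_def I3_def split: if_splits)
qed

lemma card_accepted_rec:
  fixes n s l :: nat
  assumes "s < l" "l \<le> n"
    and fin1: "\<And>l'. \<not> b \<Longrightarrow> l < l' \<Longrightarrow> l' \<le> n \<Longrightarrow> finite (accepted n False l (s, l'))"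
    and fin2: "\<And>s'. s < s' \<Longrightarrow> s' < l \<Longrightarrow> finite (accepted n True 0 (s', l))"
    and fin3: "\<And>l'. l < l' \<Longrightarrow> l' \<le> n \<Longrightarrow> finite (accepted n False 0 (l, l'))"
  shows "finite (accepted n b j (s, l))"
    and "card (accepted n b j (s, l)) = (if s = n - 1 then 1 else 0) +
      (if b then 0 else \<Sum>l'\<in>{l<..n}. card (accepted n False l (s, l'))) +
      (\<Sum>s'\<in>{max (Suc s) j..<l}. card (accepted n True 0 (s', l))) +
      (\<Sum>l'\<in>{l<..n}. card (accepted n False 0 (l, l')))"
proof -
  define I1 where "I1 = (if b then {} else Pair s ` {l<..n})"
  define I2 where "I2 = (\<lambda>s'. (s', l)) ` {max (Suc s) j..<l}"
  define I3 where "I3 = Pair l ` {l<..n}"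
  define U1 where "U1 = (\<Union>q\<in>I1. Cons q ` accepted n False l q)"
  define U2 where "U2 = (\<Union>q\<in>I2. Cons q ` accepted n True 0 q)"
  define U3 where "U3 = (\<Union>q\<in>I3. Cons q ` accepted n False 0 q)"
  define U0 where "U0 = (if s = n - 1 then {[] :: (nat \<times> nat) list} else {})"
  have eq: "accepted n b j (s, l) = U0 \<union> U1 \<union> U2 \<union> U3"
    unfolding U0_def U1_def U2_def U3_def I1_def I2_def I3_def by (rule accepted_unfold[OF assms(1,2)])
  have f1: "finite (accepted n False l q)" if "q \<in> I1" for q
    using that fin1 by (auto simp: I1_def split: if_splits)
  have f2: "finite (accepted n True 0 q)" if "q \<in> I2" for q
    using that fin2 by (auto simp: I2_def)
  have f3: "finite (accepted n False 0 q)" if "q \<in> I3" for q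
    using that fin3 by (auto simp: I3_def)
  have fI: "finite I1" "finite I2" "finite I3" by (auto simp: I1_def I2_def I3_def)
  have c1: "finite U1" "card U1 = (\<Sum>q\<in>I1. card (accepted n False l q))"
    unfolding U1_def using card_Cons_family[OF fI(1), of "accepted n False l"] f1 by auto
  have c2: "finite U2" "card U2 = (\<Sum>q\<in>I2. card (accepted n True 0 q))"
    unfolding U2_def using card_Cons_family[OF fI(2), of "accepted n True 0"] f2 by auto
  have c3: "finite U3" "card U3 = (\<Sum>q\<in>I3. card (accepted n False 0 q))"
    unfolding U3_def using card_Cons_family[OF fI(3), of "accepted n False 0"] f3 by auto
  have disj: "I1 \<inter> I2 = {}" "I1 \<inter> I3 = {}" "I2 \<inter> I3 = {}"
    using assms(1) by (auto simp: I1_def I2_def I3_def)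
  have "U1 \<inter> U2 = {}" "(U1 \<union> U2) \<inter> U3 = {}" "U0 \<inter> (U1 \<union> U2 \<union> U3) = {}"
    using disj by (auto simp: U0_def U1_def U2_def U3_def)
  moreover have "finite U0" "card U0 = (if s = n - 1 then 1 else 0)" by (auto simp: U0_def)
  ultimately have "card (accepted n b j (s, l)) = (if s = n - 1 then 1 else 0) + card U1 + card U2 + card U3"
    unfolding eq Un_assoc using c1(1) c2(1) c3(1)
    by (simp add: card_Un_disjoint Int_Un_distrib Int_Un_distrib2)
  moreover have "card U1 = (if b then 0 else \<Sum>l'\<in>{l<..n}. card (accepted n False l (s, l')))"
    unfolding c1(2) by (simp add: I1_def sum.reindex inj_on_def)
  moreover have "card U2 = (\<Sum>s'\<in>{max (Suc s) j..<l}. card (accepted n True 0 (s', l)))"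
    unfolding c2(2) I2_def by (subst sum.reindex) (auto simp: inj_on_def)
  moreover have "card U3 = (\<Sum>l'\<in>{l<..n}. card (accepted n False 0 (l, l')))"
    unfolding c3(2) I3_def by (subst sum.reindex) (auto simp: inj_on_def)
  ultimately show "card (accepted n b j (s, l)) = (if s = n - 1 then 1 else 0) +
      (if b then 0 else \<Sum>l'\<in>{l<..n}. card (accepted n False l (s, l'))) +
      (\<Sum>s'\<in>{max (Suc s) j..<l}. card (accepted n True 0 (s', l))) +
      (\<Sum>l'\<in>{l<..n}. card (accepted n False 0 (l, l')))" by simp
  show "finite (accepted n b j (s, l))"
    unfolding eq using c1(1) c2(1) c3(1) by (simp add: U0_def)
qed

text \<open>For \<open>l < n\<close> and \<open>m = n - l\<close>, an unfrozen state with larger entry \<open>l\<close> has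
  \<open>growth_A m + 2\<^sup>k * growth_H m\<close> completions, where \<open>k\<close> depends on the smaller entry.\<close>

definition growth_A :: "nat \<Rightarrow> real" where
  "growth_A m = (if m = 1 then 1 else 5 * 4 ^ (m - 2))"

definition growth_H :: "nat \<Rightarrow> real" where
  "growth_H m = (if m = 1 then 1 else (10 * 4 ^ (m - 2) - 1) / 3)"

lemma growth_sums:
  assumes "m \<ge> 2"
  shows "(\<Sum>k\<in>{1..<m}. growth_A k) = (5 * 4 ^ (m - 2) - 2) / 3"
    and "(\<Sum>k\<in>{1..<m}. 2 ^ (m - k) * growth_H k) = (10 * 4 ^ (m - 2) + 2) / 3 - 2 ^ (m - 1)"
proof -
  have "(\<Sum>k\<in>{1..<m}. growth_A k) = (5 * 4 ^ (m - 2) - 2) / 3 \<and>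
    (\<Sum>k\<in>{1..<m}. 2 ^ (m - k) * growth_H k) = (10 * 4 ^ (m - 2) + 2) / 3 - 2 ^ (m - 1)"
    using assms
  proof (induction m rule: dec_induct)
    case base
    have "{1..<2} = {1::nat}" by auto
    then show ?case by (simp add: growth_A_def growth_H_def)
  next
    case (step m)
    have "(\<Sum>k\<in>{1..<Suc m}. growth_A k) = (\<Sum>k\<in>{1..<m}. growth_A k) + growth_A m"
      using step.hyps by simp
    moreover have "(\<Sum>k\<in>{1..<Suc m}. 2 ^ (Suc m - k) * growth_H k) =
        2 * (\<Sum>k\<in>{1..<m}. 2 ^ (m - k) * growth_H k) + 2 * growth_H m"
      using step.hyps by (simp add: sum_distrib_left Suc_diff_le mult.assoc)
    moreover obtain i where "m = i + 2" using step.hyps by (metis add.commute le_Suc_ex)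
    ultimately show ?case
      using step.IH by (simp add: growth_A_def growth_H_def field_simps)
  qed
  then show "(\<Sum>k\<in>{1..<m}. growth_A k) = (5 * 4 ^ (m - 2) - 2) / 3"
    "(\<Sum>k\<in>{1..<m}. 2 ^ (m - k) * growth_H k) = (10 * 4 ^ (m - 2) + 2) / 3 - 2 ^ (m - 1)" by auto
qed

text \<open>With \<open>m = n - l\<close>, the sum runs over the new larger entry
  \<open>l' = n - k\<close> after the larger entry \<open>l\<close> has moved. The last summand is
  \<open>l' = n\<close>: the smaller entry then visits any subset of the \<open>m - 1\<close>
  entries from \<open>l\<close> to \<open>n - 2\<close> on its way to \<open>n - 1\<close>.\<close>

lemma growth_A_rec:
  assumes "m \<ge> 1"
  shows "growth_A m = (\<Sum>k\<in>{1..<m}. growth_A k + 2 ^ (m - k) * growth_H k) + 2 ^ (m - 1)"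
proof (cases "m = 1")
  case False
  with assms growth_sums[of m] show ?thesis by (simp add: sum.distrib growth_A_def field_simps)
qed (simp add: growth_A_def)

text \<open>The same sum after an overtaking. Now \<open>l\<close> is the smaller entry, which
  leaves one entry fewer to visit. For \<open>m = 1\<close> the exponent \<open>m - 2\<close>
  truncates to 0 and counts the path that has just reached its end.\<close>

lemma growth_H_rec:
  assumes "m \<ge> 1"
  shows "growth_H m = (\<Sum>k\<in>{1..<m}. growth_A k + 2 ^ (m - k - 1) * growth_H k) + 2 ^ (m - 2)"
proof (cases "m = 1")
  case False
  have "(\<Sum>k\<in>{1..<m}. 2 ^ (m - k - 1) * growth_H k) = (\<Sum>k\<in>{1..<m}. 2 ^ (m - k) * growth_H k) / 2"
    unfolding sum_divide_distrib
    by (intro sum.cong refl) (auto simp: field_simps simp flip: power_Suc)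
  moreover obtain i where "m = i + 2" using False assms by (metis add.commute le_Suc_ex Suc_1 le_antisym not_less_eq_eq)
  ultimately show ?thesis
    using growth_sums[of m] by (simp add: sum.distrib growth_H_def field_simps)
qed (simp add: growth_H_def)

lemma sum_reflect:
  fixes f :: "nat \<Rightarrow> real" and l n :: nat
  assumes "l < n"
  shows "(\<Sum>l'\<in>{l<..<n}. f l') = (\<Sum>k\<in>{1..<n - l}. f (n - k))"
  by (rule sum.reindex_bij_witness[of _ "\<lambda>k. n - k" "\<lambda>k. n - k"]) (use assms in auto)

lemma sum_pow2_down:
  fixes t m :: nat
  assumes "t \<le> m"
  shows "(\<Sum>s\<in>{t..<m}. 2 ^ (m - 1 - s) :: real) = 2 ^ (m - t) - 1"
  using assms
proof (induction t rule: inc_induct)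
  case base
  then show ?case by simp
next
  case (step t)
  have "{t..<m} = insert t {Suc t..<m}" using step.hyps by auto
  then have "(\<Sum>s\<in>{t..<m}. 2 ^ (m - 1 - s) :: real) = 2 ^ (m - 1 - t) + (2 ^ (m - Suc t) - 1)"
    using step.IH by simp
  also have "\<dots> = 2 ^ (m - t) - 1" using step.hyps by (simp flip: power_Suc add: Suc_diff_Suc)
  finally show ?case .
qed

text \<open>\<open>growth_A (n - l)\<close> counts the continuations that move the larger entry
  first. In all others the smaller entry visits a subset of the entries from
  \<open>max (Suc s) j\<close> to \<open>l - 1\<close> and then overtakes, for which
  \<open>growth_H (n - l)\<close> continuations are left. For \<open>l = n\<close> the only freedom
  is the subset visited before \<open>n - 1\<close>. The induction is on the room left for the sum
  of the pair, which every move increases.\<close>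

lemma card_accepted:
  assumes "s < l" "l \<le> n" "j < l"
  shows "finite (accepted n b j (s, l)) \<and>
    (b \<and> j = 0 \<longrightarrow> real (card (accepted n b j (s, l))) =
      (if l = n then 2 ^ (n - 2 - s) else 2 ^ (l - 1 - s) * growth_H (n - l))) \<and>
    (\<not> b \<longrightarrow> real (card (accepted n b j (s, l))) =
      (if l = n then 2 ^ (n - 1 - max (Suc s) j)
       else growth_A (n - l) + 2 ^ (l - max (Suc s) j) * growth_H (n - l)))"
  using assms
proof (induction "2 * n - (s + l)" arbitrary: b j s l rule: less_induct)
  case less
  note sl = less.prems
  have IH1: "finite (accepted n False l (s, l'))"
    "real (card (accepted n False l (s, l'))) = (if l' = n then 2 ^ (n - 1 - l)
       else growth_A (n - l') + 2 ^ (l' - l) * growth_H (n - l'))"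
    if "l < l'" "l' \<le> n" for l'
    using less.hyps[of s l' l False] that sl by (auto simp: max_def)
  have IH2: "finite (accepted n True 0 (s', l))"
    "real (card (accepted n True 0 (s', l))) =
      (if l = n then 2 ^ (n - 2 - s') else 2 ^ (l - 1 - s') * growth_H (n - l))"
    if "s < s'" "s' < l" for s'
    using less.hyps[of s' l 0 True] that sl by auto
  have IH3: "finite (accepted n False 0 (l, l'))"
    "real (card (accepted n False 0 (l, l'))) = (if l' = n then 2 ^ (n - 2 - l)
       else growth_A (n - l') + 2 ^ (l' - l - 1) * growth_H (n - l'))"
    if "l < l'" "l' \<le> n" for l'
    using less.hyps[of l l' 0 False] that sl by (auto simp: numeral_2_eq_2)
  have rec: "finite (accepted n b j (s, l))"
    "card (accepted n b j (s, l)) = (if s = n - 1 then 1 else 0) +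
      (if b then 0 else \<Sum>l'\<in>{l<..n}. card (accepted n False l (s, l'))) +
      (\<Sum>s'\<in>{max (Suc s) j..<l}. card (accepted n True 0 (s', l))) +
      (\<Sum>l'\<in>{l<..n}. card (accepted n False 0 (l, l')))"
    by (rule card_accepted_rec[OF sl(1,2)]; use IH1(1) IH2(1) IH3(1) in blast)+
  have split: "{l<..n} = insert n {l<..<n}" if "l < n" using that by auto
  have S1: "(\<Sum>l'\<in>{l<..n}. real (card (accepted n False l (s, l')))) = growth_A (n - l)" if "l < n"
  proof -
    have "(\<Sum>l'\<in>{l<..n}. real (card (accepted n False l (s, l')))) =
      (\<Sum>l'\<in>{l<..<n}. growth_A (n - l') + 2 ^ (l' - l) * growth_H (n - l')) + 2 ^ (n - 1 - l)"
      using that by (simp add: split IH1(2))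
    also have "\<dots> = growth_A (n - l)"
      using that by (subst growth_A_rec) (auto simp: sum_reflect[OF that] intro!: sum.cong)
    finally show ?thesis .
  qed
  have S3: "(\<Sum>l'\<in>{l<..n}. real (card (accepted n False 0 (l, l')))) = growth_H (n - l)" if "l < n"
  proof -
    have "(\<Sum>l'\<in>{l<..n}. real (card (accepted n False 0 (l, l')))) =
      (\<Sum>l'\<in>{l<..<n}. growth_A (n - l') + 2 ^ (l' - l - 1) * growth_H (n - l')) + 2 ^ (n - 2 - l)"
      using that by (simp add: split IH3(2))
    also have "\<dots> = growth_H (n - l)"
      using that by (subst growth_H_rec) (auto simp: sum_reflect[OF that] intro!: sum.cong)
    finally show ?thesis .
  qed
  let ?t = "max (Suc s) j"
  have t: "?t \<le> l" using sl by auto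
  have S2: "(\<Sum>s'\<in>{?t..<l}. real (card (accepted n True 0 (s', l)))) =
    (2 ^ (l - ?t) - 1) * growth_H (n - l)" if "l < n"
  proof -
    have "(\<Sum>s'\<in>{?t..<l}. real (card (accepted n True 0 (s', l)))) =
        (\<Sum>s'\<in>{?t..<l}. 2 ^ (l - 1 - s') * growth_H (n - l))"
      using that by (intro sum.cong refl) (simp add: IH2(2))
    then show ?thesis using sum_pow2_down[OF t] by (simp flip: sum_distrib_right)
  qed
  have S2n: "(\<Sum>s'\<in>{?t..<l}. real (card (accepted n True 0 (s', l)))) =
      (if s = n - 1 then 0 else 2 ^ (n - 1 - ?t))" if "l = n"
  proof (cases "s = n - 1")
    case False
    then have tl: "?t \<le> n - 1" "{?t..<n} = insert (n - 1) {?t..<n - 1}" using sl that by auto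
    have "(\<Sum>s'\<in>{?t..<l}. real (card (accepted n True 0 (s', l)))) = (\<Sum>s'\<in>{?t..<l}. 2 ^ (n - 2 - s'))"
    proof (rule sum.cong[OF refl])
      fix s' assume "s' \<in> {?t..<l}"
      then have "s < s'" "s' < l" by auto
      from IH2(2)[OF this] show "real (card (accepted n True 0 (s', l))) = 2 ^ (n - 2 - s')"
        using that by simp
    qed
    also have "\<dots> = 1 + (\<Sum>s'\<in>{?t..<n - 1}. 2 ^ (n - 1 - 1 - s'))"
      unfolding \<open>l = n\<close> tl(2) by (simp add: numeral_2_eq_2)
    finally show ?thesis using False sum_pow2_down[OF tl(1)] by simp
  qed (use sl that in auto)
  have "real (card (accepted n b j (s, l))) = (if s = n - 1 then 1 else 0) +
      (if b then 0 else \<Sum>l'\<in>{l<..n}. real (card (accepted n False l (s, l')))) +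
      (\<Sum>s'\<in>{?t..<l}. real (card (accepted n True 0 (s', l)))) +
      (\<Sum>l'\<in>{l<..n}. real (card (accepted n False 0 (l, l'))))"
    unfolding rec(2) by simp
  then have "real (card (accepted n b j (s, l))) =
    (if l = n then (if s = n - 1 then 1 else 2 ^ (n - 1 - ?t))
     else (if b then 0 else growth_A (n - l)) + 2 ^ (l - ?t) * growth_H (n - l))"
    using S1 S2 S3 S2n sl by (cases "l = n") (auto simp: algebra_simps)
  \<comment> \<open>In the final pair the exponent \<open>n - 1 - n\<close> truncates to 0, so the
    uniform formula also covers the single empty continuation.\<close>
  moreover have "?t = n" if "l = n" "s = n - 1" using that sl by auto
  ultimately have c: "real (card (accepted n b j (s, l))) =
    (if l = n then 2 ^ (n - 1 - ?t)
     else (if b then 0 else growth_A (n - l)) + 2 ^ (l - ?t) * growth_H (n - l))"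
    by (cases "l = n \<and> s = n - 1") (simp_all split: if_splits)
  show ?case
    unfolding c using rec(1) by simp
qed

text \<open>No entry lies between 1 and 2, so the exponent of two is 0 and the total is
  \<open>growth_A (n - 2) + growth_H (n - 2)\<close>, that is, \<open>5 * 4 ^ (n - 4)\<close> plus a
  third of \<open>10 * 4 ^ (n - 4) - 1\<close>.\<close>

lemma card_accepts:
  assumes "n \<ge> 4"
  shows "finite {ps. accepts n False 0 (1, 2) ps}"
    and "real (card {ps. accepts n False 0 (1, 2) ps}) = (25 * 4 ^ (n - 4) - 1) / 3"
proof -
  note * = card_accepted[of 1 2 n 0 False, unfolded accepted_def]
  show "finite {ps. accepts n False 0 (1, 2) ps}" using * assms by simp
  obtain i where n: "n = i + 4" using assms by (metis add.commute le_Suc_ex)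
  show "real (card {ps. accepts n False 0 (1, 2) ps}) = (25 * 4 ^ (n - 4) - 1) / 3"
    using * assms by (simp add: n growth_A_def growth_H_def field_simps)
qed

section \<open>Lattice paths\<close>

definition sort_pair :: "nat \<times> nat \<Rightarrow> nat \<times> nat" where
  "sort_pair p = (min (fst p) (snd p), max (fst p) (snd p))"

lemma sort_pair_Pair:
  "a < b \<Longrightarrow> sort_pair (a, b) = (a, b)" "b < a \<Longrightarrow> sort_pair (a, b) = (b, a)"
  by (simp_all add: sort_pair_def)

lemma lattice_step_sort_pair:
  assumes "lattice_step p q" "fst p \<noteq> snd p" "fst q \<noteq> snd q"
  shows "pair_move (sort_pair p) (sort_pair q) \<and> pair_step (sort_pair p) (sort_pair q) = enhanced_step p q"
proof -
  obtain a b a' b' where pq: "p = (a, b)" "q = (a', b')" by (cases p; cases q)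
  then have "a < b \<or> b < a" "a' < b' \<or> b' < a'" "a < a' \<and> b = b' \<or> a = a' \<and> b < b'"
    using assms by (auto simp: lattice_step_def)
  then show ?thesis
    unfolding pq
    by (elim disjE conjE) (simp_all add: sort_pair_Pair pair_move_def pair_step_def enhanced_step_def)
qed

text \<open>A step keeps one entry in its coordinate, so exchanging the coordinates of the target
  would not give a step again. Hence sorting the pairs loses no information once the starting point
  is fixed.\<close>

lemma lattice_step_determined:
  assumes "lattice_step p q" "lattice_step p q'" "fst p \<noteq> snd p" "sort_pair q = sort_pair q'"
  shows "q = q'"
  using assms
  by (cases p; cases q; cases q') (auto simp: lattice_step_def sort_pair_def min_def max_def split: if_splits)

lemma pair_move_lift:
  assumes "pair_move (sort_pair p) r" "fst p \<noteq> snd p"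
  obtains q where "lattice_step p q" "sort_pair q = r" "fst q \<noteq> snd q"
proof -
  obtain a b s l where pr: "p = (a, b)" "r = (s, l)" by (cases p; cases r)
  \<comment> \<open>The entry common to \<open>p\<close> and \<open>r\<close> stays in its
    coordinate; the other coordinate receives the new entry.\<close>
  define q where "q = (if a = s then (a, l) else if a = l then (a, s) else if b = s then (l, b) else (s, b))"
  show ?thesis
    by (rule that[of q]; use assms in
      \<open>auto simp: pr q_def pair_move_def lattice_step_def sort_pair_def min_def max_def split: if_splits\<close>)
qed

lemma pair_path_lift:
  assumes "successively pair_move (sort_pair r # ps)" "fst r \<noteq> snd r"
  shows "\<exists>rs. map sort_pair rs = ps \<and> successively lattice_step (r # rs) \<and> (\<forall>p\<in>set (r # rs). fst p \<noteq> snd p)"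
  using assms
proof (induction ps arbitrary: r)
  case Nil
  then show ?case by simp
next
  case (Cons q ps)
  then have "pair_move (sort_pair r) q" by simp
  from pair_move_lift[OF this Cons.prems(2)] obtain r' where
    r': "lattice_step r r'" "sort_pair r' = q" "fst r' \<noteq> snd r'" by metis
  with Cons.IH[of r'] Cons.prems obtain rs where
    "map sort_pair rs = ps" "successively lattice_step (r' # rs)" "\<forall>p\<in>set (r' # rs). fst p \<noteq> snd p"
    by auto
  with r' Cons.prems(2) show ?case by (intro exI[of _ "r' # rs"]) auto
qed

lemma lattice_path_determined:
  assumes "successively lattice_step (r # rs)" "successively lattice_step (r # rs')"
    "\<forall>p\<in>set (r # rs). fst p \<noteq> snd p" "map sort_pair rs = map sort_pair rs'"
  shows "rs = rs'"
  using assms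
proof (induction rs arbitrary: r rs')
  case (Cons q rs)
  then obtain q' qs where rs': "rs' = q' # qs" by (cases rs') auto
  have "q = q'" using Cons.prems lattice_step_determined[of r q q'] by (auto simp: rs')
  then show ?case using Cons.IH[of q qs] Cons.prems by (simp add: rs')
qed auto

lemma successively_sort_pair:
  assumes "successively lattice_step ls" "\<forall>p\<in>set ls. fst p \<noteq> snd p"
  shows "successively pair_move (map sort_pair ls)"
    and "consec pair_step (map sort_pair ls) = consec enhanced_step ls"
  using assms by (induction ls rule: induct_list012) (auto simp: lattice_step_sort_pair)

lemma sort_pair_eq_end_iff:
  assumes "n \<ge> 1"
  shows "sort_pair p = (n - 1, n) \<longleftrightarrow> p \<in> {(n - 1, n), (n, n - 1)}"
proof (cases p)
  case (Pair a b)
  consider "a < b" | "b < a" | "a = b" by linarith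
  then show ?thesis
    using assms by cases (auto simp: Pair sort_pair_Pair, simp_all add: sort_pair_def)
qed

lemma coherent_lattice_path_iff:
  "coherent_lattice_path n ls \<longleftrightarrow>
     diagonal_avoiding_path n ls \<and> sorted_wrt compatible (consec enhanced_step ls)"
proof -
  have "(\<forall>k l i j a x y z. k < l \<and> Suc l < length ls \<and>
        enhanced_step (ls ! k) (ls ! Suc k) = (i, j, a) \<and>
        enhanced_step (ls ! l) (ls ! Suc l) = (x, y, z) \<and> x < j \<longrightarrow> j = z \<or> x = a) \<longleftrightarrow>
      (\<forall>k l. k < l \<longrightarrow> l < length (consec enhanced_step ls) \<longrightarrow>
        compatible (consec enhanced_step ls ! k) (consec enhanced_step ls ! l))" (is "?L \<longleftrightarrow> ?R")
  proof
    assume L: ?L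
    show ?R
    proof (intro allI impI)
      fix k l assume kl: "k < l" "l < length (consec enhanced_step ls)"
      obtain i j a x y z where e: "enhanced_step (ls ! k) (ls ! Suc k) = (i, j, a)"
        "enhanced_step (ls ! l) (ls ! Suc l) = (x, y, z)" by (metis prod_cases3)
      have "x < j \<longrightarrow> j = z \<or> x = a"
        using L[rule_format, of k l i j a x y z] kl e by (auto simp: length_consec)
      then show "compatible (consec enhanced_step ls ! k) (consec enhanced_step ls ! l)"
        using kl e by (simp add: nth_consec length_consec)
    qed
  next
    assume R: ?R
    show ?L
    proof (intro allI impI, elim conjE)
      fix k l i j a x y z
      assume *: "k < l" "Suc l < length ls" "enhanced_step (ls ! k) (ls ! Suc k) = (i, j, a)"
        "enhanced_step (ls ! l) (ls ! Suc l) = (x, y, z)" "x < j"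
      then have "compatible (i, j, a) (x, y, z)"
        using R[rule_format, of k l] by (simp add: nth_consec length_consec)
      with * show "j = z \<or> x = a" by simp
    qed
  qed
  then show ?thesis
    unfolding coherent_lattice_path_def sorted_wrt_iff_nth_less by blast
qed

text \<open>The fixed start \<open>(2, 1)\<close> settles which coordinate holds which entry. From
  there every path of pairs has exactly one lift, with the same steps, so coherence is preserved in
  both directions.\<close>

lemma bij_betw_coherent_lattice_path:
  assumes "n \<ge> 2"
  shows "bij_betw (map sort_pair) {ls. coherent_lattice_path n ls}
    (Cons (1, 2) ` {ps. accepts n False 0 (1, 2) ps})"
proof (rule bij_betw_imageI)
  have dap: "\<exists>rs. ls = (2, 1) # rs \<and> successively lattice_step ls \<and> (\<forall>p\<in>set ls. fst p \<noteq> snd p) \<and>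
      sort_pair (last ls) = (n - 1, n)" if "diagonal_avoiding_path n ls" for ls
  proof -
    have "ls \<noteq> []" "hd ls = (2, 1)" "last ls \<in> {(n - 1, n), (n, n - 1)}" "successively lattice_step ls"
      "\<forall>p\<in>set ls. fst p \<noteq> snd p"
      using that unfolding diagonal_avoiding_path_def successively_conv_nth by auto
    then show ?thesis
      using sort_pair_eq_end_iff[of n "last ls"] assms by (cases ls) simp_all
  qed
  have start: "sort_pair (2, 1) = (1, 2)" "sort_pair (2, Suc 0) = (Suc 0, 2)" by (simp_all add: sort_pair_def)
  show "inj_on (map sort_pair) {ls. coherent_lattice_path n ls}"
  proof (rule inj_onI)
    fix ls ls' assume *: "ls \<in> {ls. coherent_lattice_path n ls}" "ls' \<in> {ls. coherent_lattice_path n ls}"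
      "map sort_pair ls = map sort_pair ls'"
    obtain rs where rs: "ls = (2, 1) # rs" "successively lattice_step ls" "\<forall>p\<in>set ls. fst p \<noteq> snd p"
      using * dap[of ls] by (auto simp: coherent_lattice_path_iff)
    obtain rs' where rs': "ls' = (2, 1) # rs'" "successively lattice_step ls'"
      using * dap[of ls'] by (auto simp: coherent_lattice_path_iff)
    show "ls = ls'"
      using lattice_path_determined[of "(2, 1)" rs rs'] rs rs' *(3) by simp
  qed
  show "map sort_pair ` {ls. coherent_lattice_path n ls} = Cons (1, 2) ` {ps. accepts n False 0 (1, 2) ps}"
  proof (intro set_eqI iffI)
    fix qs assume "qs \<in> map sort_pair ` {ls. coherent_lattice_path n ls}"
    then obtain ls where ls: "coherent_lattice_path n ls" "qs = map sort_pair ls" by auto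
    then obtain rs where rs: "ls = (2, 1) # rs" "successively lattice_step ls" "\<forall>p\<in>set ls. fst p \<noteq> snd p"
      "sort_pair (last ls) = (n - 1, n)"
      using dap[of ls] by (auto simp: coherent_lattice_path_iff)
    have "qs = (1, 2) # map sort_pair rs" by (simp add: ls rs start)
    moreover have "accepts n False 0 (1, 2) (map sort_pair rs)"
      using successively_sort_pair[OF rs(2,3)] rs(4) ls(1) \<open>ls = (2, 1) # rs\<close>
      unfolding accepts_iff calculation[symmetric] ls(2)
      by (auto simp: coherent_lattice_path_iff last_map split: if_splits)
    ultimately show "qs \<in> Cons (1, 2) ` {ps. accepts n False 0 (1, 2) ps}" by simp
  next
    fix qs assume "qs \<in> Cons (1, 2) ` {ps. accepts n False 0 (1, 2) ps}"
    then obtain ps where qs: "qs = (1, 2) # ps" and acc: "accepts n False 0 (1, 2) ps" by auto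
    from acc have path: "successively pair_move ((1, 2) # ps)" "last ((1, 2) # ps) = (n - 1, n)"
      "sorted_wrt compatible (consec pair_step ((1, 2) # ps))" unfolding accepts_iff by blast+
    obtain rs where rs: "map sort_pair rs = ps" "successively lattice_step ((2, 1) # rs)"
      "\<forall>p\<in>set ((2, 1) # rs). fst p \<noteq> snd p"
      using pair_path_lift[of "(2, 1)" ps] path(1) start by auto
    let ?ls = "(2, 1) # rs"
    have m: "map sort_pair ?ls = (1, 2) # ps" using rs start by simp
    have "sort_pair (last ?ls) = (n - 1, n)"
      using path(2) unfolding m[symmetric] by (simp add: last_map split: if_splits)
    then have "last ?ls \<in> {(n - 1, n), (n, n - 1)}"
      using sort_pair_eq_end_iff assms by simp
    moreover have "set ?ls \<subseteq> {1..n} \<times> {1..n}"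
    proof
      fix p assume p: "p \<in> set ?ls"
      then have "sort_pair p \<in> set ((1, 2) # ps)" unfolding m[symmetric] set_map by blast
      from pair_path_mono[OF path(1) this] path(2)
      show "p \<in> {1..n} \<times> {1..n}" by (cases p) (auto simp: sort_pair_def)
    qed
    ultimately have "diagonal_avoiding_path n ?ls"
      using rs(2,3) unfolding diagonal_avoiding_path_def successively_conv_nth by force
    moreover have "sorted_wrt compatible (consec enhanced_step ?ls)"
      using path(3) successively_sort_pair(2)[OF rs(2,3)] m by simp
    ultimately have "coherent_lattice_path n ?ls" by (simp add: coherent_lattice_path_iff)
    then show "qs \<in> map sort_pair ` {ls. coherent_lattice_path n ls}"
      unfolding qs m[symmetric] by blast
  qed
qed

section \<open>Arrangements of lines\<close>

definition line :: "(nat \<Rightarrow> real) \<Rightarrow> (nat \<Rightarrow> real) \<Rightarrow> real \<Rightarrow> nat \<Rightarrow> real" where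
  "line d w t x = w x + t * d x"

text \<open>With increasing slopes and \<open>i < j\<close> this is the event that the second place
  passes from \<open>i\<close> to the steeper line \<open>j\<close> while \<open>a\<close> is on
  top.\<close>

fun crossing :: "(nat \<Rightarrow> real) \<Rightarrow> (nat \<Rightarrow> real) \<Rightarrow> nat set \<Rightarrow> real \<Rightarrow> nat \<times> nat \<times> nat \<Rightarrow> bool" where
  "crossing d w U t (i, j, a) \<longleftrightarrow> line d w t i = line d w t j \<and> line d w t i < line d w t a \<and>
     (\<forall>x\<in>U - {i, j, a}. line d w t x < line d w t i)"

lemma line_diff: "line d w t x - line d w t' x = (t - t') * d x"
  by (simp add: line_def algebra_simps)

lemma line_less_later:
  assumes "line d w t x \<le> line d w t y" "t < t'" "d x < d y"
  shows "line d w t' x < line d w t' y"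
proof -
  have "(t' - t) * d x < (t' - t) * d y" using assms by simp
  then show ?thesis using assms(1) line_diff[of d w t' x t] line_diff[of d w t' y t] by linarith
qed

lemma line_fun_upd: "x \<noteq> y \<Longrightarrow> line d (w(y := v)) t x = line d w t x"
  by (simp add: line_def)

lemma pair_step_cases:
  assumes "pair_move p q" "pair_step p q = (i, j, a)"
  shows "i < j" "i \<noteq> a" "j \<noteq> a" "{fst p, snd p} = {i, a}" "{fst q, snd q} = {j, a}"
  using assms by (auto simp: pair_move_def pair_step_def split: if_splits)

text \<open>Lines that may still overtake an entry of \<open>p\<close> are steeper, so they lie strictly below it.\<close>

definition dominates :: "(nat \<Rightarrow> real) \<Rightarrow> (nat \<Rightarrow> real) \<Rightarrow> nat set \<Rightarrow> real \<Rightarrow> nat \<times> nat \<Rightarrow> bool" where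
  "dominates d w U t p \<longleftrightarrow>
     (\<forall>x\<in>U - {fst p, snd p}. \<forall>y\<in>{fst p, snd p}. x < y \<or> line d w t x < line d w t y)"

lemma crossing_imp_dominates:
  assumes "pair_move p q" "crossing d w U t (pair_step p q)"
  shows "dominates d w U t q"
proof -
  obtain i j a where e: "pair_step p q = (i, j, a)" by (cases "pair_step p q")
  note c = pair_step_cases[OF assms(1) e]
  show ?thesis
    unfolding dominates_def c(5)
  proof (intro ballI)
    fix x y assume *: "x \<in> U - {j, a}" "y \<in> {j, a}"
    have "line d w t x < line d w t i" if "x \<noteq> i"
      using assms(2)[unfolded e crossing.simps] * that by blast
    then show "x < y \<or> line d w t x < line d w t y"
      using assms(2) * c(1,2,3) unfolding e by (cases "x = i") auto
  qed
qed

text \<open>At \<open>t0\<close> the line \<open>j\<close> is strictly below \<open>i\<close>, and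
  it is steeper. So the two can meet only afterwards.\<close>

lemma crossing_time:
  assumes "dominates d w U t0 p" "pair_move p q" "crossing d w U t (pair_step p q)"
    and "strict_mono_on U d" "{fst p, snd p} \<subseteq> U" "{fst q, snd q} \<subseteq> U"
  shows "t0 < t"
proof (rule ccontr)
  assume neg: "\<not> t0 < t"
  obtain i j a where e: "pair_step p q = (i, j, a)" by (cases "pair_step p q")
  note c = pair_step_cases[OF assms(2) e]
  have U: "i \<in> U" "j \<in> U" "a \<in> U" using assms(5,6) unfolding c(4,5) by auto
  have "line d w t0 j < line d w t0 i"
    using assms(1) c(1,2,3) U(2) unfolding dominates_def c(4) by (metis Diff_iff insert_iff order_less_asym singletonD)
  moreover have "line d w t i = line d w t j" using assms(3) unfolding e by simp
  moreover have "d i < d j" using assms(4) U c(1) by (simp add: strict_mono_on_def)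
  ultimately show False
    using neg line_less_later[of d w t i j t0] by (cases "t = t0") auto
qed

text \<open>The crossing times are given for each step separately, with no order among them.
  Domination passes from each pair to the next and forces the times to increase along the
  path.\<close>

lemma later_crossings:
  assumes "successively pair_move (p # ps)" "\<forall>q\<in>set (p # ps). {fst q, snd q} \<subseteq> U"
    and "\<forall>e\<in>set (consec pair_step (p # ps)). \<exists>t. crossing d w U t e"
    and "dominates d w U t0 p" "strict_mono_on U d" "e \<in> set (consec pair_step (p # ps))"
  shows "\<exists>t>t0. crossing d w U t e"
  using assms
proof (induction ps arbitrary: p t0)
  case Nil
  then show ?case by simp
next
  case (Cons q ps)
  obtain t1 where t1: "crossing d w U t1 (pair_step p q)" using Cons.prems(3) by auto
  have move: "pair_move p q" using Cons.prems(1) by simp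
  have "t0 < t1"
    by (rule crossing_time[OF Cons.prems(4) move t1 Cons.prems(5)]) (use Cons.prems(2) in auto)
  moreover have "\<exists>t>t1. crossing d w U t e" if "e \<in> set (consec pair_step (q # ps))"
    using Cons.IH[OF _ _ _ crossing_imp_dominates[OF move t1] Cons.prems(5) that] Cons.prems(1,2,3)
    by simp
  ultimately show ?case
    using Cons.prems(6) t1 by (cases "e = pair_step p q") (auto intro: less_trans)
qed

text \<open>Let \<open>x < j\<close> and \<open>x \<noteq> a\<close>. At the crossing of the earlier
  step \<open>x\<close> is not above \<open>j\<close>, so ever after the steeper line
  \<open>j\<close> is strictly above \<open>x\<close>. When a later step starts at \<open>x\<close>,
  only its top line \<open>z\<close> is above \<open>x\<close>, hence \<open>j = z\<close>.\<close>

lemma crossings_imp_compatible: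
  assumes "successively pair_move ps" "\<forall>q\<in>set ps. {fst q, snd q} \<subseteq> U"
    and "\<forall>e\<in>set (consec pair_step ps). \<exists>t. crossing d w U t e" "strict_mono_on U d"
  shows "sorted_wrt compatible (consec pair_step ps)"
  using assms
proof (induction ps rule: induct_list012)
  case (3 p q ps)
  obtain t1 where t1: "crossing d w U t1 (pair_step p q)" using "3.prems"(3) by auto
  have move: "pair_move p q" using "3.prems"(1) by simp
  obtain i j a where e: "pair_step p q = (i, j, a)" by (cases "pair_step p q")
  note c = pair_step_cases[OF move e]
  have U: "i \<in> U" "j \<in> U" "a \<in> U"
    using "3.prems"(2) c(4,5) by (metis insert_subset list.set_intros(1,2))+
  have "compatible (i, j, a) f" if f: "f \<in> set (consec pair_step (q # ps))" for f
  proof -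
    obtain x y z where xyz: "f = (x, y, z)" by (cases f)
    have "\<exists>t>t1. crossing d w U t f"
      by (rule later_crossings[OF _ _ _ crossing_imp_dominates[OF move t1] "3.prems"(4) f])
        (use "3.prems"(1,2,3) in auto)
    then obtain t where t: "t1 < t" "crossing d w U t (x, y, z)" by (auto simp: xyz)
    have "x \<in> U"
      using f "3.prems"(1,2) unfolding xyz
    proof (induction ps arbitrary: q p)
      case (Cons r ps)
      obtain i j a where e: "pair_step q r = (i, j, a)" by (cases "pair_step q r")
      have "pair_move q r" "{fst q, snd q} \<subseteq> U" using Cons.prems(2,3) by auto
      then have "i \<in> U" using pair_step_cases(4)[OF _ e] by blast
      then show ?case using Cons.IH[of r q] Cons.prems e by auto
    qed simp
    have "j = z" if "x < j" "x \<noteq> a"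
    proof (rule ccontr)
      assume "j \<noteq> z"
      have "line d w t1 x \<le> line d w t1 j"
        using t1 that \<open>x \<in> U\<close> unfolding e by (cases "x = i") (auto intro: less_imp_le)
      moreover have "d x < d j" using "3.prems"(4) U \<open>x \<in> U\<close> that by (simp add: strict_mono_on_def)
      ultimately have "line d w t x < line d w t j" using t(1) by (intro line_less_later)
      moreover have "line d w t j < line d w t x" if "j \<noteq> y"
        using t(2)[unfolded crossing.simps] U(2) that \<open>j \<noteq> z\<close> \<open>x < j\<close> by blast
      ultimately show False using t(2) by (cases "j = y") auto
    qed
    then show ?thesis by (auto simp: xyz)
  qed
  then show ?case using "3.IH" "3.prems" by (simp add: e)
qed auto

text \<open>A time after \<open>\<tau>\<close> at which a new line \<open>y\<close> can cross \<open>s\<close>, with \<open>l\<close> on top, without disturbing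
  the crossings recorded in \<open>E\<close>.\<close>

abbreviation crossing_slot where
  "crossing_slot d w U E \<tau> s l y \<equiv> \<exists>t>\<tau>. line d w t s < line d w t l \<and>
     (\<forall>x\<in>U - {s, l}. line d w t x < line d w t s) \<and>
     (\<forall>(r, i, j, a)\<in>E. line d w t s - (t - r) * d y < line d w r i)"

text \<open>Every requirement holds for all large \<open>t\<close>. The steeper line
  \<open>l\<close> ends up above \<open>s\<close>, and the flatter lines stay below. Moving the
  meeting point to the right along \<open>s\<close> lowers the steeper line \<open>y\<close> at any
  fixed past time without bound.\<close>

lemma late_crossing_time:
  assumes "finite U" "finite E" "s < l" "d s < d l" "d s < d y"
    and "\<forall>x\<in>U - {s, l}. d x < d s \<and> line d w \<tau> x \<le> line d w \<tau> s"
  shows "crossing_slot d w U E \<tau> s l y"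
proof -
  have lin: "eventually (\<lambda>t. A - t * B < (0::real)) at_top" if "B > 0" for A B
  proof -
    have "eventually (\<lambda>t. t > A / B) at_top" by (rule eventually_gt_at_top)
    then show ?thesis by eventually_elim (use that in \<open>simp add: field_simps\<close>)
  qed
  have "eventually (\<lambda>t. line d w t s < line d w t l) at_top"
    using lin[OF iffD2[OF diff_gt_0_iff_gt assms(4)], of "w s - w l"]
    by eventually_elim (simp_all add: line_def algebra_simps)
  moreover have "eventually (\<lambda>t. \<forall>e\<in>E. line d w t s - (t - fst e) * d y < line d w (fst e) (fst (snd e))) at_top"
  proof (rule eventually_ball_finite[OF assms(2)], rule ballI)
    fix e assume "e \<in> E"
    show "eventually (\<lambda>t. line d w t s - (t - fst e) * d y < line d w (fst e) (fst (snd e))) at_top"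
      using lin[OF iffD2[OF diff_gt_0_iff_gt assms(5)], of "w s + fst e * d y - line d w (fst e) (fst (snd e))"]
      by eventually_elim (simp_all add: line_def algebra_simps)
  qed
  ultimately have "eventually (\<lambda>t. t > \<tau> \<and> line d w t s < line d w t l \<and>
      (\<forall>e\<in>E. line d w t s - (t - fst e) * d y < line d w (fst e) (fst (snd e)))) at_top"
    by (intro eventually_conj eventually_gt_at_top)
  then obtain t where t: "t > \<tau>" "line d w t s < line d w t l"
    "\<forall>e\<in>E. line d w t s - (t - fst e) * d y < line d w (fst e) (fst (snd e))"
    using eventually_happens by fastforce
  have "\<forall>x\<in>U - {s, l}. line d w t x < line d w t s"
    using assms(6) t(1) line_less_later by blast
  then show ?thesis using t by (intro exI[of _ t]) force
qed

text \<open>If the line \<open>j\<close> is going to cross \<open>s\<close>, then the new line \<open>y\<close> has to cross \<open>s\<close> just before.\<close>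

lemma early_crossing_time:
  assumes "finite E" "d s < d j" "d j < d l" "d j < d y"
    and "line d w \<tau> j \<le> line d w \<tau> l" "line d w \<tau> j < line d w \<tau> s"
    and U: "\<forall>x\<in>U - {s, l}. (x = j \<or> d x < d j \<and> line d w \<tau> x \<le> line d w \<tau> j)
      \<or> d x < d s \<and> line d w \<tau> x \<le> line d w \<tau> s"
    and E: "\<forall>(r, i, k, a)\<in>E. r \<le> \<tau> \<and> line d w r j \<le> line d w r i"
  shows "crossing_slot d w U E \<tau> s l y"
proof -
  \<comment> \<open>The meeting time of \<open>s\<close> and \<open>j\<close>. From then on
    \<open>j\<close> is no longer below \<open>s\<close>, so the slot has to be found to the left of
    \<open>t0\<close>, where the conditions hold by continuity.\<close>
  define t0 where "t0 = (w s - w j) / (d j - d s)"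
  have cross: "line d w t0 s = line d w t0 j"
    using assms(2) by (simp add: t0_def line_def field_simps)
  have before: "line d w t j < line d w t s \<longleftrightarrow> t < t0" for t
    using assms(2) by (simp add: t0_def line_def field_simps)
  have \<tau>: "\<tau> < t0" using assms(6) before by simp
  have cont: "((\<lambda>t. line d w t x) \<longlongrightarrow> line d w t0 x) (at_left t0)" for x
    unfolding line_def by (intro tendsto_intros)
  have "line d w t0 s < line d w t0 l"
    using line_less_later[OF assms(5) \<tau> assms(3)] cross by simp
  then have "eventually (\<lambda>t. 0 < line d w t l - line d w t s) (at_left t0)"
    by (intro order_tendstoD(1)[OF tendsto_diff[OF cont cont]]) simp
  moreover have "eventually (\<lambda>t. \<forall>e\<in>E. line d w t s - (t - fst e) * d y < line d w (fst e) (fst (snd e))) (at_left t0)"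
  proof (rule eventually_ball_finite[OF assms(1)], rule ballI)
    fix e assume e: "e \<in> E"
    then have le: "fst e \<le> \<tau>" "line d w (fst e) j \<le> line d w (fst e) (fst (snd e))" using E by auto
    \<comment> \<open>In the limit the new line passes through the meeting point of \<open>s\<close>
      and \<open>j\<close>. Being steeper than \<open>j\<close>, it was below \<open>j\<close>
      before, and \<open>j\<close> was at or below every recorded crossing.\<close>
    have "(t0 - fst e) * d j < (t0 - fst e) * d y" using le \<tau> assms(4) by simp
    then have "line d w t0 s - (t0 - fst e) * d y < line d w (fst e) (fst (snd e))"
      using le(2) cross line_diff[of d w t0 j "fst e"] by linarith
    moreover have "((\<lambda>t. line d w t s - (t - fst e) * d y) \<longlongrightarrow> line d w t0 s - (t0 - fst e) * d y) (at_left t0)"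
      by (intro tendsto_intros cont)
    ultimately show "eventually (\<lambda>t. line d w t s - (t - fst e) * d y < line d w (fst e) (fst (snd e))) (at_left t0)"
      by (auto dest: order_tendstoD)
  qed
  moreover have "eventually (\<lambda>t. \<tau> < t) (at_left t0)"
    by (rule eventually_at_left_real[OF \<tau>, THEN eventually_mono]) auto
  moreover have "eventually (\<lambda>t. t < t0) (at_left t0)"
    by (rule eventually_at_left_real[OF \<tau>, THEN eventually_mono]) auto
  ultimately have "eventually (\<lambda>t. t < t0 \<and> \<tau> < t \<and> line d w t s < line d w t l \<and>
      (\<forall>e\<in>E. line d w t s - (t - fst e) * d y < line d w (fst e) (fst (snd e)))) (at_left t0)"
    by eventually_elim auto
  then obtain t where t: "t < t0" "\<tau> < t" "line d w t s < line d w t l"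
      "\<forall>e\<in>E. line d w t s - (t - fst e) * d y < line d w (fst e) (fst (snd e))"
    using eventually_happens[of _ "at_left t0"] by fastforce
  have "line d w t x < line d w t s" if "x \<in> U - {s, l}" for x
    using U[rule_format, OF that] line_less_later[of d w \<tau> x j t] line_less_later[of d w \<tau> x s t] t(1,2)
      before[of t] by fastforce
  then show ?thesis using t by (intro exI[of _ t]) force
qed

section \<open>Realising an accepted sequence by inserting lines\<close>

definition past_crossings :: "(nat \<Rightarrow> real) \<Rightarrow> (nat \<Rightarrow> real) \<Rightarrow> nat set \<Rightarrow> real \<Rightarrow> (real \<times> nat \<times> nat \<times> nat) set \<Rightarrow> bool" where
  "past_crossings d w U \<tau> E \<longleftrightarrow> finite E \<and>
     (\<forall>(r, i, j, a)\<in>E. r \<le> \<tau> \<and> crossing d w U r (i, j, a) \<and> {i, j, a} \<subseteq> U)"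

text \<open>\<open>U\<close> is the set of lines inserted so far. The larger entry of the current
  pair is always the steepest of them.\<close>

definition top_pair :: "nat \<Rightarrow> nat set \<Rightarrow> nat \<Rightarrow> nat \<Rightarrow> bool" where
  "top_pair n U s l \<longleftrightarrow> U \<subseteq> {1..n} \<and> s \<in> U \<and> l \<in> U \<and> s < l \<and> (\<forall>x\<in>U. x \<le> l)"

lemma top_pairD:
  assumes "top_pair n U s l"
  shows "U \<subseteq> {1..n}" "s \<in> U" "l \<in> U" "s < l" "\<forall>x\<in>U. x \<le> l" "l \<le> n"
  using assms unfolding top_pair_def by auto

lemma top_pair_mono:
  assumes "strict_mono_on {1..n} d" "top_pair n U s l" "x \<in> U" "x < y" "y \<le> n"
  shows "d x < d y"
  using assms(3-5) top_pairD(1)[OF assms(2)] by (intro strict_mono_onD[OF assms(1)]) auto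

text \<open>The geometric meaning of \<open>b\<close>. The line \<open>l\<close> is on top for good
  and all other lines of \<open>U\<close> are flatter than \<open>s\<close> and not above it. So
  nothing inserted so far can disturb \<open>s\<close>, and the next crossing may be arbitrarily
  late.\<close>

definition frozen_state ::
  "(nat \<Rightarrow> real) \<Rightarrow> (nat \<Rightarrow> real) \<Rightarrow> nat set \<Rightarrow> (real \<times> nat \<times> nat \<times> nat) set \<Rightarrow> real \<Rightarrow> nat \<Rightarrow> nat \<Rightarrow> bool" where
  "frozen_state d w U E \<tau> s l \<longleftrightarrow> past_crossings d w U \<tau> E \<and> line d w \<tau> s < line d w \<tau> l \<and>
     (\<forall>x\<in>U - {s, l}. x < s \<and> line d w \<tau> x \<le> line d w \<tau> s)"

text \<open>The geometric meaning of the state without \<open>b\<close>: the larger entry holds the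
  second place, under \<open>s\<close>. It passes at or below all recorded crossings, so a steeper
  line that crosses it later passes below them too. If \<open>s < j\<close>, then \<open>j\<close>
  is the line that \<open>l\<close> has just overtaken. It will cross \<open>s\<close> in turn, it
  is the steepest and highest among the other lines steeper than \<open>s\<close>, and it also
  passes at or below the recorded crossings.\<close>

definition free_state ::
  "(nat \<Rightarrow> real) \<Rightarrow> (nat \<Rightarrow> real) \<Rightarrow> nat set \<Rightarrow> (real \<times> nat \<times> nat \<times> nat) set \<Rightarrow> nat \<Rightarrow> real \<Rightarrow> nat \<Rightarrow> nat \<Rightarrow> bool" where
  "free_state d w U E j \<tau> s l \<longleftrightarrow> past_crossings d w U \<tau> E \<and> line d w \<tau> l < line d w \<tau> s \<and>
     (\<forall>x\<in>U - {s, l}. line d w \<tau> x \<le> line d w \<tau> l) \<and>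
     (\<forall>(r, i, k, a)\<in>E. line d w r l \<le> line d w r i) \<and>
     (if s < j then j \<in> U \<and> j < l \<and>
        (\<forall>x\<in>U - {s, l}. s < x \<longrightarrow> x \<le> j \<and> line d w \<tau> x \<le> line d w \<tau> j) \<and>
        (\<forall>(r, i, k, a)\<in>E. line d w r j \<le> line d w r i)
      else \<forall>x\<in>U - {s, l}. x < s)"

lemma past_crossings_mono: "past_crossings d w U \<tau> E \<Longrightarrow> \<tau> \<le> t \<Longrightarrow> past_crossings d w U t E"
  unfolding past_crossings_def by fastforce

lemma past_crossings_insert:
  "past_crossings d w U t (insert (r, i, j, a) E) \<longleftrightarrow> past_crossings d w U t E \<and>
     r \<le> t \<and> crossing d w U r (i, j, a) \<and> i \<in> U \<and> j \<in> U \<and> a \<in> U"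
  unfolding past_crossings_def by auto

text \<open>The new weight is dictated by the point where \<open>y\<close> is to meet
  \<open>s\<close> at time \<open>t\<close>. A recorded crossing survives because \<open>y\<close>
  passes below it.\<close>

lemma add_line:
  assumes "past_crossings d w U \<tau> E" "y \<notin> U" "s \<in> U" "l \<in> U" "s \<noteq> l" "\<tau> < t"
    and "line d w t s < line d w t l" "\<forall>x\<in>U - {s, l}. line d w t x < line d w t s"
    and below: "\<forall>(r, i, j, a)\<in>E. line d w t s - (t - r) * d y < line d w r i"
  obtains w' where "past_crossings d w' (insert y U) t (insert (t, s, y, l) E)"
    "\<And>x r. x \<in> U \<Longrightarrow> line d w' r x = line d w r x"
    "\<And>r. line d w' r y = line d w t s - (t - r) * d y"
proof -
  define w' where "w' = w(y := line d w t s - t * d y)"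
  have old: "line d w' r x = line d w r x" if "x \<in> U" for x r
    using that assms(2) by (auto simp: w'_def intro: line_fun_upd)
  have new: "line d w' r y = line d w t s - (t - r) * d y" for r
    by (simp add: w'_def line_def algebra_simps)
  have "crossing d w' (insert y U) r (i, j, a)" if "(r, i, j, a) \<in> E" for r i j a
  proof -
    have c: "line d w r i = line d w r j" "line d w r i < line d w r a" "i \<in> U" "j \<in> U" "a \<in> U"
      "\<forall>x\<in>U - {i, j, a}. line d w r x < line d w r i" "line d w t s - (t - r) * d y < line d w r i"
      using assms(1) that below unfolding past_crossings_def by auto
    show ?thesis
      unfolding crossing.simps old[OF c(3)] old[OF c(4)] old[OF c(5)]
      using c(1,2,6,7) old new by auto
  qed
  note cross = this
  have "r \<le> \<tau> \<and> crossing d w' (insert y U) r (i, j, a) \<and> {i, j, a} \<subseteq> insert y U"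
    if "(r, i, j, a) \<in> E" for r i j a
    using assms(1) that cross[OF that] unfolding past_crossings_def by (auto simp del: crossing.simps)
  then have "past_crossings d w' (insert y U) \<tau> E"
    using assms(1) unfolding past_crossings_def by (auto simp del: crossing.simps)
  then have "past_crossings d w' (insert y U) t E"
    by (rule past_crossings_mono) (use assms(6) in simp)
  moreover have "crossing d w' (insert y U) t (s, y, l)"
    unfolding crossing.simps old[OF assms(3)] old[OF assms(4)] new
    using assms(7,8) old by auto
  ultimately show ?thesis
    using that[of w'] old new assms(3,4) unfolding past_crossings_insert by auto
qed

lemma frozen_crossing_time:
  assumes "strict_mono_on {1..n} d" "top_pair n U s l" "frozen_state d w U E \<tau> s l" "s < y" "y \<le> n"
  shows "crossing_slot d w U E \<tau> s l y"
proof (rule late_crossing_time)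
  note mono = top_pair_mono[OF assms(1,2)]
  note U = top_pairD(1-4)[OF assms(2)]
  show "finite U" "s < l" using U finite_subset by auto
  show "finite E" using assms(3) unfolding frozen_state_def past_crossings_def by auto
  show "d s < d l" "d s < d y" using mono U assms(4,5) by auto
  show "\<forall>x\<in>U - {s, l}. d x < d s \<and> line d w \<tau> x \<le> line d w \<tau> s"
  proof
    fix x assume x: "x \<in> U - {s, l}"
    then have "x < s \<and> line d w \<tau> x \<le> line d w \<tau> s"
      using assms(3) unfolding frozen_state_def by blast
    then show "d x < d s \<and> line d w \<tau> x \<le> line d w \<tau> s"
      using mono[of x s] x U(2) assms(4,5) by auto
  qed
qed

text \<open>Without a line \<open>j\<close> steeper than \<open>s\<close> there is no deadline and a
  late crossing will do. With such a line the crossing has to precede that of \<open>s\<close> and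
  \<open>j\<close>, and \<open>j < y\<close> makes this possible.\<close>

lemma free_crossing_time:
  assumes "strict_mono_on {1..n} d" "top_pair n U s l" "free_state d w U E j \<tau> s l" "s < y" "j < y" "y \<le> n"
  shows "crossing_slot d w U E \<tau> s l y"
proof -
  note mono = top_pair_mono[OF assms(1,2)]
  note U = top_pairD(1-4,6)[OF assms(2)]
  have fin: "finite U" "finite E"
    using U finite_subset assms(3) unfolding free_state_def past_crossings_def by auto
  have ls: "line d w \<tau> l < line d w \<tau> s" "\<forall>x\<in>U - {s, l}. line d w \<tau> x \<le> line d w \<tau> l"
    using assms(3) unfolding free_state_def by auto
  show ?thesis
  proof (cases "s < j")
    case False
    then have xs: "\<forall>x\<in>U - {s, l}. x < s" using assms(3) unfolding free_state_def by simp
    have "\<forall>x\<in>U - {s, l}. d x < d s \<and> line d w \<tau> x \<le> line d w \<tau> s"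
    proof
      fix x assume x: "x \<in> U - {s, l}"
      then have "x < s" "line d w \<tau> x \<le> line d w \<tau> l" using xs ls(2) by blast+
      then show "d x < d s \<and> line d w \<tau> x \<le> line d w \<tau> s"
        using mono[of x s] x U(4,5) ls(1) by auto
    qed
    moreover have "d s < d l" "d s < d y" using mono[of s l] mono[of s y] U assms(4,6) by auto
    ultimately show ?thesis by (intro late_crossing_time[OF fin U(4)])
  next
    case True
    then have j: "j \<in> U" "j < l" "\<forall>x\<in>U - {s, l}. s < x \<longrightarrow> x \<le> j \<and> line d w \<tau> x \<le> line d w \<tau> j"
      "\<forall>(r, i, k, a)\<in>E. line d w r j \<le> line d w r i"
      using assms(3) unfolding free_state_def by auto
    have jl: "line d w \<tau> j \<le> line d w \<tau> l" using ls(2) j(1,2) True by auto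
    have "\<forall>x\<in>U - {s, l}. (x = j \<or> d x < d j \<and> line d w \<tau> x \<le> line d w \<tau> j)
        \<or> d x < d s \<and> line d w \<tau> x \<le> line d w \<tau> s"
    proof
      fix x assume x: "x \<in> U - {s, l}"
      show "(x = j \<or> d x < d j \<and> line d w \<tau> x \<le> line d w \<tau> j)
        \<or> d x < d s \<and> line d w \<tau> x \<le> line d w \<tau> s"
      proof (cases "s < x")
        case True
        have "x \<le> j" "line d w \<tau> x \<le> line d w \<tau> j" using j(3) x True by blast+
        then show ?thesis using j(2) mono[of x j] x U(5) by auto
      next
        case False
        then have "x < s" using x by auto
        moreover have "line d w \<tau> x \<le> line d w \<tau> s" using ls(1) bspec[OF ls(2) x] by simp
        ultimately show ?thesis using mono[of x s] x U by simp
      qed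
    qed
    moreover have "\<forall>(r, i, k, a)\<in>E. r \<le> \<tau> \<and> line d w r j \<le> line d w r i"
      using j(4) assms(3) unfolding free_state_def past_crossings_def by blast
    moreover have "d s < d j" "d j < d l" "d j < d y"
      using mono[of s j] mono[of j l] mono[of j y] U assms(5,6) True j(1,2) by auto
    moreover have "line d w \<tau> j < line d w \<tau> s" using jl ls(1) by simp
    ultimately show ?thesis
      using jl by (intro early_crossing_time[OF fin(2), of d s j l])
  qed
qed

text \<open>The new line meets \<open>l\<close> at once, before anything else happens. It is steeper
  than \<open>l\<close>, so in the past it runs below \<open>l\<close> and therefore below all
  recorded crossings.\<close>

lemma free_move_large:
  assumes "strict_mono_on {1..n} d" "top_pair n U s l" "free_state d w U E j \<tau> s l" "l < l'" "l' \<le> n"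
  shows "\<exists>t w'. free_state d w' (insert l' U) (insert (t, l, l', s) E) l t s l'"
proof -
  note U = top_pairD(1-5)[OF assms(2)]
  have l': "l' \<notin> U" using U(5) assms(4) by auto
  note mono = top_pair_mono[OF assms(1,2)]
  have st: "past_crossings d w U \<tau> E" "line d w \<tau> l < line d w \<tau> s"
    "\<forall>x\<in>U - {s, l}. line d w \<tau> x \<le> line d w \<tau> l" "\<forall>(r, i, k, a)\<in>E. line d w r l \<le> line d w r i"
    using assms(3) unfolding free_state_def by auto
  \<comment> \<open>A time right after \<tau> keeps \<open>l\<close> below \<open>s\<close>, and it
    separates \<open>l\<close> strictly from lines that may tie with it at \<tau>, since
    \<open>l\<close> is the steepest.\<close>
  have "((\<lambda>t. line d w t s - line d w t l) \<longlongrightarrow> line d w \<tau> s - line d w \<tau> l) (at_right \<tau>)"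
    unfolding line_def by (intro tendsto_intros)
  then have "eventually (\<lambda>t. 0 < line d w t s - line d w t l) (at_right \<tau>)"
    using st(2) by (intro order_tendstoD(1)) auto
  moreover have "eventually (\<lambda>t. \<tau> < t) (at_right \<tau>)" by (rule eventually_at_right_less)
  ultimately have "eventually (\<lambda>t. \<tau> < t \<and> line d w t l < line d w t s) (at_right \<tau>)"
    by eventually_elim simp
  then obtain t where t: "\<tau> < t" "line d w t l < line d w t s"
    using eventually_happens[of _ "at_right \<tau>"] by fastforce
  have others: "line d w t x < line d w t l" if "x \<in> U - {s, l}" for x
  proof (rule line_less_later[OF _ t(1)])
    show "line d w \<tau> x \<le> line d w \<tau> l" using st(3) that by blast
    have "x < l" using that U(5) by (simp add: order_less_le)
    then show "d x < d l" using mono[of x l] that assms(4,5) by simp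
  qed
  have below: "line d w t l - (t - r) * d l' < line d w r l" if "r \<le> \<tau>" for r
  proof -
    have "(t - r) * d l < (t - r) * d l'" using that t(1) mono[of l l'] U assms(4,5) by simp
    then show ?thesis using line_diff[of d w t l r] by linarith
  qed
  have E: "\<forall>(r, i, k, a)\<in>E. line d w t l - (t - r) * d l' < line d w r i"
  proof clarify
    fix r i k a assume e: "(r, i, k, a) \<in> E"
    have "r \<le> \<tau>" using st(1) e unfolding past_crossings_def by auto
    then show "line d w t l - (t - r) * d l' < line d w r i"
      using below[of r] bspec[OF st(4) e] by simp
  qed
  obtain w' where w': "past_crossings d w' (insert l' U) t (insert (t, l, l', s) E)"
    "\<And>x r. x \<in> U \<Longrightarrow> line d w' r x = line d w r x"
    "\<And>r. line d w' r l' = line d w t l - (t - r) * d l'"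
    by (rule add_line[OF st(1) l' U(3,2) _ t(1,2) _ E]) (use U others in auto)
  have i: "i \<in> U" if "(r, i, k, a) \<in> E" for r i k a
    using st(1) that unfolding past_crossings_def by auto
  have "free_state d w' (insert l' U) (insert (t, l, l', s) E) l t s l'"
    unfolding free_state_def
  proof (intro conjI)
    show "line d w' t l' < line d w' t s" using w'(2)[OF U(2)] w'(3) t(2) by simp
    show "\<forall>x\<in>insert l' U - {s, l'}. line d w' t x \<le> line d w' t l'"
    proof
      fix x assume "x \<in> insert l' U - {s, l'}"
      then have x: "x \<in> U" "x \<noteq> s" by auto
      show "line d w' t x \<le> line d w' t l'"
        using others[of x] x w'(2)[OF x(1)] w'(3) by (cases "x = l") auto
    qed
    show "\<forall>(r, i, k, a)\<in>insert (t, l, l', s) E. line d w' r l' \<le> line d w' r i"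
    proof -
      have "line d w' r l' \<le> line d w' r i" if "(r, i, k, a) \<in> E" for r i k a
        using bspec[OF E that] w'(2)[OF i[OF that], of r] w'(3)[of r] by simp
      then show ?thesis using w'(2)[OF U(3), of t] w'(3)[of t] by auto
    qed
    have "\<forall>x\<in>insert l' U - {s, l'}. s < x \<longrightarrow> x \<le> l \<and> line d w' t x \<le> line d w' t l"
    proof (intro ballI impI)
      fix x assume "x \<in> insert l' U - {s, l'}" "s < x"
      then have x: "x \<in> U" "x \<noteq> s" by auto
      show "x \<le> l \<and> line d w' t x \<le> line d w' t l"
        using others[of x] x w'(2)[OF x(1)] w'(2)[OF U(3)] U(5) by (cases "x = l") auto
    qed
    moreover have "\<forall>(r, i, k, a)\<in>insert (t, l, l', s) E. line d w' r l \<le> line d w' r i"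
    proof -
      have "line d w' r l \<le> line d w' r i" if "(r, i, k, a) \<in> E" for r i k a
        using bspec[OF st(4) that] w'(2)[OF i[OF that], of r] w'(2)[OF U(3), of r] by simp
      then show ?thesis by auto
    qed
    ultimately show "if s < l then l \<in> insert l' U \<and> l < l' \<and>
        (\<forall>x\<in>insert l' U - {s, l'}. s < x \<longrightarrow> x \<le> l \<and> line d w' t x \<le> line d w' t l) \<and>
        (\<forall>(r, i, k, a)\<in>insert (t, l, l', s) E. line d w' r l \<le> line d w' r i)
      else \<forall>x\<in>insert l' U - {s, l'}. x < s" using U assms(4) by simp
  qed (use w'(1) in auto)
  then show ?thesis by blast
qed

lemma new_line_small:
  assumes "top_pair n U s l" "past_crossings d w U \<tau> E" "y \<notin> U" "s < y" "y < l" "\<forall>x\<in>U - {s, l}. x < y"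
    and "\<tau> < t" "line d w t s < line d w t l" "\<forall>x\<in>U - {s, l}. line d w t x < line d w t s"
    and "\<forall>(r, i, j, a)\<in>E. line d w t s - (t - r) * d y < line d w r i"
  shows "\<exists>w'. frozen_state d w' (insert y U) (insert (t, s, y, l) E) t y l"
proof -
  note U = top_pairD(1-5)[OF assms(1)]
  obtain w' where w': "past_crossings d w' (insert y U) t (insert (t, s, y, l) E)"
    "\<And>x r. x \<in> U \<Longrightarrow> line d w' r x = line d w r x"
    "\<And>r. line d w' r y = line d w t s - (t - r) * d y"
    by (rule add_line[OF assms(2,3) U(2,3) _ assms(7-10)]) (use U in auto)
  have "x < y \<and> line d w' t x \<le> line d w' t y" if "x \<in> insert y U - {y, l}" for x
    using that assms(4) bspec[OF assms(6), of x] bspec[OF assms(9), of x] w'(2)[of x t] w'(3)[of t]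
    by (cases "x = s") auto
  then have "frozen_state d w' (insert y U) (insert (t, s, y, l) E) t y l"
    unfolding frozen_state_def using w'(1) w'(2)[OF U(3)] w'(3) assms(8) by auto
  then show ?thesis by blast
qed

text \<open>Here \<open>y\<close> takes the second place from \<open>s\<close> but becomes the
  larger entry, and \<open>l\<close> becomes the smaller one. Apart from \<open>y\<close> no line is
  steeper than \<open>l\<close>, so the new state carries the bound 0.\<close>

lemma new_line_large:
  assumes "top_pair n U s l" "past_crossings d w U \<tau> E" "l < y"
    and "\<tau> < t" "line d w t s < line d w t l" "\<forall>x\<in>U - {s, l}. line d w t x < line d w t s"
    and E: "\<forall>(r, i, j, a)\<in>E. line d w t s - (t - r) * d y < line d w r i"
  shows "\<exists>w'. free_state d w' (insert y U) (insert (t, s, y, l) E) 0 t l y"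
proof -
  note U = top_pairD(1-5)[OF assms(1)]
  have y: "y \<notin> U" using U(5) assms(3) by auto
  obtain w' where w': "past_crossings d w' (insert y U) t (insert (t, s, y, l) E)"
    "\<And>x r. x \<in> U \<Longrightarrow> line d w' r x = line d w r x"
    "\<And>r. line d w' r y = line d w t s - (t - r) * d y"
    by (rule add_line[OF assms(2) y U(2,3) _ assms(4-7)]) (use U in auto)
  have i: "i \<in> U" if "(r, i, k, a) \<in> E" for r i k a
    using assms(2) that unfolding past_crossings_def by auto
  have "line d w' t x \<le> line d w' t y" if "x \<in> insert y U - {l, y}" for x
    using that bspec[OF assms(6), of x] w'(2)[of x t] w'(3)[of t] by (cases "x = s") auto
  moreover have "\<forall>(r, i, k, a)\<in>insert (t, s, y, l) E. line d w' r y \<le> line d w' r i"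
  proof -
    have "line d w' r y \<le> line d w' r i" if "(r, i, k, a) \<in> E" for r i k a
      using bspec[OF E that] w'(2)[OF i[OF that], of r] w'(3)[of r] by simp
    then show ?thesis using w'(2)[OF U(2), of t] w'(3)[of t] by auto
  qed
  moreover have "\<forall>x\<in>insert y U - {l, y}. x < l" using U(5) by (auto simp: order_less_le)
  ultimately have "free_state d w' (insert y U) (insert (t, s, y, l) E) 0 t l y"
    unfolding free_state_def using w'(1) w'(2)[OF U(3)] w'(3) assms(5) by auto
  then show ?thesis by blast
qed

text \<open>The case in which the smaller entry moves back to the line \<open>j\<close> that the larger entry
  left in the preceding step.\<close>

lemma free_move_back:
  assumes "strict_mono_on {1..n} d" "top_pair n U s l" "free_state d w U E j \<tau> s l" "s < j"
  shows "\<exists>t. frozen_state d w U (insert (t, s, j, l) E) t j l"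
proof -
  note U = top_pairD(1-4,6)[OF assms(2)]
  note mono = top_pair_mono[OF assms(1,2)]
  have st: "past_crossings d w U \<tau> E" "line d w \<tau> l < line d w \<tau> s"
    "\<forall>x\<in>U - {s, l}. line d w \<tau> x \<le> line d w \<tau> l"
    and j: "j \<in> U" "j < l" "\<forall>x\<in>U - {s, l}. s < x \<longrightarrow> x \<le> j \<and> line d w \<tau> x \<le> line d w \<tau> j"
    using assms(3,4) unfolding free_state_def by auto
  have jl: "line d w \<tau> j \<le> line d w \<tau> l" using st(3) j(1,2) assms(4) by auto
  \<comment> \<open>No line is added. Both \<open>s\<close> and \<open>j\<close> are present
    already, and this is the time at which they meet.\<close>
  define t where "t = (w s - w j) / (d j - d s)"
  have dsj: "d s < d j" using mono U j assms(4) by auto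
  have cross: "line d w t s = line d w t j"
    using dsj by (simp add: t_def line_def field_simps)
  have "line d w \<tau> j < line d w \<tau> s \<longleftrightarrow> \<tau> < t"
    using dsj by (simp add: t_def line_def field_simps)
  then have t: "\<tau> < t" using jl st(2) by simp
  have top: "line d w t j < line d w t l"
    using line_less_later[OF jl t] mono[of j l] j U by simp
  have others: "x < j \<and> line d w t x < line d w t j" if x: "x \<in> U - {s, j, l}" for x
  proof (cases "s < x")
    case True
    with j(3) x have "x < j" "line d w \<tau> x \<le> line d w \<tau> j" by force+
    then show ?thesis using line_less_later[OF _ t] mono[of x j] j U x by auto
  next
    case False
    then have "x < s" using x by auto
    moreover have "line d w \<tau> x \<le> line d w \<tau> s" using st x by force
    ultimately show ?thesis
      using line_less_later[OF _ t, of d w x s] mono[of x s] U x cross assms(4) by auto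
  qed
  have "crossing d w U t (s, j, l)" using cross top others by auto
  then have "past_crossings d w U t (insert (t, s, j, l) E)"
    unfolding past_crossings_insert using past_crossings_mono[OF st(1), of t] t U j by auto
  moreover have "x < j \<and> line d w t x \<le> line d w t j" if "x \<in> U - {j, l}" for x
    using that others[of x] cross assms(4) by (cases "x = s") auto
  ultimately have "frozen_state d w U (insert (t, s, j, l) E) t j l"
    unfolding frozen_state_def using top by auto
  then show ?thesis by blast
qed

text \<open>The lines that are never visited are placed so low that they pass below all of the
  finitely many recorded crossings.\<close>

lemma extend_to_all_lines:
  assumes "past_crossings d w U \<tau> E" "U \<subseteq> {1..n}"
  shows "\<exists>w'. \<forall>(r, i, j, a)\<in>E. crossing d w' {1..n} r (i, j, a)"
proof -
  have fin: "finite E" using assms(1) unfolding past_crossings_def by simp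
  \<comment> \<open>The largest weight with which \<open>x\<close> stays at or below every recorded
    crossing, capped at 0 so that the minimum also exists for empty \<open>E\<close>. Subtracting 1
    below makes the inequalities strict.\<close>
  define m where "m x = Min (insert 0 ((\<lambda>(r, i, j, a). line d w r i - r * d x) ` E))" for x
  define w' where "w' = (\<lambda>x. if x \<in> U then w x else m x - 1)"
  have old: "line d w' r x = line d w r x" if "x \<in> U" for x r
    using that by (simp add: w'_def line_def)
  have "crossing d w' {1..n} r (i, j, a)" if e: "(r, i, j, a) \<in> E" for r i j a
  proof -
    have c: "line d w r i = line d w r j" "line d w r i < line d w r a" "i \<in> U" "j \<in> U" "a \<in> U"
      "\<forall>x\<in>U - {i, j, a}. line d w r x < line d w r i"
      using assms(1) that unfolding past_crossings_def by auto
    have new: "line d w' r x < line d w r i" if "x \<notin> U" for x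
    proof -
      have "m x \<le> line d w r i - r * d x"
        using fin e unfolding m_def by (intro Min_le) force+
      moreover have "line d w' r x = m x - 1 + r * d x"
        using that unfolding line_def w'_def by simp
      ultimately show ?thesis by linarith
    qed
    show ?thesis
      unfolding crossing.simps old[OF c(3)] old[OF c(4)] old[OF c(5)]
      using c(1,2,6) old new by (metis Diff_iff)
  qed
  then show ?thesis by blast
qed

text \<open>\<open>E\<close> holds the crossings realised so far. The conclusion demands them again
  for the final weights, since later insertions must not destroy them. The bit \<open>b\<close>
  selects the invariant.\<close>

lemma accepts_imp_crossings:
  assumes "accepts n b j (s, l) ps" "strict_mono_on {1..n} d" "top_pair n U s l"
    and "if b then frozen_state d w U E \<tau> s l \<and> j = 0 else free_state d w U E j \<tau> s l \<and> j < l"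
  shows "\<exists>w'. (\<forall>(r, i, j, a)\<in>E. crossing d w' {1..n} r (i, j, a)) \<and>
    (\<forall>e\<in>set (consec pair_step ((s, l) # ps)). \<exists>t. crossing d w' {1..n} t e)"
  using assms
proof (induction ps arbitrary: b j s l w U E \<tau>)
  case Nil
  then have "past_crossings d w U \<tau> E" "U \<subseteq> {1..n}"
    by (auto simp: frozen_state_def free_state_def top_pair_def split: if_splits)
  from extend_to_all_lines[OF this] show ?case by simp
next
  case (Cons q ps)
  obtain u v where q: "q = (u, v)" by (cases q)
  note U = top_pairD(1-5)[OF Cons.prems(3)]
  have past: "past_crossings d w U \<tau> E"
    using Cons.prems(4) by (auto simp: frozen_state_def free_state_def split: if_splits)
  have "u < v" "v \<le> n" using Cons.prems(1) by (auto simp: q)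
  consider (1) "\<not> b" "u = s" "l < v" "accepts n False l (u, v) ps"
    | (2) "v = l" "s < u" "j \<le> u" "accepts n True 0 (u, v) ps"
    | (3) "u = l" "accepts n False 0 (u, v) ps"
    using Cons.prems(1) by (auto simp: q)
  then have "\<exists>b' j' w' U' t. accepts n b' j' (u, v) ps \<and> top_pair n U' u v \<and>
    (if b' then frozen_state d w' U' (insert (t, pair_step (s, l) q) E) t u v \<and> j' = 0
     else free_state d w' U' (insert (t, pair_step (s, l) q) E) j' t u v \<and> j' < v)"
  proof cases
    case 1
    then obtain t w' where "free_state d w' (insert v U) (insert (t, l, v, s) E) l t s v"
      using free_move_large[OF Cons.prems(2,3) _ \<open>l < v\<close> \<open>v \<le> n\<close>, of w E j \<tau>] Cons.prems(4) by auto
    moreover have "top_pair n (insert v U) s v"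
      using U 1 \<open>v \<le> n\<close> unfolding top_pair_def by fastforce
    moreover have "pair_step (s, l) q = (l, v, s)" using 1 q by (simp add: pair_step_def)
    ultimately show ?thesis
      using 1 by (intro exI[of _ False] exI[of _ l] exI[of _ w'] exI[of _ "insert v U"] exI[of _ t]) simp
  next
    case 2
    have st: "pair_step (s, l) q = (s, u, l)" using 2 q by (simp add: pair_step_def)
    \<comment> \<open>The target \<open>u\<close> is already present only if it is the line
      \<open>j\<close> that the larger entry has just left. Otherwise \<open>u\<close> exceeds all
      lines of \<open>U\<close> except \<open>l\<close>, so it is new and can be inserted in a
      slot.\<close>
    have "\<exists>w' U' t. top_pair n U' u l \<and> frozen_state d w' U' (insert (t, s, u, l) E) t u l"
    proof (cases "\<not> b \<and> s < j \<and> j = u")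
      case True
      then obtain t where "frozen_state d w U (insert (t, s, u, l) E) t u l"
        using free_move_back[OF Cons.prems(2,3), of w E j \<tau>] Cons.prems(4) by auto
      moreover have "top_pair n U u l"
        using True Cons.prems(4) U unfolding top_pair_def free_state_def by (auto split: if_splits)
      ultimately show ?thesis by blast
    next
      case False
      have ul: "u < l" using \<open>u < v\<close> 2 by simp
      have below: "x < u" if x: "x \<in> U - {s, l}" for x
      proof (cases b)
        case True
        then have "x < s" using Cons.prems(4) x unfolding frozen_state_def by auto
        then show ?thesis using 2 by simp
      next
        case b: False
        then have free: "free_state d w U E j \<tau> s l" using Cons.prems(4) by simp
        show ?thesis
        proof (cases "s < j")
          case True
          then have "s < x \<longrightarrow> x \<le> j" using free x unfolding free_state_def by simp
          then show ?thesis using False b True 2 x by auto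
        next
          case False
          then have "x < s" using free x unfolding free_state_def by simp
          then show ?thesis using 2 by simp
        qed
      qed
      have u: "u \<notin> U" using below[of u] 2 ul by auto
      have "crossing_slot d w U E \<tau> s l u"
      proof (cases b)
        case True
        then show ?thesis
          using frozen_crossing_time[OF Cons.prems(2,3), of w E \<tau> u] Cons.prems(4) 2 ul U \<open>v \<le> n\<close> by simp
      next
        case b: False
        then have "free_state d w U E j \<tau> s l" using Cons.prems(4) by simp
        moreover have "j < u" using False b 2 by auto
        ultimately show ?thesis
          using free_crossing_time[OF Cons.prems(2,3)] 2 ul \<open>v \<le> n\<close> by simp
      qed
      then obtain t where "\<tau> < t" "line d w t s < line d w t l"
        "\<forall>x\<in>U - {s, l}. line d w t x < line d w t s"
        "\<forall>(r, i, j, a)\<in>E. line d w t s - (t - r) * d u < line d w r i" by blast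
      from new_line_small[OF Cons.prems(3) past u 2(2) ul _ this] below obtain w' where
        "frozen_state d w' (insert u U) (insert (t, s, u, l) E) t u l" by blast
      moreover have "top_pair n (insert u U) u l" using U 2 ul \<open>v \<le> n\<close> unfolding top_pair_def by auto
      ultimately show ?thesis by blast
    qed
    then obtain w' U' t where "top_pair n U' u l" "frozen_state d w' U' (insert (t, s, u, l) E) t u l"
      by blast
    then show ?thesis
      using 2 st by (intro exI[of _ True] exI[of _ 0] exI[of _ w'] exI[of _ U'] exI[of _ t]) simp
  next
    case 3
    have st: "pair_step (s, l) q = (s, v, l)" using 3 q U(4) \<open>u < v\<close> by (simp add: pair_step_def)
    have lv: "l < v" using 3 \<open>u < v\<close> by simp
    have "crossing_slot d w U E \<tau> s l v"
    proof (cases b)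
      case True
      then show ?thesis
        using frozen_crossing_time[OF Cons.prems(2,3), of w E \<tau> v] Cons.prems(4) U lv \<open>v \<le> n\<close> by simp
    next
      case b: False
      then have "free_state d w U E j \<tau> s l" "j < l" using Cons.prems(4) by auto
      then show ?thesis
        using free_crossing_time[OF Cons.prems(2,3), of w E j \<tau> v] lv U \<open>v \<le> n\<close> by simp
    qed
    then obtain t where "\<tau> < t" "line d w t s < line d w t l"
      "\<forall>x\<in>U - {s, l}. line d w t x < line d w t s"
      "\<forall>(r, i, j, a)\<in>E. line d w t s - (t - r) * d v < line d w r i" by blast
    from new_line_large[OF Cons.prems(3) past lv this] obtain w' where
      "free_state d w' (insert v U) (insert (t, s, v, l) E) 0 t l v" by blast
    moreover have "top_pair n (insert v U) l v" using U lv \<open>v \<le> n\<close> unfolding top_pair_def by fastforce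
    ultimately show ?thesis
      using 3 st lv by (intro exI[of _ False] exI[of _ 0] exI[of _ w'] exI[of _ "insert v U"] exI[of _ t]) simp
  qed
  then obtain b' j' w' U' t where *: "accepts n b' j' (u, v) ps" "top_pair n U' u v"
    "if b' then frozen_state d w' U' (insert (t, pair_step (s, l) q) E) t u v \<and> j' = 0
     else free_state d w' U' (insert (t, pair_step (s, l) q) E) j' t u v \<and> j' < v" by blast
  from Cons.IH[OF *(1) Cons.prems(2) *(2,3)] obtain w'' where
    E: "\<forall>(r, i, j, a)\<in>insert (t, pair_step (s, l) q) E. crossing d w'' {1..n} r (i, j, a)" and
    S: "\<forall>e\<in>set (consec pair_step ((u, v) # ps)). \<exists>t. crossing d w'' {1..n} t e" by blast
  have "\<exists>t. crossing d w'' {1..n} t (pair_step (s, l) q)"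
    using E by (cases "pair_step (s, l) q") (auto simp del: crossing.simps)
  with E S show ?case unfolding q by (intro exI[of _ w'']) simp
qed

lemma accepts_imp_realizable:
  assumes "accepts n False 0 (1, 2) ps" "strict_mono_on {1..n} d" "n \<ge> 2"
  shows "\<exists>w. \<forall>e\<in>set (consec pair_step ((1, 2) # ps)). \<exists>t. crossing d w {1..n} t e"
proof -
  define w :: "nat \<Rightarrow> real" where "w = (\<lambda>x. if x = 1 then 1 else 0)"
  have "top_pair n {1, 2} 1 2" using assms(3) by (auto simp: top_pair_def)
  moreover have "free_state d w {1, 2} {} 0 0 1 2"
    by (auto simp: free_state_def past_crossings_def line_def w_def)
  ultimately show ?thesis
    using accepts_imp_crossings[OF assms(1,2), of "{1, 2}" w "{}" 0] by auto
qed

section \<open>The crossing path of generic weights\<close>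

lemma pair_move_swap:
  assumes "fst p < snd p" "fst q < snd q" "{fst p, snd p} = {i, a}" "{fst q, snd q} = {j, a}" "i < j"
  shows "pair_move p q \<and> pair_step p q = (i, j, a)"
  using assms by (cases p; cases q) (auto simp: doubleton_eq_iff pair_move_def pair_step_def)

text \<open>With denominators cleared, this says that two different pairs of lines never cross at
  the same time, provided that the slopes \<open>d\<close> are distinct.\<close>

definition generic_weights :: "nat \<Rightarrow> (nat \<Rightarrow> real) \<Rightarrow> (nat \<Rightarrow> real) \<Rightarrow> bool" where
  "generic_weights n d w \<longleftrightarrow> (\<forall>i j k l. {i, j, k, l} \<subseteq> {1..n} \<and> i < j \<and> k < l \<and> (i, j) \<noteq> (k, l) \<longrightarrow>
     (w i - w j) * (d l - d k) \<noteq> (w k - w l) * (d j - d i))"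

definition crossing_move :: "nat \<Rightarrow> (nat \<Rightarrow> real) \<Rightarrow> (nat \<Rightarrow> real) \<Rightarrow> nat \<times> nat \<Rightarrow> nat \<times> nat \<Rightarrow> bool" where
  "crossing_move n d w p q \<longleftrightarrow> pair_move p q \<and> (\<exists>t. crossing d w {1..n} t (pair_step p q))"

text \<open>A flatter outsider never catches up with the top pair, so only steeper outsiders matter;
  they form \<open>K\<close> and exist unless the pair is \<open>(n - 1, n)\<close>. The earliest
  meeting of one of them with an entry of the pair is unique by genericity, so at that time all
  other comparisons between the pair and the outsiders are strict.\<close>

lemma generic_next_crossing:
  assumes d: "strict_mono_on {1..n} d" and gen: "generic_weights n d w"
    and p: "1 \<le> s" "s < l" "l \<le> n" "(s, l) \<noteq> (n - 1, n)"
    and top: "\<forall>x\<in>{1..n} - {s, l}. \<forall>y\<in>{s, l}. line d w t0 x < line d w t0 y"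
  shows "\<exists>t i j a. {s, l} = {i, a} \<and> i \<noteq> a \<and> j \<in> {1..n} - {s, l} \<and> i < j \<and> crossing d w {1..n} t (i, j, a)"
proof -
  have mono: "d x < d y" if "x \<in> {1..n}" "y \<in> {1..n}" "x < y" for x y
    using d that by (simp add: strict_mono_on_def)
  define K where "K = {(i, k). i \<in> {s, l} \<and> k \<in> {1..n} - {s, l} \<and> i < k}"
  define time where "time = (\<lambda>(i, k). (w i - w k) / (d k - d i))"
  have K: "i \<in> {1..n}" "k \<in> {1..n}" "i < k" "d i < d k" if "(i, k) \<in> K" for i k
    using that p mono[of i k] by (auto simp: K_def)
  have "finite K" by (rule finite_subset[of _ "{1..n} \<times> {1..n}"]) (use K in auto)
  moreover have "K \<noteq> {}"
  proof (cases "l < n")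
    case True
    then have "(l, n) \<in> K" using p by (auto simp: K_def)
    then show ?thesis by blast
  next
    case False
    then have "(s, n - 1) \<in> K" using p by (auto simp: K_def)
    then show ?thesis by blast
  qed
  \<comment> \<open>The earliest meeting in \<open>K\<close>. It decides which entry is
    replaced.\<close>
  ultimately obtain e where e: "e \<in> K" "\<forall>f\<in>K. time e \<le> time f"
    by (metis arg_min_if_finite(1) arg_min_least)
  obtain i j where ij: "e = (i, j)" by (cases e)
  define t where "t = time (i, j)"
  have iff: "line d w t' i' < line d w t' k \<longleftrightarrow> time (i', k) < t'"
    "line d w t' i' = line d w t' k \<longleftrightarrow> t' = time (i', k)" if "d i' < d k" for i' k t'
    using that unfolding time_def line_def by (auto simp: field_simps)
  obtain a where a: "{s, l} = {i, a}" "i \<noteq> a" using e(1) p(2) unfolding ij K_def by auto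
  have ijK: "i \<in> {1..n}" "j \<in> {1..n}" "i < j" "d i < d j" "j \<in> {1..n} - {s, l}" "i \<in> {s, l}"
    using K[of i j] e(1) unfolding ij by (auto simp: K_def)
  have aU: "a \<in> {1..n}" "a \<in> {s, l}" using a p by (auto simp: doubleton_eq_iff)
  have eq: "line d w t i = line d w t j" using iff(2)[OF ijK(4)] by (simp add: t_def)
  have "line d w t0 j < line d w t0 i" using top ijK by blast
  then have t0: "t0 < t" using iff[OF ijK(4), of t0] unfolding t_def by linarith
  have below: "line d w t k < line d w t y" if y: "y \<in> {s, l}" and k: "k \<in> {1..n} - {s, l}" and ne: "(y, k) \<noteq> (i, j)" for y k
  proof (cases "y < k")
    case True
    then have yk: "(y, k) \<in> K" using y k by (auto simp: K_def)
    have "time (i, j) \<noteq> time (y, k)"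
    proof
      assume eq: "time (i, j) = time (y, k)"
      have "(w i - w j) * (d k - d y) = (w y - w k) * (d j - d i)"
        using eq ijK(4) K(4)[OF yk] unfolding time_def by (simp add: field_simps)
      moreover have "{i, j, y, k} \<subseteq> {1..n}" using ijK(1,2) K(1,2)[OF yk] by simp
      ultimately show False using gen ijK(3) True ne unfolding generic_weights_def by (metis)
    qed
    then have "t < time (y, k)" using e(2) yk unfolding ij t_def by fastforce
    then show ?thesis using iff[OF K(4)[OF yk], of t] by linarith
  next
    case False
    then have "k < y" using y k by auto
    then have "d k < d y" using mono y k p by auto
    moreover have "line d w t0 k \<le> line d w t0 y" using top y k by (blast intro: less_imp_le)
    ultimately show ?thesis using line_less_later[OF _ t0] by blast
  qed
  have "crossing d w {1..n} t (i, j, a)"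
    unfolding crossing.simps
  proof (intro conjI ballI)
    show "line d w t i = line d w t j" by (rule eq)
    show "line d w t i < line d w t a" using below[OF aU(2) ijK(5)] a(2) eq by simp
    fix x assume "x \<in> {1..n} - {i, j, a}"
    then have "x \<in> {1..n} - {s, l}" "x \<noteq> j" using a(1) by auto
    then show "line d w t x < line d w t i" using below[OF ijK(6)] by blast
  qed
  then show ?thesis using a ijK by blast
qed

text \<open>Just after a crossing the tie is resolved in favour of the steeper line, and all strict
  inequalities persist by continuity. So the new pair is strictly on top and the argument repeats;
  it ends because the sum of the pair grows.\<close>

lemma generic_path_exists:
  assumes "strict_mono_on {1..n} d" "generic_weights n d w" "1 \<le> s" "s < l" "l \<le> n"
    and "\<forall>x\<in>{1..n} - {s, l}. \<forall>y\<in>{s, l}. line d w t0 x < line d w t0 y"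
  shows "\<exists>ps. successively (crossing_move n d w) ((s, l) # ps) \<and> last ((s, l) # ps) = (n - 1, n)"
  using assms
proof (induction "2 * n - (s + l)" arbitrary: s l t0 rule: less_induct)
  case less
  show ?case
  proof (cases "(s, l) = (n - 1, n)")
    case True
    then show ?thesis by (intro exI[of _ "[]"]) simp
  next
    case False
    from generic_next_crossing[OF less.prems(1-5) False less.prems(6)] obtain t i j a where
      a: "{s, l} = {i, a}" "i \<noteq> a" "j \<in> {1..n} - {s, l}" "i < j" and cr: "crossing d w {1..n} t (i, j, a)"
      by blast
    define s' l' where "s' = min j a" and "l' = max j a"
    have ja: "j \<noteq> a" "j \<in> {1..n}" using a by auto
    have aU: "a \<in> {s, l}" "i \<in> {s, l}" unfolding a(1) by auto
    then have an: "a \<in> {1..n}" "i \<in> {1..n}" using less.prems(3-5) by auto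
    have s'l': "1 \<le> s'" "s' < l'" "l' \<le> n" "{s', l'} = {j, a}"
      using ja an by (auto simp: s'_def l'_def min_def max_def)
    have mv: "pair_move (s, l) (s', l') \<and> pair_step (s, l) (s', l') = (i, j, a)"
      by (rule pair_move_swap) (use less.prems(4) s'l' a in auto)
    have "s + l = i + a" using a(1,2) less.prems(4) by (auto simp: doubleton_eq_iff)
    moreover have "s' + l' = j + a" by (simp add: s'_def l'_def)
    ultimately have dec: "2 * n - (s' + l') < 2 * n - (s + l)" using a(4) s'l' by linarith
    have "eventually (\<lambda>r. \<forall>x\<in>{1..n} - {s', l'}. \<forall>y\<in>{s', l'}. line d w r x < line d w r y) (at_right t)"
    proof (intro eventually_ball_finite ballI)
      fix x y assume x: "x \<in> {1..n} - {s', l'}" and y: "y \<in> {s', l'}"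
      show "eventually (\<lambda>r. line d w r x < line d w r y) (at_right t)"
      proof (cases "x = i \<and> y = j")
        case True
        have "d i < d j" using less.prems(1) an ja a(4) by (simp add: strict_mono_on_def)
        moreover have "eventually (\<lambda>r. t < r) (at_right t)" by (rule eventually_at_right_less)
        moreover have "line d w t i \<le> line d w t j" using cr by simp
        ultimately show ?thesis using True by (auto elim!: eventually_mono intro: line_less_later)
      next
        case False
        have xja: "x \<noteq> j" "x \<noteq> a" "y = j \<or> y = a" using x y s'l'(4) by auto
        have "line d w t x < line d w t y"
        proof (cases "x = i")
          case True
          then show ?thesis using False cr xja by auto
        next
          case False
          then have "line d w t x < line d w t i" using cr[unfolded crossing.simps] x xja by blast
          then show ?thesis using cr[unfolded crossing.simps] xja(3) by force
        qed
        then have "0 < line d w t y - line d w t x" by simp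
        moreover have "((\<lambda>r. line d w r y - line d w r x) \<longlongrightarrow> line d w t y - line d w t x) (at_right t)"
          unfolding line_def by (intro tendsto_intros)
        ultimately have "eventually (\<lambda>r. 0 < line d w r y - line d w r x) (at_right t)"
          by (intro order_tendstoD(1))
        then show ?thesis by eventually_elim simp
      qed
    qed auto
    then obtain r where "\<forall>x\<in>{1..n} - {s', l'}. \<forall>y\<in>{s', l'}. line d w r x < line d w r y"
      using eventually_happens[of _ "at_right t"] by fastforce
    from less.hyps[OF dec less.prems(1,2) s'l'(1-3) this] obtain ps where
      "successively (crossing_move n d w) ((s', l') # ps)" "last ((s', l') # ps) = (n - 1, n)" by blast
    moreover have "crossing_move n d w (s, l) (s', l')"
      using mv cr unfolding crossing_move_def by auto
    ultimately show ?thesis by (intro exI[of _ "(s', l') # ps"]) simp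
  qed
qed

lemma generic_path_from_start:
  assumes "strict_mono_on {1..n} d" "generic_weights n d w" "n \<ge> 2"
  shows "\<exists>ps. successively (crossing_move n d w) ((1, 2) # ps) \<and> last ((1, 2) # ps) = (n - 1, n)"
proof -
  \<comment> \<open>Far in the past the two flattest lines are on top.\<close>
  have "eventually (\<lambda>t. \<forall>x\<in>{1..n} - {1, 2}. \<forall>y\<in>{1, 2}. line d w t x < line d w t y) at_bot"
  proof (intro eventually_ball_finite ballI)
    fix x y :: nat assume x: "x \<in> {1..n} - {1, 2}" and y: "y \<in> {1, 2}"
    have "d y < d x" using assms(1,3) x y by (intro strict_mono_onD[OF assms(1)]) auto
    have "eventually (\<lambda>t. t < (w y - w x) / (d x - d y)) at_bot" by (rule eventually_gt_at_bot)
    then show "eventually (\<lambda>t. line d w t x < line d w t y) at_bot"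
      by eventually_elim (use \<open>d y < d x\<close> in \<open>simp add: line_def field_simps\<close>)
  qed auto
  then obtain t0 where "\<forall>x\<in>{1..n} - {1, 2}. \<forall>y\<in>{1, 2}. line d w t0 x < line d w t0 y"
    using eventually_happens[of _ at_bot] by fastforce
  then show ?thesis using assms by (intro generic_path_exists) auto
qed

section \<open>Coherent monotone paths\<close>

definition argmax_face :: "'a::euclidean_space set \<Rightarrow> 'a \<Rightarrow> 'a set" where
  "argmax_face P h = {x \<in> P. \<forall>y\<in>P. y \<bullet> h \<le> x \<bullet> h}"

text \<open>Coherence for a fixed direction, stated without the shadow polygon. The number \<mu> is
  the negative of the slope of the corresponding upper edge.\<close>

definition coherent_via :: "'a::euclidean_space set \<Rightarrow> 'a \<Rightarrow> 'a \<Rightarrow> 'a list \<Rightarrow> bool" where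
  "coherent_via P c \<omega> vs \<longleftrightarrow> monotone_path P c vs \<and>
     successively (\<lambda>u v. \<exists>\<mu>. argmax_face P (\<omega> + \<mu> *\<^sub>R c) = closed_segment u v) vs"

lemma linear_shadow_map: "linear (shadow_map c \<omega>)"
  by (intro linearI) (simp_all add: shadow_map_def inner_add_left)

lemma inner_shadow: "x \<bullet> (\<omega> + \<mu> *\<^sub>R c) = snd (shadow_map c \<omega> x) + \<mu> * fst (shadow_map c \<omega> x)"
  by (simp add: shadow_map_def inner_add_right)

text \<open>An upper edge is not vertical, so it lies on a line that can be written as a level set
  of \<open>snd r + \<mu> * fst r\<close>. Upperness compares points only vertically, so every claim
  about a point \<open>r\<close> is moved to the vertical line through the midpoint
  \<open>m\<close>, where it can be compared with \<open>m\<close>.\<close>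

lemma upper_edge_line:
  fixes Q :: "(real \<times> real) set"
  assumes "upper_edge_of F Q" "convex Q"
  obtains \<mu> \<kappa> p q where "p \<in> F" "q \<in> F" "fst p < fst q" "\<And>r. r \<in> Q \<Longrightarrow> snd r + \<mu> * fst r \<le> \<kappa>"
    "F = {r \<in> Q. snd r + \<mu> * fst r = \<kappa>}"
proof -
  have face: "F face_of Q" and dim: "aff_dim F = 1"
    and upper: "\<And>s t t'. (s, t) \<in> F \<Longrightarrow> (s, t') \<in> Q \<Longrightarrow> t' \<le> t"
    using assms(1) unfolding upper_edge_of_def edge_of_def by blast+
  have FQ: "F \<subseteq> Q" "convex F" using face face_of_imp_subset face_of_imp_convex by auto
  have "\<exists>p q. p \<in> F \<and> q \<in> F \<and> p \<noteq> q"
  proof (rule ccontr)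
    assume "\<not> ?thesis"
    then consider "F = {}" | p where "F = {p}" by (metis empty_iff insertI1 subset_singleton_iff subsetI)
    then show False using dim by cases auto
  qed
  then obtain p q where pq: "p \<in> F" "q \<in> F" "fst p < fst q"
  proof -
    obtain p q where *: "p \<in> F" "q \<in> F" "p \<noteq> q" using \<open>\<exists>p q. p \<in> F \<and> q \<in> F \<and> p \<noteq> q\<close> by blast
    have "fst p \<noteq> fst q"
    proof
      assume eq: "fst p = fst q"
      have "snd p \<le> snd q" "snd q \<le> snd p"
        using upper[of "fst q" "snd q" "snd p"] upper[of "fst p" "snd p" "snd q"] *(1,2) FQ(1) eq
        by (metis prod.collapse subsetD)+
      then show False using * eq by (auto simp: prod_eq_iff)
    qed
    then show ?thesis using that[of p q] that[of q p] * by linarith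
  qed
  define \<mu> where "\<mu> = - (snd q - snd p) / (fst q - fst p)"
  define g where "g r = snd r + \<mu> * fst r" for r :: "real \<times> real"
  define \<kappa> where "\<kappa> = g p"
  define m where "m = (1/2) *\<^sub>R p + (1/2) *\<^sub>R q"
  have gq: "g q = \<kappa>" using pq(3) by (simp add: \<kappa>_def g_def \<mu>_def field_simps)
  have g_comb: "g ((1 - \<theta>) *\<^sub>R b + \<theta> *\<^sub>R r) = (1 - \<theta>) * g b + \<theta> * g r" for \<theta> b r
    by (simp add: g_def algebra_simps)
  have m: "m \<in> F" "fst p < fst m" "fst m < fst q" "g m = \<kappa>"
  proof -
    show "m \<in> F" unfolding m_def using FQ(2) pq by (intro convexD) auto
    show "fst p < fst m" "fst m < fst q" using pq(3) by (auto simp: m_def)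
    show "g m = \<kappa>" using g_comb[of "1/2" p q] gq by (simp add: m_def \<kappa>_def)
  qed
  \<comment> \<open>Take \<open>b\<close> on the other side of \<open>m\<close> from
    \<open>r\<close>. The segment from \<open>b\<close> to \<open>r\<close> then meets the vertical
    line through \<open>m\<close>, and \<open>g\<close> is affine on it with value \<kappa> at
    \<open>b\<close>.\<close>
  have slice: "\<exists>\<theta> b. 0 < \<theta> \<and> \<theta> \<le> 1 \<and> b \<in> {p, q} \<and> fst ((1 - \<theta>) *\<^sub>R b + \<theta> *\<^sub>R r) = fst m" for r
  proof (cases "fst r \<ge> fst m")
    case True
    define \<theta> where "\<theta> = (fst m - fst p) / (fst r - fst p)"
    have "0 < \<theta>" "\<theta> \<le> 1" using True m by (auto simp: \<theta>_def)
    moreover have "fst ((1 - \<theta>) *\<^sub>R p + \<theta> *\<^sub>R r) = fst p + \<theta> * (fst r - fst p)" by (simp add: algebra_simps)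
    moreover have "\<theta> * (fst r - fst p) = fst m - fst p" using True m by (simp add: \<theta>_def)
    ultimately show ?thesis by (intro exI[of _ \<theta>] exI[of _ p]) simp
  next
    case False
    define \<theta> where "\<theta> = (fst q - fst m) / (fst q - fst r)"
    have "0 < \<theta>" "\<theta> \<le> 1" using False m by (auto simp: \<theta>_def)
    moreover have "fst ((1 - \<theta>) *\<^sub>R q + \<theta> *\<^sub>R r) = fst q - \<theta> * (fst q - fst r)" by (simp add: algebra_simps)
    moreover have "\<theta> * (fst q - fst r) = fst q - fst m" using False m by (simp add: \<theta>_def)
    ultimately show ?thesis by (intro exI[of _ \<theta>] exI[of _ q]) simp
  qed
  have le: "g r \<le> \<kappa>" if "r \<in> Q" for r
  proof -
    obtain \<theta> b e where *: "0 < \<theta>" "\<theta> \<le> 1" "b \<in> {p, q}" "fst e = fst m"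
      and e: "e = (1 - \<theta>) *\<^sub>R b + \<theta> *\<^sub>R r" using slice by blast
    have "e \<in> Q" unfolding e using * that pq FQ by (intro convexD[OF assms(2)]) auto
    then have "snd e \<le> snd m"
      using upper[of "fst m" "snd m" "snd e"] m(1) *(4) by (metis prod.collapse)
    then have "g e \<le> \<kappa>" using m(4) unfolding g_def *(4) by linarith
    moreover have "g e = \<kappa> + \<theta> * (g r - \<kappa>)" unfolding e g_comb using *(3) gq by (auto simp: \<kappa>_def algebra_simps)
    ultimately show ?thesis using *(1) by (simp add: mult_le_0_iff)
  qed
  have ge: "\<kappa> \<le> g r" if "r \<in> F" for r
  proof -
    obtain \<theta> b e where *: "0 < \<theta>" "\<theta> \<le> 1" "b \<in> {p, q}" "fst e = fst m"
      and e: "e = (1 - \<theta>) *\<^sub>R b + \<theta> *\<^sub>R r" using slice by blast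
    have "e \<in> F" unfolding e using * that pq by (intro convexD[OF FQ(2)]) auto
    then have "snd m \<le> snd e"
      using upper[of "fst m" "snd e" "snd m"] m(1) *(4) FQ(1) by (metis prod.collapse subsetD)
    then have "\<kappa> \<le> g e" using m(4) unfolding g_def *(4) by linarith
    moreover have "g e = \<kappa> + \<theta> * (g r - \<kappa>)" unfolding e g_comb using *(3) gq by (auto simp: \<kappa>_def algebra_simps)
    ultimately show ?thesis using *(1) by (simp add: zero_le_mult_iff)
  qed
  \<comment> \<open>If \<open>r\<close> is on the supporting line, the slice point is
    \<open>m\<close> itself. Either \<open>r = m\<close>, or \<open>m\<close> is interior to a
    segment ending in \<open>r\<close>, and the face property puts \<open>r\<close> into
    \<open>F\<close>.\<close>
  have on: "r \<in> F" if "r \<in> Q" "g r = \<kappa>" for r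
  proof -
    obtain \<theta> b e where *: "0 < \<theta>" "\<theta> \<le> 1" "b \<in> {p, q}" "fst e = fst m"
      and e: "e = (1 - \<theta>) *\<^sub>R b + \<theta> *\<^sub>R r" using slice by blast
    have "g e = \<kappa>" unfolding e g_comb using *(3) gq that(2) by (auto simp: \<kappa>_def algebra_simps)
    then have em: "e = m" using m(4) *(4) by (simp add: g_def prod_eq_iff)
    show ?thesis
    proof (cases "\<theta> = 1")
      case True
      then show ?thesis using em e m(1) by simp
    next
      case False
      have "b \<noteq> r"
      proof
        assume "b = r"
        then have "b = m" using em e by (simp flip: scaleR_add_left)
        then show False using *(3) m(2,3) by auto
      qed
      then have "m \<in> open_segment b r" unfolding in_segment using False * em e by (intro conjI exI[of _ \<theta>]) auto
      then show ?thesis using face_ofD[OF face, of m b r] that(1) m(1) *(3) pq FQ by auto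
    qed
  qed
  show ?thesis
  proof (rule that[OF pq, of \<mu> \<kappa>])
    show "snd r + \<mu> * fst r \<le> \<kappa>" if "r \<in> Q" for r using le[OF that] by (simp add: g_def)
    show "F = {r \<in> Q. snd r + \<mu> * fst r = \<kappa>}"
      using le ge on FQ unfolding g_def by (auto intro!: antisym)
  qed
qed

lemma upper_edge_preimage:
  assumes "convex P" "upper_edge_of F (shadow_map c \<omega> ` P)"
  obtains \<mu> x y where "{x \<in> P. shadow_map c \<omega> x \<in> F} = argmax_face P (\<omega> + \<mu> *\<^sub>R c)"
    "x \<in> argmax_face P (\<omega> + \<mu> *\<^sub>R c)" "y \<in> argmax_face P (\<omega> + \<mu> *\<^sub>R c)" "x \<bullet> c < y \<bullet> c"
proof -
  have "convex (shadow_map c \<omega> ` P)" by (intro convex_linear_image linear_shadow_map assms(1))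
  then obtain \<mu> \<kappa> p q where
    pq: "p \<in> F" "q \<in> F" "fst p < fst q" and
    le: "\<And>r. r \<in> shadow_map c \<omega> ` P \<Longrightarrow> snd r + \<mu> * fst r \<le> \<kappa>" and
    F: "F = {r \<in> shadow_map c \<omega> ` P. snd r + \<mu> * fst r = \<kappa>}"
    by (rule upper_edge_line[OF assms(2)]) (rule that; assumption)
  obtain x y where xy: "x \<in> P" "p = shadow_map c \<omega> x" "y \<in> P" "q = shadow_map c \<omega> y" using pq F by auto
  have x\<kappa>: "x \<bullet> (\<omega> + \<mu> *\<^sub>R c) = \<kappa>" using pq(1) by (auto simp: inner_shadow F xy(2))
  have eq: "{x \<in> P. shadow_map c \<omega> x \<in> F} = argmax_face P (\<omega> + \<mu> *\<^sub>R c)"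
  proof (intro set_eqI iffI)
    fix z assume "z \<in> {x \<in> P. shadow_map c \<omega> x \<in> F}"
    then show "z \<in> argmax_face P (\<omega> + \<mu> *\<^sub>R c)"
      using le unfolding argmax_face_def inner_shadow by (auto simp: F)
  next
    fix z assume z: "z \<in> argmax_face P (\<omega> + \<mu> *\<^sub>R c)"
    then have "z \<in> P" "\<kappa> \<le> z \<bullet> (\<omega> + \<mu> *\<^sub>R c)" using xy(1) x\<kappa> unfolding argmax_face_def by auto
    then show "z \<in> {x \<in> P. shadow_map c \<omega> x \<in> F}"
      using le[of "shadow_map c \<omega> z"] unfolding inner_shadow by (auto simp: F)
  qed
  moreover have "x \<in> argmax_face P (\<omega> + \<mu> *\<^sub>R c)" "y \<in> argmax_face P (\<omega> + \<mu> *\<^sub>R c)"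
    using xy pq by (auto simp flip: eq)
  moreover have "x \<bullet> c < y \<bullet> c" using pq(3) xy by (simp add: shadow_map_def)
  ultimately show ?thesis using that by blast
qed

lemma argmax_segment_upper_edge:
  assumes "convex P" "argmax_face P (\<omega> + \<mu> *\<^sub>R c) = closed_segment u v" "u \<bullet> c < v \<bullet> c"
  obtains F where "upper_edge_of F (shadow_map c \<omega> ` P)"
    "{x \<in> P. shadow_map c \<omega> x \<in> F} = closed_segment u v"
proof -
  let ?S = "shadow_map c \<omega>"
  define \<kappa> where "\<kappa> = u \<bullet> (\<omega> + \<mu> *\<^sub>R c)"
  have u: "u \<in> P" "\<And>y. y \<in> P \<Longrightarrow> y \<bullet> (\<omega> + \<mu> *\<^sub>R c) \<le> \<kappa>"
    using assms(2) ends_in_segment(1)[of u v] unfolding argmax_face_def \<kappa>_def by auto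
  have mem: "x \<in> closed_segment u v \<longleftrightarrow> x \<in> P \<and> x \<bullet> (\<omega> + \<mu> *\<^sub>R c) = \<kappa>" for x
  proof
    assume "x \<in> closed_segment u v"
    then have "x \<in> P" "u \<bullet> (\<omega> + \<mu> *\<^sub>R c) \<le> x \<bullet> (\<omega> + \<mu> *\<^sub>R c)"
      using u(1) unfolding assms(2)[symmetric] argmax_face_def by auto
    then show "x \<in> P \<and> x \<bullet> (\<omega> + \<mu> *\<^sub>R c) = \<kappa>" using u(2) unfolding \<kappa>_def by fastforce
  next
    assume "x \<in> P \<and> x \<bullet> (\<omega> + \<mu> *\<^sub>R c) = \<kappa>"
    then show "x \<in> closed_segment u v" using u(2) unfolding assms(2)[symmetric] argmax_face_def by auto
  qed
  have dot: "(\<mu>, 1) \<bullet> r = snd r + \<mu> * fst r" for r :: "real \<times> real" by (simp add: inner_prod_def)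
  define F where "F = ?S ` P \<inter> {r. (\<mu>, 1) \<bullet> r = \<kappa>}"
  have pre: "{x \<in> P. ?S x \<in> F} = closed_segment u v"
    using mem unfolding F_def dot inner_shadow by auto
  have "F = ?S ` closed_segment u v"
    using mem unfolding F_def dot inner_shadow by auto
  also have "\<dots> = closed_segment (?S u) (?S v)"
    by (simp add: closed_segment_linear_image linear_shadow_map)
  finally have F: "F = closed_segment (?S u) (?S v)" .
  have ne: "?S u \<noteq> ?S v" using assms(3) by (auto simp: shadow_map_def)
  have "F face_of ?S ` P"
    unfolding F_def
    by (rule face_of_Int_supporting_hyperplane_le)
      (use u(2) assms(1) in \<open>auto simp: dot convex_linear_image linear_shadow_map simp flip: inner_shadow\<close>)
  moreover have "aff_dim F = 1"
    unfolding F segment_convex_hull aff_dim_convex_hull using ne by (simp add: aff_dim_2)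
  moreover have "t' \<le> t" if st: "(s, t) \<in> F" "(s, t') \<in> ?S ` P" for s t t'
  proof -
    obtain y where y: "y \<in> P" "?S y = (s, t')" using st(2) by auto
    have "t' + \<mu> * s \<le> \<kappa>" using u(2)[OF y(1)] unfolding inner_shadow y(2) by simp
    moreover have "t + \<mu> * s = \<kappa>" using st(1) unfolding F_def dot by auto
    ultimately show ?thesis by simp
  qed
  ultimately have "upper_edge_of F (?S ` P)" unfolding upper_edge_of_def edge_of_def by blast
  then show ?thesis using that pre by blast
qed

lemma successively_cover:
  fixes f :: "'a \<Rightarrow> real"
  assumes "f (hd vs) \<le> t" "t \<le> f (last vs)" "length vs \<ge> 2"
  shows "\<exists>k. Suc k < length vs \<and> f (vs ! k) \<le> t \<and> t \<le> f (vs ! Suc k)"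
  using assms
proof (induction vs rule: induct_list012)
  case (3 u v vs)
  show ?case
  proof (cases "t \<le> f v")
    case True
    then show ?thesis using 3 by (intro exI[of _ 0]) auto
  next
    case False
    then have "vs \<noteq> []" using "3.prems" by auto
    then have "\<exists>k. Suc k < length (v # vs) \<and> f ((v # vs) ! k) \<le> t \<and> t \<le> f ((v # vs) ! Suc k)"
      using False "3.prems" by (intro "3.IH"(2)) (auto simp: Suc_le_eq)
    then obtain k where "Suc k < length (v # vs)" "f ((v # vs) ! k) \<le> t" "t \<le> f ((v # vs) ! Suc k)" by blast
    then show ?thesis by (intro exI[of _ "Suc k"]) auto
  qed
qed auto

lemma closed_segment_determined:
  assumes "x \<in> closed_segment u v" "y \<in> closed_segment u v" "x \<bullet> c = y \<bullet> c" "u \<bullet> c \<noteq> v \<bullet> c"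
  shows "x = y"
proof -
  obtain a b where a: "x = (1 - a) *\<^sub>R u + a *\<^sub>R v" and b: "y = (1 - b) *\<^sub>R u + b *\<^sub>R v"
    using assms(1,2) unfolding in_segment by auto
  have "(a - b) * (v \<bullet> c - u \<bullet> c) = 0"
    using assms(3) unfolding a b by (simp add: inner_add_left algebra_simps)
  then show ?thesis using assms(4) a b by simp
qed

lemma closed_segment_inner_value:
  assumes "u \<bullet> c \<le> t" "t \<le> v \<bullet> c"
  obtains z where "z \<in> closed_segment u v" "z \<bullet> c = t"
proof -
  have "t \<in> closed_segment (u \<bullet> c) (v \<bullet> c)" using assms by (simp add: closed_segment_eq_real_ivl)
  also have "\<dots> = (\<lambda>x. x \<bullet> c) ` closed_segment u v"
    by (intro closed_segment_linear_image linearI) (auto simp: inner_add_left)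
  finally show ?thesis using that by auto
qed

lemma monotone_path_subset:
  assumes "monotone_path P c vs" "v \<in> set vs"
  shows "v \<in> P"
  using assms unfolding monotone_path_def extreme_point_of_def by blast

text \<open>The edges of a path with maximal faces are preimages of upper edges. What remains is
  that there are no further upper edges: the path already has an edge over every height, and two
  maximal faces that compete at one height must coincide.\<close>

lemma coherent_monotone_path_iff:
  assumes "convex P"
  shows "coherent_monotone_path P c vs \<longleftrightarrow> (\<exists>\<omega>. coherent_via P c \<omega> vs)"
proof
  assume "coherent_monotone_path P c vs"
  then obtain \<omega> where mono: "monotone_path P c vs" and eq: "path_edges vs =
      {{x \<in> P. shadow_map c \<omega> x \<in> F} |F. upper_edge_of F (shadow_map c \<omega> ` P)}"
    unfolding coherent_monotone_path_def by blast
  have "\<exists>\<mu>. argmax_face P (\<omega> + \<mu> *\<^sub>R c) = closed_segment (vs ! k) (vs ! Suc k)" if k: "Suc k < length vs" for k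
  proof -
    have "closed_segment (vs ! k) (vs ! Suc k) \<in> path_edges vs" using k unfolding path_edges_def by blast
    then obtain F where F: "upper_edge_of F (shadow_map c \<omega> ` P)"
      "closed_segment (vs ! k) (vs ! Suc k) = {x \<in> P. shadow_map c \<omega> x \<in> F}" unfolding eq by blast
    show ?thesis unfolding F(2) by (rule upper_edge_preimage[OF assms F(1)]) blast
  qed
  then show "\<exists>\<omega>. coherent_via P c \<omega> vs"
    using mono unfolding coherent_via_def successively_conv_nth by blast
next
  assume "\<exists>\<omega>. coherent_via P c \<omega> vs"
  then obtain \<omega> where mono: "monotone_path P c vs" and
    seg: "\<And>k. Suc k < length vs \<Longrightarrow> \<exists>\<mu>. argmax_face P (\<omega> + \<mu> *\<^sub>R c) = closed_segment (vs ! k) (vs ! Suc k)"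
    unfolding coherent_via_def successively_conv_nth by blast
  have less: "\<And>k. Suc k < length vs \<Longrightarrow> vs ! k \<bullet> c < vs ! Suc k \<bullet> c"
    and bounds: "\<And>x. x \<in> P \<Longrightarrow> hd vs \<bullet> c \<le> x \<bullet> c" "\<And>x. x \<in> P \<Longrightarrow> x \<bullet> c \<le> last vs \<bullet> c"
    using mono unfolding monotone_path_def by blast+
  have "path_edges vs = {{x \<in> P. shadow_map c \<omega> x \<in> F} |F. upper_edge_of F (shadow_map c \<omega> ` P)}"
  proof (intro set_eqI iffI)
    fix S assume "S \<in> path_edges vs"
    then obtain k where k: "Suc k < length vs" "S = closed_segment (vs ! k) (vs ! Suc k)"
      unfolding path_edges_def by blast
    then obtain \<mu> where "argmax_face P (\<omega> + \<mu> *\<^sub>R c) = closed_segment (vs ! k) (vs ! Suc k)" using seg by blast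
    then obtain F where "upper_edge_of F (shadow_map c \<omega> ` P)"
      "{x \<in> P. shadow_map c \<omega> x \<in> F} = closed_segment (vs ! k) (vs ! Suc k)"
      by (rule argmax_segment_upper_edge[OF assms _ less[OF k(1)]])
    then show "S \<in> {{x \<in> P. shadow_map c \<omega> x \<in> F} |F. upper_edge_of F (shadow_map c \<omega> ` P)}"
      using k(2) by blast
  next
    fix S assume "S \<in> {{x \<in> P. shadow_map c \<omega> x \<in> F} |F. upper_edge_of F (shadow_map c \<omega> ` P)}"
    then obtain F where F: "upper_edge_of F (shadow_map c \<omega> ` P)" "S = {x \<in> P. shadow_map c \<omega> x \<in> F}" by blast
    obtain \<mu> x y where "{x \<in> P. shadow_map c \<omega> x \<in> F} = argmax_face P (\<omega> + \<mu> *\<^sub>R c)"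
      "x \<in> argmax_face P (\<omega> + \<mu> *\<^sub>R c)" "y \<in> argmax_face P (\<omega> + \<mu> *\<^sub>R c)" "x \<bullet> c < y \<bullet> c"
      by (rule upper_edge_preimage[OF assms F(1)])
    then have S: "S = argmax_face P (\<omega> + \<mu> *\<^sub>R c)" "x \<in> S" "y \<in> S" "x \<bullet> c < y \<bullet> c"
      unfolding F(2) by simp_all
    \<comment> \<open>The midpoint \<open>m\<close> of the given face is compared with the point
      \<open>z\<close> of the path at the same height. Each is optimal for its own multiplier, so
      \<open>m\<close> is optimal for \<mu>' too, and then so are \<open>x\<close> and
      \<open>y\<close>. They differ in height but have equal values for \<mu> and for \<mu>', hence
      the multipliers agree.\<close>
    define m where "m = (1/2) *\<^sub>R x + (1/2) *\<^sub>R y"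
    have xyP: "x \<in> P" "y \<in> P" using S unfolding argmax_face_def by auto
    have val: "z \<bullet> (\<omega> + \<mu> *\<^sub>R c) \<le> x \<bullet> (\<omega> + \<mu> *\<^sub>R c)" "z \<bullet> (\<omega> + \<mu> *\<^sub>R c) \<le> y \<bullet> (\<omega> + \<mu> *\<^sub>R c)" if "z \<in> P" for z
      using S that unfolding argmax_face_def by auto
    have mP: "m \<in> P" unfolding m_def using xyP by (intro convexD[OF assms]) auto
    have minner: "m \<bullet> h = (x \<bullet> h + y \<bullet> h) / 2" for h by (simp add: m_def inner_add_left)
    have "length vs \<ge> 2"
    proof (rule ccontr)
      assume "\<not> length vs \<ge> 2"
      then have "hd vs = last vs" using mono by (cases vs) (auto simp: monotone_path_def Suc_le_eq)
      then show False using bounds[OF xyP(1)] bounds[OF xyP(2)] S(4) by simp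
    qed
    then obtain k where k: "Suc k < length vs" "vs ! k \<bullet> c \<le> m \<bullet> c" "m \<bullet> c \<le> vs ! Suc k \<bullet> c"
      using successively_cover[of "\<lambda>v. v \<bullet> c" vs "m \<bullet> c"] bounds[OF mP] by blast
    then obtain z where z: "z \<in> closed_segment (vs ! k) (vs ! Suc k)" "z \<bullet> c = m \<bullet> c"
      using closed_segment_inner_value by blast
    obtain \<mu>' where \<mu>': "argmax_face P (\<omega> + \<mu>' *\<^sub>R c) = closed_segment (vs ! k) (vs ! Suc k)" using seg k(1) by blast
    have zP: "z \<in> P" "\<And>y. y \<in> P \<Longrightarrow> y \<bullet> (\<omega> + \<mu>' *\<^sub>R c) \<le> z \<bullet> (\<omega> + \<mu>' *\<^sub>R c)"
      using z(1) unfolding \<mu>'[symmetric] argmax_face_def by auto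
    have "z \<bullet> (\<omega> + \<mu> *\<^sub>R c) \<le> m \<bullet> (\<omega> + \<mu> *\<^sub>R c)" 
    proof -
      have "a \<le> (b + d) / 2" if "a \<le> b" "a \<le> d" for a b d :: real using that by simp
      then show ?thesis unfolding minner using val[OF zP(1)] by blast
    qed
    then have mz: "z \<bullet> \<omega> \<le> m \<bullet> \<omega>" using z(2) by (simp add: inner_add_right)
    have "x \<bullet> (\<omega> + \<mu>' *\<^sub>R c) \<le> z \<bullet> (\<omega> + \<mu>' *\<^sub>R c)" "y \<bullet> (\<omega> + \<mu>' *\<^sub>R c) \<le> z \<bullet> (\<omega> + \<mu>' *\<^sub>R c)"
      "z \<bullet> (\<omega> + \<mu>' *\<^sub>R c) \<le> m \<bullet> (\<omega> + \<mu>' *\<^sub>R c)"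
      using zP(2) xyP mz z(2) by (auto simp: inner_add_right)
    then have "x \<bullet> (\<omega> + \<mu>' *\<^sub>R c) = y \<bullet> (\<omega> + \<mu>' *\<^sub>R c)" using minner[of "\<omega> + \<mu>' *\<^sub>R c"] by simp
    moreover have "x \<bullet> (\<omega> + \<mu> *\<^sub>R c) = y \<bullet> (\<omega> + \<mu> *\<^sub>R c)" using val xyP by (simp add: antisym)
    ultimately have "(\<mu> - \<mu>') * (y \<bullet> c - x \<bullet> c) = 0" by (simp add: inner_add_right algebra_simps)
    then have "\<mu> = \<mu>'" using S(4) by simp
    then show "S \<in> path_edges vs" using S(1) \<mu>' k(1) unfolding path_edges_def by blast
  qed
  then show "coherent_monotone_path P c vs" using mono unfolding coherent_monotone_path_def by blast
qed

section \<open>Vertices of the monotone path polytope\<close>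

lemma monotone_path_range:
  assumes "convex P" "monotone_path P c vs"
  shows "(\<lambda>x. x \<bullet> c) ` P = {hd vs \<bullet> c..last vs \<bullet> c}"
proof
  show "(\<lambda>x. x \<bullet> c) ` P \<subseteq> {hd vs \<bullet> c..last vs \<bullet> c}"
    using assms(2) unfolding monotone_path_def by auto
  have "vs \<noteq> []" using assms(2) unfolding monotone_path_def by blast
  then have P: "hd vs \<in> P" "last vs \<in> P" using monotone_path_subset[OF assms(2)] by auto
  show "{hd vs \<bullet> c..last vs \<bullet> c} \<subseteq> (\<lambda>x. x \<bullet> c) ` P"
  proof
    fix t assume "t \<in> {hd vs \<bullet> c..last vs \<bullet> c}"
    then obtain z where "z \<in> closed_segment (hd vs) (last vs)" "z \<bullet> c = t"
      using closed_segment_inner_value by (metis atLeastAtMost_iff)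
    then show "t \<in> (\<lambda>x. x \<bullet> c) ` P" using closed_segment_subset[OF P assms(1)] by blast
  qed
qed

definition is_path_section :: "'a::euclidean_space \<Rightarrow> 'a list \<Rightarrow> (real \<Rightarrow> 'a) \<Rightarrow> bool" where
  "is_path_section c vs \<gamma> \<longleftrightarrow> continuous_on {hd vs \<bullet> c..last vs \<bullet> c} \<gamma> \<and>
     (\<forall>k. Suc k < length vs \<longrightarrow> (\<forall>t\<in>{vs ! k \<bullet> c..vs ! Suc k \<bullet> c}.
        \<gamma> t \<in> closed_segment (vs ! k) (vs ! Suc k) \<and> \<gamma> t \<bullet> c = t))"

text \<open>The affine parametrisations of the edges by height are glued from the last edge
  backwards. The prescribed start value is what makes the pieces match.\<close>

lemma path_section_exists:
  assumes "successively (\<lambda>u v. u \<bullet> c < v \<bullet> c) vs" "vs \<noteq> []"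
  shows "\<exists>\<gamma>. is_path_section c vs \<gamma> \<and> \<gamma> (hd vs \<bullet> c) = hd vs"
  using assms
proof (induction vs rule: induct_list012)
  case (2 v)
  then show ?case by (intro exI[of _ "\<lambda>_. v"]) (simp add: is_path_section_def)
next
  case (3 u v vs)
  have less: "u \<bullet> c < v \<bullet> c" using 3 by simp
  obtain \<gamma> where \<gamma>: "is_path_section c (v # vs) \<gamma>" "\<gamma> (v \<bullet> c) = v" using 3 by auto
  define \<beta> where "\<beta> t = u + ((t - u \<bullet> c) / (v \<bullet> c - u \<bullet> c)) *\<^sub>R (v - u)" for t
  define \<delta> where "\<delta> t = (if t \<le> v \<bullet> c then \<beta> t else \<gamma> t)" for t
  have \<beta>: "\<beta> (u \<bullet> c) = u" "\<beta> (v \<bullet> c) = v" using less by (simp_all add: \<beta>_def)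
  have later: "\<delta> t = \<gamma> t" if "v \<bullet> c \<le> t" for t using that \<beta>(2) \<gamma>(2) by (auto simp: \<delta>_def)
  have "continuous_on {u \<bullet> c..last (v # vs) \<bullet> c} (\<lambda>t. if t \<le> v \<bullet> c then \<beta> t else \<gamma> t)"
  proof (rule continuous_on_cases_le)
    show "continuous_on {t \<in> {u \<bullet> c..last (v # vs) \<bullet> c}. t \<le> v \<bullet> c} \<beta>"
      unfolding \<beta>_def by (intro continuous_intros) (use less in auto)
    show "continuous_on {t \<in> {u \<bullet> c..last (v # vs) \<bullet> c}. v \<bullet> c \<le> t} \<gamma>"
      by (rule continuous_on_subset[of "{v \<bullet> c..last (v # vs) \<bullet> c}"])
        (use \<gamma>(1) in \<open>auto simp: is_path_section_def\<close>)
  qed (use \<beta>(2) \<gamma>(2) in \<open>auto intro: continuous_intros\<close>)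
  moreover have "\<delta> t \<in> closed_segment ((u # v # vs) ! k) ((u # v # vs) ! Suc k) \<and> \<delta> t \<bullet> c = t"
    if "Suc k < length (u # v # vs)" "t \<in> {(u # v # vs) ! k \<bullet> c..(u # v # vs) ! Suc k \<bullet> c}" for k t
  proof (cases k)
    case 0
    define \<theta> where "\<theta> = (t - u \<bullet> c) / (v \<bullet> c - u \<bullet> c)"
    have t: "u \<bullet> c \<le> t" "t \<le> v \<bullet> c" using that 0 by auto
    then have \<theta>: "0 \<le> \<theta>" "\<theta> \<le> 1" "\<theta> * (v \<bullet> c - u \<bullet> c) = t - u \<bullet> c" using less by (auto simp: \<theta>_def)
    have \<delta>t: "\<delta> t = (1 - \<theta>) *\<^sub>R u + \<theta> *\<^sub>R v"
      using t by (simp add: \<delta>_def \<beta>_def \<theta>_def[symmetric] algebra_simps)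
    have "\<delta> t \<in> closed_segment u v" unfolding in_segment using \<theta> \<delta>t by blast
    moreover have "\<delta> t \<bullet> c = u \<bullet> c + \<theta> * (v \<bullet> c - u \<bullet> c)"
      unfolding \<delta>t by (simp add: inner_add_left algebra_simps)
    ultimately show ?thesis using \<theta>(3) 0 by simp
  next
    case (Suc i)
    have "v \<bullet> c \<le> (v # vs) ! i \<bullet> c"
    proof -
      have "successively (\<lambda>u v. u \<bullet> c < v \<bullet> c) (v # vs)" using 3 by simp
      then have "sorted_wrt (\<lambda>u v. u \<bullet> c < v \<bullet> c) (v # vs)"
        by (subst (asm) successively_conv_sorted_wrt) (auto intro: transpI)
      then show ?thesis using that Suc by (cases i) (auto intro: less_imp_le)
    qed
    then have "\<delta> t = \<gamma> t" using that Suc by (intro later) auto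
    then show ?thesis using \<gamma>(1) that Suc unfolding is_path_section_def by auto
  qed
  moreover have "\<delta> (u \<bullet> c) = u" using less \<beta> by (simp add: \<delta>_def)
  ultimately show ?case
    by (intro exI[of _ \<delta>]) (simp add: is_path_section_def \<delta>_def[abs_def])
qed simp

definition path_section :: "'a::euclidean_space \<Rightarrow> 'a list \<Rightarrow> real \<Rightarrow> 'a" where
  "path_section c vs = (SOME \<gamma>. is_path_section c vs \<gamma>)"

definition section_average :: "'a::euclidean_space set \<Rightarrow> 'a \<Rightarrow> (real \<Rightarrow> 'a) \<Rightarrow> 'a" where
  "section_average P c \<gamma> =
     (1 / measure lborel ((\<lambda>x. x \<bullet> c) ` P)) *\<^sub>R integral ((\<lambda>x. x \<bullet> c) ` P) \<gamma>"

lemma monotone_path_polytope_eq: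
  "monotone_path_polytope P c = section_average P c ` {\<gamma>. section_over P c \<gamma>}"
  by (auto simp: monotone_path_polytope_def section_average_def Let_def)

lemma is_path_section_path_section:
  assumes "monotone_path P c vs"
  shows "is_path_section c vs (path_section c vs)"
proof -
  have "successively (\<lambda>u v. u \<bullet> c < v \<bullet> c) vs" "vs \<noteq> []"
    using assms unfolding monotone_path_def successively_conv_nth by blast+
  then show ?thesis unfolding path_section_def by (metis someI_ex path_section_exists)
qed

section \<open>Averages of path sections as the vertices\<close>

context
  fixes P :: "'a::euclidean_space set" and c :: 'a
  assumes P: "convex P" and nonconst: "\<exists>x\<in>P. \<exists>y\<in>P. x \<bullet> c < y \<bullet> c"
begin

abbreviation "heights \<equiv> (\<lambda>x. x \<bullet> c) ` P"

abbreviation "average \<equiv> section_average P c"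

lemma monotone_path_bounds:
  assumes "monotone_path P c vs"
  shows "hd vs \<bullet> c < last vs \<bullet> c" "length vs \<ge> 2"
proof -
  show *: "hd vs \<bullet> c < last vs \<bullet> c"
    using assms nonconst unfolding monotone_path_def by fastforce
  show "length vs \<ge> 2" using * assms by (cases vs) (auto simp: Suc_le_eq monotone_path_def)
qed

lemma path_section_on_edge:
  assumes "monotone_path P c vs" "t \<in> heights"
  obtains k where "Suc k < length vs" "t \<in> {vs ! k \<bullet> c..vs ! Suc k \<bullet> c}"
    "path_section c vs t \<in> closed_segment (vs ! k) (vs ! Suc k)" "path_section c vs t \<bullet> c = t"
proof -
  have "hd vs \<bullet> c \<le> t" "t \<le> last vs \<bullet> c" using assms(2) unfolding monotone_path_range[OF P assms(1)] by auto
  then obtain k where "Suc k < length vs" "vs ! k \<bullet> c \<le> t" "t \<le> vs ! Suc k \<bullet> c"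
    using successively_cover[of "\<lambda>v. v \<bullet> c" vs t] monotone_path_bounds[OF assms(1)] by blast
  then show ?thesis
    using that is_path_section_path_section[OF assms(1)] unfolding is_path_section_def by auto
qed

lemma section_over_path_section:
  assumes "monotone_path P c vs"
  shows "section_over P c (path_section c vs)"
  unfolding section_over_def
proof (intro conjI ballI)
  show "continuous_on heights (path_section c vs)"
    using is_path_section_path_section[OF assms] unfolding monotone_path_range[OF P assms] is_path_section_def by blast
  fix t assume "t \<in> heights"
  then obtain k where k: "Suc k < length vs" "path_section c vs t \<in> closed_segment (vs ! k) (vs ! Suc k)"
    "path_section c vs t \<bullet> c = t" by (rule path_section_on_edge[OF assms])
  have "vs ! k \<in> P" "vs ! Suc k \<in> P" using k(1) monotone_path_subset[OF assms] by auto
  from closed_segment_subset[OF this P] show "path_section c vs t \<in> P" using k(2) by blast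
  show "path_section c vs t \<bullet> c = t" by fact
qed

text \<open>The path point at height \<open>t\<close> maximises \<omega> plus a multiple of
  \<open>c\<close>, and at equal heights the multiple of \<open>c\<close> cancels. Equality puts
  \<open>\<delta> t\<close> on the same edge, where the height determines the point.\<close>

lemma section_le_path_section:
  assumes "coherent_via P c \<omega> vs" "section_over P c \<delta>" "t \<in> heights"
  shows "\<delta> t \<bullet> \<omega> \<le> path_section c vs t \<bullet> \<omega>"
    and "\<delta> t \<bullet> \<omega> = path_section c vs t \<bullet> \<omega> \<Longrightarrow> \<delta> t = path_section c vs t"
proof -
  have mono: "monotone_path P c vs" and
    seg: "\<And>k. Suc k < length vs \<Longrightarrow> \<exists>\<mu>. argmax_face P (\<omega> + \<mu> *\<^sub>R c) = closed_segment (vs ! k) (vs ! Suc k)"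
    using assms(1) unfolding coherent_via_def successively_conv_nth by blast+
  obtain k where k: "Suc k < length vs" "path_section c vs t \<in> closed_segment (vs ! k) (vs ! Suc k)"
    "path_section c vs t \<bullet> c = t" by (rule path_section_on_edge[OF mono assms(3)])
  obtain \<mu> where \<mu>: "argmax_face P (\<omega> + \<mu> *\<^sub>R c) = closed_segment (vs ! k) (vs ! Suc k)" using seg k(1) by blast
  have \<delta>: "\<delta> t \<in> P" "\<delta> t \<bullet> c = t" using assms(2,3) unfolding section_over_def by auto
  have max: "y \<bullet> (\<omega> + \<mu> *\<^sub>R c) \<le> path_section c vs t \<bullet> (\<omega> + \<mu> *\<^sub>R c)" if "y \<in> P" for y
    using k(2) that unfolding \<mu>[symmetric] argmax_face_def by auto
  from max[OF \<delta>(1)] show "\<delta> t \<bullet> \<omega> \<le> path_section c vs t \<bullet> \<omega>"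
    using \<delta>(2) k(3) by (simp add: inner_add_right)
  assume "\<delta> t \<bullet> \<omega> = path_section c vs t \<bullet> \<omega>"
  then have "\<delta> t \<bullet> (\<omega> + \<mu> *\<^sub>R c) = path_section c vs t \<bullet> (\<omega> + \<mu> *\<^sub>R c)"
    using \<delta>(2) k(3) by (simp add: inner_add_right)
  then have "\<delta> t \<in> closed_segment (vs ! k) (vs ! Suc k)"
    using max \<delta>(1) unfolding \<mu>[symmetric] argmax_face_def by auto
  moreover have "vs ! k \<bullet> c < vs ! Suc k \<bullet> c" using mono k(1) unfolding monotone_path_def by blast
  ultimately show "\<delta> t = path_section c vs t"
    using closed_segment_determined[OF _ k(2), of "\<delta> t" c] \<delta>(2) k(3) by simp
qed

lemma range_interval:
  assumes "monotone_path P c vs"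
  obtains a b where "heights = {a..b}" "a < b"
  using monotone_path_range[OF P assms] monotone_path_bounds[OF assms] by blast

lemma section_average_inner:
  assumes "monotone_path P c vs" "section_over P c \<delta>"
  shows "average \<delta> \<bullet> h =
    integral heights (\<lambda>t. \<delta> t \<bullet> h) / measure lborel heights"
proof -
  obtain a b where ab: "heights = {a..b}" "a < b" by (rule range_interval[OF assms(1)])
  have "continuous_on {a..b} \<delta>" using assms(2) unfolding section_over_def ab by blast
  then have int: "\<delta> integrable_on {a..b}" by (rule integrable_continuous_real)
  have "integral {a..b} ((\<lambda>x. x \<bullet> h) \<circ> \<delta>) = integral {a..b} \<delta> \<bullet> h"
    by (rule integral_linear[OF int bounded_linear_inner_left])
  then show ?thesis by (simp add: section_average_def ab o_def)
qed

text \<open>The pointwise inequality is integrated. If the averages agree in direction \<omega>, a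
  nonnegative continuous function has integral zero and vanishes.\<close>

lemma section_average_le:
  assumes "coherent_via P c \<omega> vs" "section_over P c \<delta>"
  shows "average \<delta> \<bullet> \<omega> \<le> average (path_section c vs) \<bullet> \<omega>"
    and "average \<delta> \<bullet> \<omega> = average (path_section c vs) \<bullet> \<omega> \<Longrightarrow>
      (\<forall>t\<in>heights. \<delta> t = path_section c vs t) \<and>
      average \<delta> = average (path_section c vs)"
proof -
  have mono: "monotone_path P c vs" using assms(1) unfolding coherent_via_def by blast
  define \<gamma> where "\<gamma> = path_section c vs"
  have \<gamma>: "section_over P c \<gamma>" unfolding \<gamma>_def by (rule section_over_path_section[OF mono])
  obtain a b where ab: "heights = {a..b}" "a < b" by (rule range_interval[OF mono])
  have cont: "continuous_on {a..b} (\<lambda>t. \<delta> t \<bullet> \<omega>)" "continuous_on {a..b} (\<lambda>t. \<gamma> t \<bullet> \<omega>)"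
    using assms(2) \<gamma> unfolding section_over_def ab by (auto intro: continuous_intros)
  note int = cont[THEN integrable_continuous_real]
  have le: "\<delta> t \<bullet> \<omega> \<le> \<gamma> t \<bullet> \<omega>" if "t \<in> {a..b}" for t
    unfolding \<gamma>_def by (rule section_le_path_section[OF assms]) (use that ab in simp)
  have avg: "average \<eta> \<bullet> \<omega> = integral {a..b} (\<lambda>t. \<eta> t \<bullet> \<omega>) / (b - a)" if "section_over P c \<eta>" for \<eta>
    using section_average_inner[OF mono that] ab by simp
  have "integral {a..b} (\<lambda>t. \<delta> t \<bullet> \<omega>) \<le> integral {a..b} (\<lambda>t. \<gamma> t \<bullet> \<omega>)"
    using int le by (rule integral_le)
  then show "average \<delta> \<bullet> \<omega> \<le> average (path_section c vs) \<bullet> \<omega>"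
    unfolding avg[OF assms(2)] avg[OF \<gamma>, unfolded \<gamma>_def] using ab(2) by (simp add: divide_right_mono \<gamma>_def)
  assume "average \<delta> \<bullet> \<omega> = average (path_section c vs) \<bullet> \<omega>"
  then have "integral {a..b} (\<lambda>t. \<gamma> t \<bullet> \<omega> - \<delta> t \<bullet> \<omega>) = 0"
    using avg[OF assms(2)] avg[OF \<gamma>] ab(2) int by (simp add: integral_diff \<gamma>_def)
  then have "\<forall>t\<in>{a..b}. \<gamma> t \<bullet> \<omega> - \<delta> t \<bullet> \<omega> = 0"
    by (subst (asm) integral_eq_0_iff) (use cont le ab(2) in \<open>auto intro: continuous_intros\<close>)
  then have eq: "\<forall>t\<in>heights. \<delta> t = \<gamma> t"
    using section_le_path_section(2)[OF assms] unfolding ab(1) \<gamma>_def by simp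
  moreover have "integral heights \<delta> = integral heights \<gamma>"
    using eq by (intro integral_cong) auto
  ultimately show "(\<forall>t\<in>heights. \<delta> t = path_section c vs t) \<and>
      average \<delta> = average (path_section c vs)"
    by (simp add: section_average_def \<gamma>_def)
qed

text \<open>The average is the unique maximiser of \<omega> on the polytope, so it is not interior
  to any segment.\<close>

lemma extreme_point_path_average:
  assumes "coherent_via P c \<omega> vs"
  shows "average (path_section c vs) extreme_point_of monotone_path_polytope P c"
  unfolding extreme_point_of_def
proof (intro conjI ballI notI)
  let ?x = "average (path_section c vs)"
  have mono: "monotone_path P c vs" using assms unfolding coherent_via_def by blast
  show "?x \<in> monotone_path_polytope P c"
    using section_over_path_section[OF mono] unfolding monotone_path_polytope_eq by blast
  fix u v assume uv: "u \<in> monotone_path_polytope P c" "v \<in> monotone_path_polytope P c" "?x \<in> open_segment u v"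
  have le: "y \<bullet> \<omega> \<le> ?x \<bullet> \<omega>" "y \<bullet> \<omega> = ?x \<bullet> \<omega> \<Longrightarrow> y = ?x" if "y \<in> monotone_path_polytope P c" for y
    using section_average_le[OF assms] that unfolding monotone_path_polytope_eq by blast+
  obtain \<theta> where \<theta>: "u \<noteq> v" "0 < \<theta>" "\<theta> < 1" "?x = (1 - \<theta>) *\<^sub>R u + \<theta> *\<^sub>R v"
    using uv(3) unfolding in_segment by blast
  have "?x \<bullet> \<omega> = (1 - \<theta>) * (u \<bullet> \<omega>) + \<theta> * (v \<bullet> \<omega>)"
    by (subst \<theta>(4)) (simp add: inner_add_left)
  then have "(1 - \<theta>) * (?x \<bullet> \<omega> - u \<bullet> \<omega>) + \<theta> * (?x \<bullet> \<omega> - v \<bullet> \<omega>) = 0" by (simp add: algebra_simps)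
  moreover have "(1 - \<theta>) * (?x \<bullet> \<omega> - u \<bullet> \<omega>) \<ge> 0" "\<theta> * (?x \<bullet> \<omega> - v \<bullet> \<omega>) \<ge> 0"
    using le(1) uv \<theta> by auto
  ultimately have "(1 - \<theta>) * (?x \<bullet> \<omega> - u \<bullet> \<omega>) = 0" "\<theta> * (?x \<bullet> \<omega> - v \<bullet> \<omega>) = 0" by linarith+
  then have "u \<bullet> \<omega> = ?x \<bullet> \<omega>" "v \<bullet> \<omega> = ?x \<bullet> \<omega>" using \<theta>(2,3) by auto
  then have "u = ?x" "v = ?x" using le(2)[OF uv(1)] le(2)[OF uv(2)] by blast+
  then show False using \<theta>(1) by simp
qed

text \<open>An extreme point of \<open>P\<close> on an edge is one of its ends, so the section, as a
  curve, remembers the vertices of the path.\<close>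

lemma path_vertices_of_section:
  assumes "monotone_path P c vs"
  shows "set vs = {x. x extreme_point_of P} \<inter> path_section c vs ` heights"
proof (intro equalityI subsetI)
  fix v assume v: "v \<in> set vs"
  then have vP: "v \<in> P" "v extreme_point_of P"
    using monotone_path_subset[OF assms] assms unfolding monotone_path_def by auto
  obtain i where i: "i < length vs" "v = vs ! i" using v by (metis in_set_conv_nth)
  have less: "vs ! k \<bullet> c < vs ! Suc k \<bullet> c" if "Suc k < length vs" for k
    using assms that unfolding monotone_path_def by blast
  obtain k where k: "Suc k < length vs" "v = vs ! k \<or> v = vs ! Suc k"
  proof (cases "Suc i < length vs")
    case False
    then have "Suc (i - 1) < length vs" "v = vs ! Suc (i - 1)"
      using i monotone_path_bounds(2)[OF assms] by auto
    then show ?thesis using that by blast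
  qed (use i that in blast)
  have "v \<bullet> c \<in> {vs ! k \<bullet> c..vs ! Suc k \<bullet> c}" using k less[OF k(1)] by auto
  then have s: "path_section c vs (v \<bullet> c) \<in> closed_segment (vs ! k) (vs ! Suc k)" "path_section c vs (v \<bullet> c) \<bullet> c = v \<bullet> c"
    using is_path_section_path_section[OF assms] k(1) unfolding is_path_section_def by auto
  have "v \<in> closed_segment (vs ! k) (vs ! Suc k)" using k(2) by auto
  from closed_segment_determined[OF s(1) this s(2)] less[OF k(1)] have "path_section c vs (v \<bullet> c) = v" by simp
  then show "v \<in> {x. x extreme_point_of P} \<inter> path_section c vs ` heights"
    using vP by (metis IntI image_eqI mem_Collect_eq)
next
  fix v assume "v \<in> {x. x extreme_point_of P} \<inter> path_section c vs ` heights"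
  then obtain t where t: "v extreme_point_of P" "t \<in> heights" "v = path_section c vs t" by blast
  obtain k where k: "Suc k < length vs" "v \<in> closed_segment (vs ! k) (vs ! Suc k)"
    unfolding t(3) by (rule path_section_on_edge[OF assms t(2)])
  have "vs ! k \<in> P" "vs ! Suc k \<in> P" using k(1) monotone_path_subset[OF assms] by auto
  then have "v \<notin> open_segment (vs ! k) (vs ! Suc k)" using t(1) unfolding extreme_point_of_def by blast
  then have "v = vs ! k \<or> v = vs ! Suc k" using k(2) unfolding open_segment_def by blast
  then show "v \<in> set vs" using k(1) by auto
qed

text \<open>Equal averages give equal sections and hence equal vertex sets. A monotone path lists
  its vertices by strictly increasing height, so the set determines the list.\<close>

lemma inj_on_path_average:
  "inj_on (\<lambda>vs. average (path_section c vs)) {vs. coherent_monotone_path P c vs}"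
proof (rule inj_onI)
  fix us vs assume *: "us \<in> {vs. coherent_monotone_path P c vs}" "vs \<in> {vs. coherent_monotone_path P c vs}"
    "average (path_section c us) = average (path_section c vs)"
  then obtain \<omega> where \<omega>: "coherent_via P c \<omega> vs" using coherent_monotone_path_iff[OF P] by auto
  have mono: "monotone_path P c us" "monotone_path P c vs"
    using * unfolding coherent_monotone_path_def by auto
  have eq: "\<forall>t\<in>heights. path_section c us t = path_section c vs t"
    using section_average_le(2)[OF \<omega> section_over_path_section[OF mono(1)]] *(3) by simp
  have "path_section c us ` heights = path_section c vs ` heights"
    using eq by (intro image_cong) auto
  then have set: "set us = set vs"
    using path_vertices_of_section[OF mono(1)] path_vertices_of_section[OF mono(2)] by simp
  have sorted: "sorted_wrt (<) (map (\<lambda>x. x \<bullet> c) ws)" if "monotone_path P c ws" for ws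
  proof -
    have "successively (<) (map (\<lambda>x. x \<bullet> c) ws)"
      using that unfolding monotone_path_def successively_conv_nth by auto
    then show ?thesis by (subst (asm) successively_conv_sorted_wrt) (auto intro: transpI)
  qed
  have "map (\<lambda>x. x \<bullet> c) us = map (\<lambda>x. x \<bullet> c) vs"
    by (rule strict_sorted_equal[OF sorted[OF mono(2)] sorted[OF mono(1)]]) (simp add: set)
  moreover have "inj_on (\<lambda>x. x \<bullet> c) (set vs)"
  proof (rule inj_onI)
    fix x y assume xy: "x \<in> set vs" "y \<in> set vs" "x \<bullet> c = y \<bullet> c"
    have "distinct (map (\<lambda>x. x \<bullet> c) vs)" using sorted[OF mono(2)] by (simp add: strict_sorted_iff)
    then show "x = y" using xy by (simp add: distinct_map inj_on_def)
  qed
  ultimately show "us = vs" using set by (intro map_inj_on[of "\<lambda>x. x \<bullet> c"]) auto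
qed

lemma convex_monotone_path_polytope:
  assumes "monotone_path P c vs"
  shows "convex (monotone_path_polytope P c)"
proof (rule convexI)
  fix x y :: 'a and u v :: real
  assume xy: "x \<in> monotone_path_polytope P c" "y \<in> monotone_path_polytope P c" and uv: "0 \<le> u" "0 \<le> v" "u + v = 1"
  obtain \<gamma> \<delta> where s: "section_over P c \<gamma>" "x = average \<gamma>" "section_over P c \<delta>" "y = average \<delta>"
    using xy unfolding monotone_path_polytope_eq by blast
  obtain a b where ab: "heights = {a..b}" "a < b" by (rule range_interval[OF assms])
  define \<eta> where "\<eta> t = u *\<^sub>R \<gamma> t + v *\<^sub>R \<delta> t" for t
  have cont: "continuous_on {a..b} \<gamma>" "continuous_on {a..b} \<delta>" using s unfolding section_over_def ab by blast+
  have "section_over P c \<eta>"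
    unfolding section_over_def
  proof (intro conjI ballI)
    show "continuous_on heights \<eta>" unfolding ab \<eta>_def by (intro continuous_intros cont)
    fix t assume "t \<in> heights"
    then have *: "\<gamma> t \<in> P" "\<gamma> t \<bullet> c = t" "\<delta> t \<in> P" "\<delta> t \<bullet> c = t" using s unfolding section_over_def by auto
    show "\<eta> t \<in> P" unfolding \<eta>_def using * uv by (intro convexD[OF P])
    show "\<eta> t \<bullet> c = t" unfolding \<eta>_def using * uv(3) by (simp add: inner_add_left flip: distrib_right)
  qed
  moreover have "average \<eta> = u *\<^sub>R x + v *\<^sub>R y"
  proof -
    have "integral {a..b} \<eta> = u *\<^sub>R integral {a..b} \<gamma> + v *\<^sub>R integral {a..b} \<delta>"
      unfolding \<eta>_def using cont[THEN integrable_continuous_real] by (simp add: integral_add integrable_cmul)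
    then show ?thesis unfolding s section_average_def ab by (simp add: scaleR_add_right)
  qed
  ultimately show "u *\<^sub>R x + v *\<^sub>R y \<in> monotone_path_polytope P c"
    unfolding monotone_path_polytope_eq by (metis imageI mem_Collect_eq)
qed

text \<open>If a point of the monotone path polytope were outside the convex hull of the averages of
  the coherent paths, then a separating direction could be perturbed to a generic one, and the
  coherent path of that direction would contradict the separation.\<close>

lemma bij_betw_path_average:
  assumes fin: "finite {vs. coherent_monotone_path P c vs}"
    and dense: "\<And>W. open W \<Longrightarrow> W \<noteq> {} \<Longrightarrow> \<exists>\<omega>\<in>W. \<exists>vs. coherent_via P c \<omega> vs"
  shows "bij_betw (\<lambda>vs. average (path_section c vs)) {vs. coherent_monotone_path P c vs}
    {v. v extreme_point_of monotone_path_polytope P c}"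
proof (rule bij_betw_imageI[OF inj_on_path_average])
  let ?f = "\<lambda>vs. average (path_section c vs)"
  define V where "V = ?f ` {vs. coherent_monotone_path P c vs}"
  obtain vs0 where vs0: "monotone_path P c vs0"
    using dense[of UNIV] unfolding coherent_via_def by auto
  have VM: "V \<subseteq> {v. v extreme_point_of monotone_path_polytope P c}"
    unfolding V_def using extreme_point_path_average coherent_monotone_path_iff[OF P] by blast
  have finV: "finite V" using fin unfolding V_def by simp
  have "monotone_path_polytope P c \<subseteq> convex hull V"
  proof (rule ccontr)
    assume "\<not> ?thesis"
    then obtain x where x: "x \<in> monotone_path_polytope P c" "x \<notin> convex hull V" by blast
    have "closed (convex hull V)" using finV by (simp add: compact_imp_closed finite_imp_compact_convex_hull)
    from separating_hyperplane_closed_point[OF convex_convex_hull this x(2)]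
    obtain a b where ab: "a \<bullet> x < b" "\<forall>y\<in>convex hull V. b < a \<bullet> y" by blast
    \<comment> \<open>The directions in which \<open>x\<close> beats all averages in
      \<open>V\<close>. This set is open because \<open>V\<close> is finite, and it contains the
      separating direction \<open>- a\<close>, so density yields one that has a coherent
      path.\<close>
    define W where "W = (\<Inter>v\<in>V. {\<omega>. 0 < (x - v) \<bullet> \<omega>})"
    have "open W" unfolding W_def using finV by (intro open_INT) (auto intro: open_halfspace_gt)
    moreover have "- a \<in> W"
    proof -
      have "0 < (x - v) \<bullet> (- a)" if "v \<in> V" for v
      proof -
        have "b < a \<bullet> v" using ab(2) hull_subset[of V convex] that by blast
        then show ?thesis using ab(1) by (simp add: inner_diff_left inner_diff_right inner_commute)
      qed
      then show ?thesis unfolding W_def by blast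
    qed
    ultimately obtain \<omega> vs where \<omega>: "\<omega> \<in> W" "coherent_via P c \<omega> vs" using dense[of W] by blast
    then have "?f vs \<in> V" unfolding V_def using coherent_monotone_path_iff[OF P] by blast
    then have "?f vs \<bullet> \<omega> < x \<bullet> \<omega>" using \<omega>(1) unfolding W_def by (auto simp: inner_diff_left)
    moreover have "x \<bullet> \<omega> \<le> ?f vs \<bullet> \<omega>"
      using x(1) section_average_le(1)[OF \<omega>(2)] unfolding monotone_path_polytope_eq by blast
    ultimately show False by simp
  qed
  moreover have "convex hull V \<subseteq> monotone_path_polytope P c"
    using VM by (intro hull_minimal convex_monotone_path_polytope[OF vs0]) (auto simp: extreme_point_of_def)
  ultimately have "monotone_path_polytope P c = convex hull V" by blast
  then show "?f ` {vs. coherent_monotone_path P c vs} = {v. v extreme_point_of monotone_path_polytope P c}"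
    using VM extreme_point_of_convex_hull[of _ V] unfolding V_def by auto
qed

end

section \<open>The second hypersimplex\<close>

definition pair_vertex :: "(nat \<Rightarrow> 'n) \<Rightarrow> nat \<times> nat \<Rightarrow> real ^ 'n" where
  "pair_vertex \<sigma> p = axis (\<sigma> (fst p)) 1 + axis (\<sigma> (snd p)) 1"

lemma inner_axis_pair: "(axis i 1 + axis j 1) \<bullet> (h :: real ^ 'n) = h $ i + h $ j"
  by (simp add: inner_add_left inner_axis')

lemma axis_pair_eq_iff:
  fixes i j k l :: "'n::finite"
  assumes "i \<noteq> j" "k \<noteq> l"
  shows "axis i (1::real) + axis j 1 = axis k 1 + axis l 1 \<longleftrightarrow> {i, j} = {k, l}"
proof
  assume eq: "axis i (1::real) + axis j 1 = axis k 1 + axis l 1"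
  have supp: "{x. (axis i (1::real) + axis j 1) $ x \<noteq> 0} = {i, j}" if "i \<noteq> j" for i j :: 'n
    using that by (auto simp: axis_def)
  show "{i, j} = {k, l}" using supp[OF assms(1)] supp[OF assms(2)] eq by simp
qed (auto simp: doubleton_eq_iff add.commute)

lemma convex_hypersimplex: "convex (hypersimplex k)"
proof (rule convexI)
  fix x y :: "real ^ 'n" and u v :: real
  assume xy: "x \<in> hypersimplex k" "y \<in> hypersimplex k" and uv: "0 \<le> u" "0 \<le> v" "u + v = 1"
  have "0 \<le> u * x $ i + v * y $ i \<and> u * x $ i + v * y $ i \<le> 1" for i
  proof
    show "0 \<le> u * x $ i + v * y $ i" using xy uv by (simp add: hypersimplex_def)
    have "u * x $ i + v * y $ i \<le> u * 1 + v * 1"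
      using xy uv by (intro add_mono mult_left_mono) (auto simp: hypersimplex_def)
    then show "u * x $ i + v * y $ i \<le> 1" using uv(3) by simp
  qed
  moreover have "(\<Sum>i\<in>UNIV. u * x $ i + v * y $ i) = real k"
    using xy uv(3) by (simp add: hypersimplex_def sum.distrib flip: sum_distrib_left distrib_right)
  ultimately show "u *\<^sub>R x + v *\<^sub>R y \<in> hypersimplex k" by (simp add: hypersimplex_def)
qed

lemma axis_pair_in_hypersimplex:
  assumes "i \<noteq> j"
  shows "axis i 1 + axis j 1 \<in> hypersimplex 2"
proof -
  have "(\<Sum>k\<in>UNIV. (axis i (1::real) + axis j 1) $ k) = 2"
    by (simp add: sum.distrib axis_def)
  then show ?thesis using assms by (auto simp: hypersimplex_def axis_def)
qed

text \<open>An extreme point has 0/1 coordinates, since otherwise two fractional coordinates can be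
  shifted against each other. Conversely, 0 and 1 are the ends of the allowed range, so a 0/1 point
  is not strictly between two others.\<close>

lemma extreme_point_of_hypersimplex2:
  "v extreme_point_of (hypersimplex 2 :: (real ^ 'n) set) \<longleftrightarrow> (\<exists>i j. i \<noteq> j \<and> v = axis i 1 + axis j 1)"
proof
  assume ext: "v extreme_point_of (hypersimplex 2)"
  then have v: "v \<in> hypersimplex 2" by (simp add: extreme_point_of_def)
  have b: "0 \<le> v $ i" "v $ i \<le> 1" for i using v by (auto simp: hypersimplex_def)
  have s: "(\<Sum>i\<in>UNIV. v $ i) = 2" using v by (simp add: hypersimplex_def)
  have int: "v $ i \<in> {0, 1}" for i
  proof (rule ccontr)
    assume i: "v $ i \<notin> {0, 1}"
    \<comment> \<open>The coordinates sum to an integer, so a fractional coordinate cannot be the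
      only one.\<close>
    have "\<exists>j. j \<noteq> i \<and> v $ j \<notin> {0, 1}"
    proof (rule ccontr)
      assume "\<not> ?thesis"
      then have "(\<Sum>j\<in>UNIV - {i}. v $ j) \<in> \<int>" by (intro Ints_sum) auto
      moreover have "v $ i = 2 - (\<Sum>j\<in>UNIV - {i}. v $ j)" using s by (simp add: sum.remove[of UNIV i])
      ultimately have "v $ i \<in> \<int>" by (simp add: Ints_diff)
      then obtain z where z: "v $ i = of_int z" by (rule Ints_cases)
      then have "0 < z \<and> z < 1" using b[of i] i by (auto simp: less_le)
      then show False by linarith
    qed
    then obtain j where j: "j \<noteq> i" "v $ j \<notin> {0, 1}" by blast
    \<comment> \<open>The distance of the two coordinates to the nearest bound, so that a shift by
      \<epsilon> in either direction stays in the hypersimplex.\<close>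
    define \<epsilon> where "\<epsilon> = min (min (v $ i) (1 - v $ i)) (min (v $ j) (1 - v $ j))"
    have "0 < v $ i" "v $ i < 1" "0 < v $ j" "v $ j < 1"
      using i j(2) b[of i] b[of j] by (simp_all add: less_le)
    then have \<epsilon>: "0 < \<epsilon>" "\<epsilon> \<le> v $ i" "\<epsilon> \<le> 1 - v $ i" "\<epsilon> \<le> v $ j" "\<epsilon> \<le> 1 - v $ j"
      by (auto simp: \<epsilon>_def)
    define e where "e = \<epsilon> *\<^sub>R (axis i 1 - axis j 1 :: real ^ 'n)"
    have e: "e $ k = (if k = i then \<epsilon> else if k = j then - \<epsilon> else 0)" for k
      using j(1) by (simp add: e_def axis_def)
    have se: "(\<Sum>k\<in>UNIV. e $ k) = 0"
      by (simp add: e_def axis_def sum_subtractf flip: sum_distrib_left)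
    have "v + e \<in> hypersimplex 2" "v - e \<in> hypersimplex 2"
      using b \<epsilon> s se unfolding hypersimplex_def by (auto simp: sum.distrib sum_subtractf e add_nonneg_nonneg)
    moreover have "v \<in> open_segment (v - e) (v + e)"
    proof -
      have "(v - e) $ i \<noteq> (v + e) $ i" using e[of i] \<epsilon>(1) by simp
      then have "v - e \<noteq> v + e" by metis
      moreover have "v = (1 - 1/2) *\<^sub>R (v - e) + (1/2) *\<^sub>R (v + e)"
        by (simp add: vec_eq_iff field_simps)
      ultimately show ?thesis unfolding in_segment by (intro conjI exI[of _ "1/2"]) simp_all
    qed
    ultimately show False using ext unfolding extreme_point_of_def by blast
  qed
  have ind: "v $ i = (if i \<in> {i. v $ i = 1} then 1 else 0)" for i using int[of i] by auto
  have "(\<Sum>i\<in>UNIV. v $ i) = (\<Sum>i\<in>UNIV. if i \<in> {i. v $ i = 1} then 1 else 0)"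
    by (rule sum.cong[OF refl]) (rule ind)
  then have "card {i. v $ i = 1} = 2" using s by (simp add: sum.If_cases)
  then obtain i j where ij: "{i. v $ i = 1} = {i, j}" "i \<noteq> j" by (auto simp: card_2_iff)
  have "v = axis i 1 + axis j 1"
    unfolding vec_eq_iff using ind ij by (auto simp: axis_def)
  then show "\<exists>i j. i \<noteq> j \<and> v = axis i 1 + axis j 1" using ij(2) by blast
next
  assume "\<exists>i j. i \<noteq> j \<and> v = axis i 1 + axis j 1"
  then obtain i j where ij: "i \<noteq> j" "v = axis i 1 + axis j 1" by blast
  have "v \<notin> open_segment a b" if ab: "a \<in> hypersimplex 2" "b \<in> hypersimplex 2" for a b
  proof
    assume "v \<in> open_segment a b"
    then obtain t where t: "a \<noteq> b" "0 < t" "t < 1" "v = (1 - t) *\<^sub>R a + t *\<^sub>R b" unfolding in_segment by blast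
    have "a $ k = b $ k" for k
    proof -
      have vk: "v $ k = (1 - t) * a $ k + t * b $ k" by (simp add: t(4))
      have r: "0 \<le> a $ k" "a $ k \<le> 1" "0 \<le> b $ k" "b $ k \<le> 1" using ab by (auto simp: hypersimplex_def)
      have "v $ k = 0 \<or> v $ k = 1" using ij by (auto simp: axis_def)
      then show ?thesis
      proof
        assume "v $ k = 0"
        moreover have "0 \<le> (1 - t) * a $ k" "0 \<le> t * b $ k" using r t by auto
        ultimately have "(1 - t) * a $ k = 0" "t * b $ k = 0" using vk by linarith+
        then show ?thesis using t by simp
      next
        assume "v $ k = 1"
        then have "(1 - t) * (1 - a $ k) + t * (1 - b $ k) = 0" using vk by (simp add: algebra_simps)
        moreover have "0 \<le> (1 - t) * (1 - a $ k)" "0 \<le> t * (1 - b $ k)" using r t by auto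
        ultimately have "(1 - t) * (1 - a $ k) = 0" "t * (1 - b $ k) = 0" by linarith+
        then show ?thesis using t by simp
      qed
    qed
    then show False using t(1) by (simp add: vec_eq_iff)
  qed
  then show "v extreme_point_of (hypersimplex 2)"
    unfolding extreme_point_of_def using axis_pair_in_hypersimplex[OF ij(1)] ij(2) by blast
qed

text \<open>Subtracting \<open>2 * \<theta>\<close> from \<open>x \<bullet> h\<close> leaves \<open>\<Sum>k. x $ k * (h $ k - \<theta>)\<close>, in which only the
  summand of \<open>a\<close> is positive.\<close>

lemma hypersimplex2_bound:
  fixes x h :: "real ^ 'n"
  assumes "x \<in> hypersimplex 2" "\<theta> \<le> h $ a" "\<And>k. k \<noteq> a \<Longrightarrow> h $ k \<le> \<theta>"
  shows "x \<bullet> h \<le> \<theta> + h $ a"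
    and "x \<bullet> h = \<theta> + h $ a \<Longrightarrow> \<theta> < h $ a \<Longrightarrow> x $ a = 1 \<and> (\<forall>k. k \<noteq> a \<longrightarrow> h $ k < \<theta> \<longrightarrow> x $ k = 0)"
proof -
  have b: "0 \<le> x $ i" "x $ i \<le> 1" for i using assms(1) by (auto simp: hypersimplex_def)
  have s: "(\<Sum>i\<in>UNIV. x $ i) = 2" using assms(1) by (simp add: hypersimplex_def)
  define R where "R = (\<Sum>k\<in>UNIV - {a}. x $ k * (\<theta> - h $ k))"
  have "x \<bullet> h = (\<Sum>k\<in>UNIV. x $ k * (h $ k - \<theta>)) + 2 * \<theta>"
    using s by (simp add: inner_vec_def right_diff_distrib sum_subtractf flip: sum_distrib_right)
  also have "(\<Sum>k\<in>UNIV. x $ k * (h $ k - \<theta>)) = x $ a * (h $ a - \<theta>) - R"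
  proof -
    have "(\<Sum>k\<in>UNIV - {a}. x $ k * (h $ k - \<theta>)) = - R"
      unfolding R_def sum_negf[symmetric] by (intro sum.cong refl) (simp add: algebra_simps)
    then show ?thesis by (simp add: sum.remove[of UNIV a])
  qed
  finally have xh: "x \<bullet> h = \<theta> + h $ a - ((1 - x $ a) * (h $ a - \<theta>) + R)" by (simp add: algebra_simps)
  have pos: "0 \<le> x $ k * (\<theta> - h $ k)" if "k \<noteq> a" for k using b assms(3)[OF that] by simp
  have R: "0 \<le> R" unfolding R_def using pos by (intro sum_nonneg) auto
  have a: "0 \<le> (1 - x $ a) * (h $ a - \<theta>)" using b[of a] assms(2) by simp
  show "x \<bullet> h \<le> \<theta> + h $ a" using xh R a by linarith
  assume "x \<bullet> h = \<theta> + h $ a" and less: "\<theta> < h $ a"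
  then have 0: "R = 0" "(1 - x $ a) * (h $ a - \<theta>) = 0" using xh R a by linarith+
  have "\<forall>k\<in>UNIV - {a}. x $ k * (\<theta> - h $ k) = 0"
    using 0(1) pos unfolding R_def by (subst (asm) sum_nonneg_eq_0_iff) auto
  then show "x $ a = 1 \<and> (\<forall>k. k \<noteq> a \<longrightarrow> h $ k < \<theta> \<longrightarrow> x $ k = 0)" using 0(2) less by auto
qed

text \<open>By \<open>hypersimplex2_bound\<close> with threshold \<open>h $ i\<close>, a maximiser
  has coordinate 1 at \<open>a\<close> and vanishes outside \<open>i\<close>, \<open>j\<close>,
  \<open>a\<close>. The remaining mass 1 is split between \<open>i\<close> and
  \<open>j\<close>.\<close>

lemma argmax_face_hypersimplex2:
  fixes h :: "real ^ 'n"
  assumes "i \<noteq> j" "i \<noteq> a" "j \<noteq> a" "h $ i = h $ j" "h $ i < h $ a"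
    and "\<And>k. k \<notin> {i, j, a} \<Longrightarrow> h $ k < h $ i"
  shows "argmax_face (hypersimplex 2) h = closed_segment (axis i 1 + axis a 1) (axis j 1 + axis a 1)"
    (is "?L = ?R")
proof -
  let ?P = "hypersimplex 2 :: (real ^ 'n) set"
  have le: "h $ k \<le> h $ i" if "k \<noteq> a" for k
    using assms(4) assms(6)[of k] that by (cases "k = i \<or> k = j") (auto intro: less_imp_le)
  note bound = hypersimplex2_bound[of _ "h $ i" h a]
  have ends: "axis i 1 + axis a 1 \<in> ?P" "axis j 1 + axis a 1 \<in> ?P"
    using assms axis_pair_in_hypersimplex by auto
  have val: "(axis i 1 + axis a 1) \<bullet> h = h $ i + h $ a" "(axis j 1 + axis a 1) \<bullet> h = h $ i + h $ a"
    using assms(4) by (simp_all add: inner_axis_pair)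
  show ?thesis
  proof (intro equalityI subsetI)
    fix x assume x: "x \<in> ?L"
    then have xP: "x \<in> ?P" "h $ i + h $ a \<le> x \<bullet> h"
      using ends(1) val(1) unfolding argmax_face_def by auto
    have "x \<bullet> h = h $ i + h $ a" using bound(1)[OF xP(1)] assms(5) le xP(2) by fastforce
    then have x1: "x $ a = 1" "\<And>k. k \<noteq> a \<Longrightarrow> h $ k < h $ i \<Longrightarrow> x $ k = 0"
      using bound(2)[OF xP(1)] assms(5) le by auto
    then have x0: "x $ k = 0" if "k \<notin> {i, j, a}" for k using that assms(6) by auto
    have "(\<Sum>k\<in>UNIV. x $ k) = (\<Sum>k\<in>{i, j, a}. x $ k)"
      using x0 by (intro sum.mono_neutral_right) auto
    then have xj: "x $ i = 1 - x $ j" using xP(1) x1(1) assms(1-3) by (simp add: hypersimplex_def)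
    have "x = (1 - x $ j) *\<^sub>R (axis i 1 + axis a 1) + x $ j *\<^sub>R (axis j 1 + axis a 1)"
      unfolding vec_eq_iff
    proof
      fix k
      show "x $ k = ((1 - x $ j) *\<^sub>R (axis i 1 + axis a 1) + x $ j *\<^sub>R (axis j 1 + axis a 1)) $ k"
        using x0[of k] x1(1) xj assms(1-3) by (cases "k \<in> {i, j, a}") (auto simp: axis_def)
    qed
    moreover have "0 \<le> x $ j" "x $ j \<le> 1" using xP(1) by (auto simp: hypersimplex_def)
    ultimately show "x \<in> ?R" unfolding in_segment by blast
  next
    fix x assume x: "x \<in> ?R"
    then have xP: "x \<in> ?P" using closed_segment_subset[OF ends convex_hypersimplex] by blast
    obtain t where "x = (1 - t) *\<^sub>R (axis i 1 + axis a 1) + t *\<^sub>R (axis j 1 + axis a 1)"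
      using x unfolding in_segment by blast
    then have "x \<bullet> h = (1 - t) * (h $ i + h $ a) + t * (h $ i + h $ a)"
      using val by (simp only: inner_add_left inner_scaleR_left)
    then have "x \<bullet> h = h $ i + h $ a" by (simp add: algebra_simps)
    then show "x \<in> ?L" unfolding argmax_face_def using xP bound(1) assms(5) le by auto
  qed
qed

text \<open>A segment contains no extreme points of the hypersimplex except possibly its ends, so
  only the two given pairs attain the maximum \<open>M\<close>. Each claim comes from comparing them
  with another pair.\<close>

lemma argmax_face_hypersimplex2_imp:
  fixes h :: "real ^ 'n"
  assumes p: "p1 \<noteq> p2" "q1 \<noteq> q2" "{p1, p2} \<noteq> {q1, q2}"
    and max: "argmax_face (hypersimplex 2) h = closed_segment (axis p1 1 + axis p2 1) (axis q1 1 + axis q2 1)"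
  shows "\<exists>i j a. i \<noteq> j \<and> i \<noteq> a \<and> j \<noteq> a \<and> {p1, p2} = {i, a} \<and> {q1, q2} = {j, a} \<and>
    h $ i = h $ j \<and> h $ i < h $ a \<and> (\<forall>k. k \<notin> {i, j, a} \<longrightarrow> h $ k < h $ i)"
proof -
  let ?P = "hypersimplex 2 :: (real ^ 'n) set"
  define M where "M = h $ p1 + h $ p2"
  have "axis p1 1 + axis p2 1 \<in> argmax_face ?P h" "axis q1 1 + axis q2 1 \<in> argmax_face ?P h" unfolding max by auto
  then have bound: "y \<bullet> h \<le> M" "y \<bullet> h \<le> h $ q1 + h $ q2" if "y \<in> ?P" for y
    using that by (auto simp: argmax_face_def M_def inner_axis_pair)
  have "M \<le> h $ q1 + h $ q2"
    using bound(2)[OF axis_pair_in_hypersimplex[OF p(1)]] by (simp add: inner_axis_pair M_def)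
  moreover have "h $ q1 + h $ q2 \<le> M"
    using bound(1)[OF axis_pair_in_hypersimplex[OF p(2)]] by (simp add: inner_axis_pair)
  ultimately have M: "\<And>y. y \<in> ?P \<Longrightarrow> y \<bullet> h \<le> M" "h $ q1 + h $ q2 = M" using bound(1) by auto
  have le: "h $ r + h $ s \<le> M" if "r \<noteq> s" for r s
    using M(1)[OF axis_pair_in_hypersimplex[OF that]] by (simp add: inner_axis_pair)
  have only: "{r, s} = {p1, p2} \<or> {r, s} = {q1, q2}" if rs: "r \<noteq> s" "h $ r + h $ s = M" for r s
  proof -
    let ?z = "axis r 1 + axis s 1 :: real ^ 'n"
    have "?z \<in> argmax_face ?P h"
      unfolding argmax_face_def using M(1) axis_pair_in_hypersimplex[OF rs(1)] rs(2)
      by (auto simp: inner_axis_pair)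
    moreover have "?z \<notin> open_segment (axis p1 1 + axis p2 1) (axis q1 1 + axis q2 1)"
      using extreme_point_of_hypersimplex2[of ?z] rs(1) axis_pair_in_hypersimplex[OF p(1)]
        axis_pair_in_hypersimplex[OF p(2)] unfolding extreme_point_of_def by blast
    ultimately have "?z = axis p1 1 + axis p2 1 \<or> ?z = axis q1 1 + axis q2 1"
      unfolding max open_segment_def by blast
    then show ?thesis using axis_pair_eq_iff rs(1) p by metis
  qed
  \<comment> \<open>For disjoint pairs the sums of \<open>{p1, q1}\<close> and
    \<open>{p2, q2}\<close> are at most \<open>M\<close> and add up to \<open>2 * M\<close>. Both
    would be maximal, giving further optimal vertices.\<close>
  have "{p1, p2} \<inter> {q1, q2} \<noteq> {}"
  proof
    assume disj: "{p1, p2} \<inter> {q1, q2} = {}"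
    then have "h $ p1 + h $ q1 \<le> M" "h $ p2 + h $ q2 \<le> M" by (auto intro: le)
    then have "h $ p1 + h $ q1 = M" using M(2) by (simp add: M_def)
    then show False using only[of p1 q1] disj p by (auto simp: doubleton_eq_iff)
  qed
  then obtain a where a: "a \<in> {p1, p2}" "a \<in> {q1, q2}" by blast
  define i where "i = (if a = p1 then p2 else p1)"
  define j where "j = (if a = q1 then q2 else q1)"
  have sets: "{p1, p2} = {i, a}" "{q1, q2} = {j, a}" using a by (auto simp: i_def j_def)
  have ne: "i \<noteq> a" "j \<noteq> a" "i \<noteq> j" using a p by (auto simp: i_def j_def split: if_splits)
  have sums: "h $ i + h $ a = M" "h $ j + h $ a = M" using a M(2) by (auto simp: i_def j_def M_def)
  \<comment> \<open>The pair \<open>{i, j}\<close> is a third one, so it falls short of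
    \<open>M = h $ j + h $ a\<close>; this puts \<open>a\<close> strictly above
    \<open>i\<close>.\<close>
  have "h $ i + h $ j < M"
    using le[OF ne(3)] only[OF ne(3)] ne unfolding sets by (auto simp: doubleton_eq_iff less_le)
  then have "h $ i = h $ j" "h $ i < h $ a" using sums by linarith+
  moreover have "h $ k < h $ i" if k: "k \<notin> {i, j, a}" for k
  proof -
    have "k \<noteq> a" using k by simp
    moreover have "{k, a} \<noteq> {i, a}" "{k, a} \<noteq> {j, a}" using k by (auto simp: doubleton_eq_iff)
    ultimately have "h $ k + h $ a \<noteq> M" "h $ k + h $ a \<le> M" using only[of k a] le[of k a] unfolding sets by blast+
    then show ?thesis using sums(1) by linarith
  qed
  ultimately show ?thesis
    using sets ne by blast
qed

text \<open>The rank of a coordinate is the number of coordinates that are not larger, and \<sigma>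
  is the inverse of this ranking.\<close>

lemma generic_direction_ranking:
  fixes c :: "real ^ 'n"
  assumes "generic_direction c"
  obtains \<sigma> where "bij_betw \<sigma> {1..CARD('n)} UNIV" "strict_mono_on {1..CARD('n)} (\<lambda>x. c $ \<sigma> x)"
proof -
  define \<rho> where "\<rho> i = card {j. c $ j \<le> c $ i}" for i
  have less: "\<rho> i < \<rho> j" if "c $ i < c $ j" for i j
  proof -
    have "{k. c $ k \<le> c $ i} \<subseteq> {k. c $ k \<le> c $ j}" "j \<in> {k. c $ k \<le> c $ j}" "j \<notin> {k. c $ k \<le> c $ i}"
      using that by auto
    then have "{k. c $ k \<le> c $ i} \<subset> {k. c $ k \<le> c $ j}" by blast
    then show ?thesis unfolding \<rho>_def by (intro psubset_card_mono) auto
  qed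
  have inj: "inj \<rho>"
  proof (rule injI)
    fix i j assume "\<rho> i = \<rho> j"
    then have "c $ i = c $ j" using less[of i j] less[of j i] by linarith
    then show "i = j" using assms unfolding generic_direction_def by blast
  qed
  have "\<rho> i \<in> {1..CARD('n)}" for i
  proof -
    have "{j. c $ j \<le> c $ i} \<noteq> {}" by blast
    then have "0 < \<rho> i" unfolding \<rho>_def by (simp add: card_gt_0_iff)
    moreover have "\<rho> i \<le> CARD('n)" unfolding \<rho>_def by (rule card_mono) auto
    ultimately show ?thesis by simp
  qed
  then have "range \<rho> = {1..CARD('n)}"
    using card_image[OF inj] by (intro card_subset_eq) auto
  then have bij: "bij_betw \<rho> UNIV {1..CARD('n)}" using inj by (simp add: bij_betw_def)
  define \<sigma> where "\<sigma> = inv_into UNIV \<rho>"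
  have \<sigma>: "bij_betw \<sigma> {1..CARD('n)} UNIV" unfolding \<sigma>_def by (rule bij_betw_inv_into[OF bij])
  have \<rho>\<sigma>: "\<rho> (\<sigma> x) = x" if "x \<in> {1..CARD('n)}" for x
    unfolding \<sigma>_def using that bij by (intro f_inv_into_f) (auto simp: bij_betw_def)
  have "c $ \<sigma> x < c $ \<sigma> y" if "x \<in> {1..CARD('n)}" "y \<in> {1..CARD('n)}" "x < y" for x y
  proof (rule ccontr)
    assume "\<not> c $ \<sigma> x < c $ \<sigma> y"
    moreover have "\<sigma> x \<noteq> \<sigma> y" using \<rho>\<sigma>[OF that(1)] \<rho>\<sigma>[OF that(2)] that(3) by auto
    then have "c $ \<sigma> x \<noteq> c $ \<sigma> y" using assms unfolding generic_direction_def by blast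
    ultimately have "\<rho> (\<sigma> y) < \<rho> (\<sigma> x)" by (intro less) auto
    then show False using \<rho>\<sigma>[OF that(1)] \<rho>\<sigma>[OF that(2)] that(3) by simp
  qed
  then show ?thesis using that[of \<sigma>] \<sigma> by (auto simp: strict_mono_on_def)
qed

section \<open>Coherent paths on the hypersimplex as crossing paths\<close>

context
  fixes c :: "real ^ 'n" and n :: nat and \<sigma> :: "nat \<Rightarrow> 'n" and d :: "nat \<Rightarrow> real"
  assumes n: "n \<ge> 2" and bij: "bij_betw \<sigma> {1..n} UNIV"
    and d_def: "\<And>x. d x = c $ \<sigma> x" and mono: "strict_mono_on {1..n} d"
begin

abbreviation "ranked \<omega> \<equiv> \<lambda>x. \<omega> $ \<sigma> x"

abbreviation "vertex \<equiv> pair_vertex \<sigma>"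

abbreviation "coherent_paths \<equiv> {vs. coherent_monotone_path (hypersimplex 2) c vs}"

abbreviation "accepted_paths \<equiv> {ps. accepts n False 0 (1, 2) ps}"

lemma rank_less: "x \<in> {1..n} \<Longrightarrow> y \<in> {1..n} \<Longrightarrow> x < y \<Longrightarrow> d x < d y"
  using mono by (simp add: strict_mono_on_def)

lemma rank_le: "x \<in> {1..n} \<Longrightarrow> y \<in> {1..n} \<Longrightarrow> x \<le> y \<Longrightarrow> d x \<le> d y"
  using rank_less[of x y] by (cases "x = y") auto

lemma rank_le_iff: "x \<in> {1..n} \<Longrightarrow> y \<in> {1..n} \<Longrightarrow> d x \<le> d y \<longleftrightarrow> x \<le> y"
  using rank_le[of x y] rank_less[of y x] by linarith

lemma rank_eq_iff: "x \<in> {1..n} \<Longrightarrow> y \<in> {1..n} \<Longrightarrow> \<sigma> x = \<sigma> y \<longleftrightarrow> x = y"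
  by (rule inj_on_eq_iff[OF bij_betw_imp_inj_on[OF bij]])

lemma rank_cases: obtains x where "x \<in> {1..n}" "i = \<sigma> x"
proof -
  have "i \<in> \<sigma> ` {1..n}" unfolding bij_betw_imp_surj_on[OF bij] by simp
  then show thesis using that by blast
qed

lemma line_rank: "line d (ranked \<omega>) \<mu> x = (\<omega> + \<mu> *\<^sub>R c) $ \<sigma> x"
  by (simp add: line_def d_def)

lemma pair_vertex_inner: "vertex p \<bullet> c = d (fst p) + d (snd p)"
  by (simp add: pair_vertex_def inner_axis_pair d_def)

lemma pair_vertex_extreme:
  assumes "1 \<le> fst p" "fst p < snd p" "snd p \<le> n"
  shows "vertex p extreme_point_of hypersimplex 2"
  using assms rank_eq_iff[of "fst p" "snd p"] unfolding extreme_point_of_hypersimplex2 pair_vertex_def by auto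

lemma extreme_point_pair_vertex:
  assumes "v extreme_point_of (hypersimplex 2 :: (real ^ 'n) set)"
  shows "\<exists>p. 1 \<le> fst p \<and> fst p < snd p \<and> snd p \<le> n \<and> v = vertex p"
proof -
  obtain i j where ij: "i \<noteq> j" "v = axis i 1 + axis j 1" using assms unfolding extreme_point_of_hypersimplex2 by blast
  obtain x where x: "x \<in> {1..n}" "i = \<sigma> x" by (rule rank_cases)
  obtain y where y: "y \<in> {1..n}" "j = \<sigma> y" by (rule rank_cases)
  have "x \<noteq> y" using ij x y by auto
  then show ?thesis
    using x y ij(2) by (intro exI[of _ "(min x y, max x y)"]) (auto simp: pair_vertex_def min_def max_def add.commute)
qed

lemma pair_vertex_inj:
  assumes "1 \<le> fst p" "fst p < snd p" "snd p \<le> n" "1 \<le> fst q" "fst q < snd q" "snd q \<le> n"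
    and "vertex p = vertex q"
  shows "p = q"
proof -
  have R: "fst p \<in> {1..n}" "snd p \<in> {1..n}" "fst q \<in> {1..n}" "snd q \<in> {1..n}" using assms by auto
  have ne: "\<sigma> (fst p) \<noteq> \<sigma> (snd p)" "\<sigma> (fst q) \<noteq> \<sigma> (snd q)"
    using rank_eq_iff[OF R(1,2)] rank_eq_iff[OF R(3,4)] assms by auto
  have "{\<sigma> (fst p), \<sigma> (snd p)} = {\<sigma> (fst q), \<sigma> (snd q)}"
    using assms(7) unfolding pair_vertex_def axis_pair_eq_iff[OF ne] .
  then have "fst p = fst q \<and> snd p = snd q \<or> fst p = snd q \<and> snd p = fst q"
    unfolding doubleton_eq_iff using rank_eq_iff R by blast
  then show ?thesis using assms by (auto simp: prod_eq_iff)
qed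

text \<open>Coordinate \<open>\<sigma> x\<close> of \<open>\<omega> + \<mu> *\<^sub>R c\<close> is
  the height of line \<open>x\<close> at time \<mu>. So a face that is an edge is a tie for the
  second place below a strict top line, and the increase along \<open>c\<close> orients the tie from
  \<open>i\<close> to the steeper \<open>j\<close>.\<close>

lemma argmax_segment_iff_crossing_move:
  assumes "1 \<le> fst p" "fst p < snd p" "snd p \<le> n" "1 \<le> fst q" "fst q < snd q" "snd q \<le> n"
  shows "(vertex p \<bullet> c < vertex q \<bullet> c \<and> (\<exists>\<mu>. argmax_face (hypersimplex 2) (\<omega> + \<mu> *\<^sub>R c) =
      closed_segment (vertex p) (vertex q))) \<longleftrightarrow> crossing_move n d (ranked \<omega>) p q"
    (is "?L \<longleftrightarrow> ?R")
proof
  have R: "fst p \<in> {1..n}" "snd p \<in> {1..n}" "fst q \<in> {1..n}" "snd q \<in> {1..n}" using assms by auto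
  {
    assume ?L
    then obtain \<mu> where less: "d (fst p) + d (snd p) < d (fst q) + d (snd q)" and
      max: "argmax_face (hypersimplex 2) (\<omega> + \<mu> *\<^sub>R c) = closed_segment (vertex p) (vertex q)"
      unfolding pair_vertex_inner by blast
    define h where "h = \<omega> + \<mu> *\<^sub>R c"
    have ne: "\<sigma> (fst p) \<noteq> \<sigma> (snd p)" "\<sigma> (fst q) \<noteq> \<sigma> (snd q)"
      using rank_eq_iff[OF R(1,2)] rank_eq_iff[OF R(3,4)] assms by auto
    have "vertex p \<noteq> vertex q" using less pair_vertex_inner[of p] pair_vertex_inner[of q] by auto
    then have "{\<sigma> (fst p), \<sigma> (snd p)} \<noteq> {\<sigma> (fst q), \<sigma> (snd q)}"
      unfolding pair_vertex_def axis_pair_eq_iff[OF ne] .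
    from argmax_face_hypersimplex2_imp[OF ne this max[unfolded pair_vertex_def, folded h_def]]
    obtain i' j' a' where ija': "i' \<noteq> j'" "i' \<noteq> a'" "j' \<noteq> a'" "{\<sigma> (fst p), \<sigma> (snd p)} = {i', a'}"
      "{\<sigma> (fst q), \<sigma> (snd q)} = {j', a'}" "h $ i' = h $ j'" "h $ i' < h $ a'"
      "\<forall>k. k \<notin> {i', j', a'} \<longrightarrow> h $ k < h $ i'" by blast
    obtain i where i: "i \<in> {1..n}" "i' = \<sigma> i" by (rule rank_cases)
    obtain j where j: "j \<in> {1..n}" "j' = \<sigma> j" by (rule rank_cases)
    obtain a where a: "a \<in> {1..n}" "a' = \<sigma> a" by (rule rank_cases)
    have p: "{fst p, snd p} = {i, a}" and q: "{fst q, snd q} = {j, a}"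
      using ija'(4,5) R i j a rank_eq_iff unfolding doubleton_eq_iff by blast+
    have "d i + d a < d j + d a"
    proof -
      have "d i + d a = d (fst p) + d (snd p)" "d j + d a = d (fst q) + d (snd q)"
        using p q by (auto simp: doubleton_eq_iff)
      then show ?thesis using less by simp
    qed
    then have "i < j" using rank_le[OF j(1) i(1)] by (meson add_less_cancel_right not_le)
    from pair_move_swap[OF assms(2,5) p q this] have mv: "pair_move p q" "pair_step p q = (i, j, a)" by auto
    have "crossing d (ranked \<omega>) {1..n} \<mu> (i, j, a)"
      unfolding crossing.simps line_rank h_def[symmetric]
    proof (intro conjI ballI)
      fix x assume x: "x \<in> {1..n} - {i, j, a}"
      then have "\<sigma> x \<notin> {i', j', a'}" using rank_eq_iff i j a by auto
      then show "h $ \<sigma> x < h $ \<sigma> i" using ija'(8) i(2) by blast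
    qed (use ija' i j a in auto)
    then show ?R using mv unfolding crossing_move_def by auto
  next
    assume ?R
    then obtain \<mu> where mv: "pair_move p q" and cr: "crossing d (ranked \<omega>) {1..n} \<mu> (pair_step p q)"
      unfolding crossing_move_def by blast
    obtain i j a where e: "pair_step p q = (i, j, a)" by (cases "pair_step p q")
    note ija = pair_step_cases[OF mv e]
    have "{fst p, snd p} \<subseteq> {1..n}" "{fst q, snd q} \<subseteq> {1..n}" using R by simp_all
    then have U: "i \<in> {1..n}" "j \<in> {1..n}" "a \<in> {1..n}" unfolding ija(4,5) by simp_all
    define h where "h = \<omega> + \<mu> *\<^sub>R c"
    have h: "h $ \<sigma> i = h $ \<sigma> j" "h $ \<sigma> i < h $ \<sigma> a" "\<forall>x\<in>{1..n} - {i, j, a}. h $ \<sigma> x < h $ \<sigma> i"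
      using cr unfolding e crossing.simps line_rank h_def by blast+
    have vp: "vertex p = axis (\<sigma> i) 1 + axis (\<sigma> a) 1" "vertex q = axis (\<sigma> j) 1 + axis (\<sigma> a) 1"
      using ija(4,5) unfolding pair_vertex_def doubleton_eq_iff by (auto simp: add.commute)
    have "argmax_face (hypersimplex 2) h = closed_segment (vertex p) (vertex q)"
      unfolding vp
    proof (rule argmax_face_hypersimplex2)
      fix k assume k: "k \<notin> {\<sigma> i, \<sigma> j, \<sigma> a}"
      obtain x where "x \<in> {1..n}" "k = \<sigma> x" by (rule rank_cases)
      then show "h $ k < h $ \<sigma> i" using k h(3) by auto
    qed (use h ija U rank_eq_iff in auto)
    moreover have "vertex p \<bullet> c < vertex q \<bullet> c"
      unfolding vp inner_axis_pair d_def[symmetric] using rank_less[OF U(1,2) ija(1)] by simp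
    ultimately show ?L unfolding h_def by blast
  }
qed

lemma hypersimplex2_inner_ge:
  assumes "x \<in> hypersimplex 2"
  shows "d 1 + d 2 \<le> x \<bullet> c"
proof -
  \<comment> \<open>For \<open>- c\<close> the coordinate of rank 1 is the largest, and
    \<open>- d 2\<close> bounds all the others.\<close>
  have "x \<bullet> (- c) \<le> - d 2 + (- c) $ \<sigma> 1"
  proof (rule hypersimplex2_bound(1)[OF assms])
    show "- d 2 \<le> (- c) $ \<sigma> 1" using rank_le[of 1 2] n by (simp add: d_def)
    fix k assume "k \<noteq> \<sigma> 1"
    obtain y where y: "y \<in> {1..n}" "k = \<sigma> y" by (rule rank_cases)
    then have "2 \<le> y" using \<open>k \<noteq> \<sigma> 1\<close> by (cases "y = 1") auto
    then show "(- c) $ k \<le> - d 2" using rank_le[of 2 y] y n by (simp add: d_def)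
  qed
  then show ?thesis by (simp add: d_def)
qed

lemma hypersimplex2_inner_le:
  assumes "x \<in> hypersimplex 2"
  shows "x \<bullet> c \<le> d (n - 1) + d n"
proof -
  have "x \<bullet> c \<le> d (n - 1) + c $ \<sigma> n"
  proof (rule hypersimplex2_bound(1)[OF assms])
    show "d (n - 1) \<le> c $ \<sigma> n" using rank_le[of "n - 1" n] n by (simp add: d_def)
    fix k assume "k \<noteq> \<sigma> n"
    obtain y where y: "y \<in> {1..n}" "k = \<sigma> y" by (rule rank_cases)
    then have "y \<le> n - 1" using \<open>k \<noteq> \<sigma> n\<close> by (cases "y = n") auto
    then show "c $ k \<le> d (n - 1)" using rank_le[of y "n - 1"] y n by (simp add: d_def)
  qed
  then show ?thesis by (simp add: d_def)
qed

lemma pair_path_range: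
  assumes "successively pair_move ((1, 2) # ps)" "last ((1, 2) # ps) = (n - 1, n)" "p \<in> set ((1, 2) # ps)"
  shows "1 \<le> fst p" "fst p < snd p" "snd p \<le> n"
proof -
  show "1 \<le> fst p" "snd p \<le> n" using pair_path_mono[OF assms(1,3)] assms(2) by auto
  have "\<forall>p\<in>set ps. fst p < snd p" if "successively pair_move (q # ps)" for q
    using that
  proof (induction ps arbitrary: q)
    case (Cons r ps)
    then have "pair_move q r" "successively pair_move (r # ps)" by simp_all
    from Cons.IH[OF this(2)] this(1) show ?case by (simp add: pair_move_def)
  qed simp
  from this[OF assms(1)] show "fst p < snd p" using assms(3) by auto
qed

lemma crossing_path_coherent:
  assumes "successively (crossing_move n d (ranked \<omega>)) ((1, 2) # ps)" "last ((1, 2) # ps) = (n - 1, n)"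
  shows "coherent_via (hypersimplex 2) c \<omega> (map vertex ((1, 2) # ps))"
proof -
  let ?P = "hypersimplex 2 :: (real ^ 'n) set" and ?qs = "(1, 2) # ps"
  have path: "successively pair_move ?qs"
    by (rule successively_mono[OF assms(1)]) (simp add: crossing_move_def)
  note range = pair_path_range[OF path assms(2)]
  have step: "vertex (?qs ! k) \<bullet> c < vertex (?qs ! Suc k) \<bullet> c \<and>
      (\<exists>\<mu>. argmax_face ?P (\<omega> + \<mu> *\<^sub>R c) = closed_segment (vertex (?qs ! k)) (vertex (?qs ! Suc k)))"
    if k: "Suc k < length ?qs" for k
  proof -
    have "?qs ! k \<in> set ?qs" "?qs ! Suc k \<in> set ?qs" using k by (meson Suc_lessD nth_mem)+
    note r = range[OF this(1)] range[OF this(2)]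
    show ?thesis
      unfolding argmax_segment_iff_crossing_move[OF r] using successively_nth[OF assms(1) k] .
  qed
  have "monotone_path ?P c (map vertex ?qs)"
    unfolding monotone_path_def
  proof (intro conjI ballI allI impI)
    fix v assume "v \<in> set (map vertex ?qs)"
    then obtain p where "p \<in> set ?qs" "v = vertex p" by auto
    then show "v extreme_point_of ?P" using pair_vertex_extreme range by blast
  next
    fix x assume x: "x \<in> ?P"
    show "hd (map vertex ?qs) \<bullet> c \<le> x \<bullet> c"
      using hypersimplex2_inner_ge[OF x] by (simp add: pair_vertex_inner)
    have "last (map vertex ?qs) = vertex (n - 1, n)"
      using assms(2) by (subst last_map) simp_all
    then show "x \<bullet> c \<le> last (map vertex ?qs) \<bullet> c"
      using hypersimplex2_inner_le[OF x] by (simp add: pair_vertex_inner)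
  next
    fix k assume "Suc k < length (map vertex ?qs)"
    then have k: "Suc k < length ?qs" by simp
    let ?u = "vertex (?qs ! k)" and ?v = "vertex (?qs ! Suc k)"
    have nth: "map vertex ?qs ! k = ?u" "map vertex ?qs ! Suc k = ?v"
      using k by (simp_all only: nth_map Suc_lessD)
    obtain \<mu> where \<mu>: "argmax_face ?P (\<omega> + \<mu> *\<^sub>R c) = closed_segment ?u ?v" using step[OF k] by blast
    have less: "?u \<bullet> c < ?v \<bullet> c" using step[OF k] by blast
    let ?h = "\<omega> + \<mu> *\<^sub>R c"
    have "?u \<in> argmax_face ?P ?h" unfolding \<mu> by simp
    then have u: "?u \<in> ?P" "\<And>y. y \<in> ?P \<Longrightarrow> ?h \<bullet> y \<le> ?h \<bullet> ?u"
      unfolding argmax_face_def by (auto simp: inner_commute)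
    have "argmax_face ?P ?h = ?P \<inter> {y. ?h \<bullet> y = ?h \<bullet> ?u}"
    proof (intro set_eqI iffI)
      fix x assume "x \<in> argmax_face ?P ?h"
      then have "x \<in> ?P" "?h \<bullet> ?u \<le> ?h \<bullet> x"
        using u(1) unfolding argmax_face_def inner_commute[of ?h] by blast+
      then show "x \<in> ?P \<inter> {y. ?h \<bullet> y = ?h \<bullet> ?u}" using u(2)[of x] by simp
    next
      fix x assume "x \<in> ?P \<inter> {y. ?h \<bullet> y = ?h \<bullet> ?u}"
      then show "x \<in> argmax_face ?P ?h" using u(2) unfolding argmax_face_def inner_commute[of ?h] by simp
    qed
    then have "closed_segment ?u ?v face_of ?P"
      unfolding \<mu> using face_of_Int_supporting_hyperplane_le[OF convex_hypersimplex u(2)] by simp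
    moreover have "?u \<noteq> ?v" using less by auto
    then have "aff_dim (closed_segment ?u ?v) = 1"
      unfolding segment_convex_hull aff_dim_convex_hull by (simp add: aff_dim_2)
    ultimately show "closed_segment (map vertex ?qs ! k) (map vertex ?qs ! Suc k) edge_of ?P"
      unfolding nth edge_of_def by simp
    show "map vertex ?qs ! k \<bullet> c < map vertex ?qs ! Suc k \<bullet> c" unfolding nth by (rule less)
  qed simp
  moreover have "successively (\<lambda>u v. \<exists>\<mu>. argmax_face ?P (\<omega> + \<mu> *\<^sub>R c) = closed_segment u v) (map vertex ?qs)"
    unfolding successively_conv_nth
  proof (intro allI impI)
    fix k assume "Suc k < length (map vertex ?qs)"
    then have k: "Suc k < length ?qs" by simp
    show "\<exists>\<mu>. argmax_face ?P (\<omega> + \<mu> *\<^sub>R c) =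
        closed_segment (map vertex ?qs ! k) (map vertex ?qs ! Suc k)"
      unfolding nth_map[OF k] nth_map[OF Suc_lessD[OF k]] using step[OF k] by blast
  qed
  ultimately show ?thesis unfolding coherent_via_def by blast
qed

text \<open>Vertices are turned back into pairs and edges into crossings. The end conditions of a
  monotone path identify the first and the last pair, because \<open>d\<close> is strictly
  increasing.\<close>

lemma coherent_path_crossing:
  assumes "coherent_via (hypersimplex 2) c \<omega> vs"
  shows "\<exists>ps. vs = map vertex ((1, 2) # ps) \<and>
    successively (crossing_move n d (ranked \<omega>)) ((1, 2) # ps) \<and> last ((1, 2) # ps) = (n - 1, n)"
proof -
  let ?P = "hypersimplex 2 :: (real ^ 'n) set"
  have mp: "monotone_path ?P c vs" and
    seg: "successively (\<lambda>u v. \<exists>\<mu>. argmax_face ?P (\<omega> + \<mu> *\<^sub>R c) = closed_segment u v) vs"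
    using assms unfolding coherent_via_def by auto
  define g where "g v = (SOME p. 1 \<le> fst p \<and> fst p < snd p \<and> snd p \<le> n \<and> v = vertex p)" for v
  have g: "1 \<le> fst (g v)" "fst (g v) < snd (g v)" "snd (g v) \<le> n" "vertex (g v) = v" if "v \<in> set vs" for v
    using someI_ex[OF extreme_point_pair_vertex[of v]] mp that unfolding g_def monotone_path_def by auto
  define qs where "qs = map g vs"
  have vs: "vs = map vertex qs" unfolding qs_def using g(4) by (simp add: map_idI)
  have ne: "vs \<noteq> []" "qs \<noteq> []" using mp unfolding monotone_path_def qs_def by auto
  have cm: "successively (crossing_move n d (ranked \<omega>)) qs"
    unfolding successively_conv_nth
  proof (intro allI impI)
    fix k assume "Suc k < length qs"
    then have k: "Suc k < length vs" by (simp add: qs_def)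
    then have mem: "vs ! k \<in> set vs" "vs ! Suc k \<in> set vs" by auto
    have nth: "qs ! k = g (vs ! k)" "qs ! Suc k = g (vs ! Suc k)" using k by (simp_all add: qs_def)
    have "vs ! k \<bullet> c < vs ! Suc k \<bullet> c" using mp k unfolding monotone_path_def by blast
    then show "crossing_move n d (ranked \<omega>) (qs ! k) (qs ! Suc k)"
      unfolding nth argmax_segment_iff_crossing_move[OF g(1-3)[OF mem(1)] g(1-3)[OF mem(2)], symmetric]
        g(4)[OF mem(1)] g(4)[OF mem(2)]
      using successively_nth[OF seg k] by blast
  qed
  have pv: "vertex p \<in> ?P" if "1 \<le> fst p" "fst p < snd p" "snd p \<le> n" for p
    using pair_vertex_extreme[OF that] unfolding extreme_point_of_def by blast
  have "hd qs = (1, 2)"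
  proof -
    have hd: "hd qs = g (hd vs)" "hd vs \<in> set vs" using ne by (auto simp: qs_def hd_map)
    let ?p = "g (hd vs)"
    have r: "1 \<le> fst ?p" "fst ?p < snd ?p" "snd ?p \<le> n" using g[OF hd(2)] by auto
    have "hd vs \<bullet> c \<le> vertex (1, 2) \<bullet> c"
      using mp pv[of "(1, 2)"] n unfolding monotone_path_def by auto
    then have le: "d (fst ?p) + d (snd ?p) \<le> d 1 + d 2"
      using pair_vertex_inner[of ?p] pair_vertex_inner[of "(1, 2)"] g(4)[OF hd(2)] by simp
    \<comment> \<open>Each entry is bounded below separately, so the reverse inequality for the sum
      gives it for both entries. The last vertex is treated symmetrically.\<close>
    have "d 1 \<le> d (fst ?p)" "d 2 \<le> d (snd ?p)"
      using r n by (auto intro!: rank_le)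
    then have "d (fst ?p) \<le> d 1" "d (snd ?p) \<le> d 2" using le by linarith+
    then have "fst ?p \<le> 1" "snd ?p \<le> 2"
      using rank_le_iff[of "fst ?p" 1] rank_le_iff[of "snd ?p" 2] r n by simp_all
    then have "fst ?p = 1" "snd ?p = 2" using r by linarith+
    then have "?p = (1, 2)" by (simp add: prod_eq_iff)
    then show ?thesis using hd(1) by simp
  qed
  moreover have "last qs = (n - 1, n)"
  proof -
    have la: "last qs = g (last vs)" "last vs \<in> set vs" using ne by (auto simp: qs_def last_map)
    let ?p = "g (last vs)"
    have r: "1 \<le> fst ?p" "fst ?p < snd ?p" "snd ?p \<le> n" using g[OF la(2)] by auto
    have "vertex (n - 1, n) \<bullet> c \<le> last vs \<bullet> c"
      using mp pv[of "(n - 1, n)"] n unfolding monotone_path_def by auto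
    then have le: "d (n - 1) + d n \<le> d (fst ?p) + d (snd ?p)"
      using pair_vertex_inner[of ?p] pair_vertex_inner[of "(n - 1, n)"] g(4)[OF la(2)] by simp
    have "d (fst ?p) \<le> d (n - 1)" "d (snd ?p) \<le> d n"
      using r n by (auto intro!: rank_le)
    then have "d (n - 1) \<le> d (fst ?p)" "d n \<le> d (snd ?p)" using le by linarith+
    then have "n - 1 \<le> fst ?p" "n \<le> snd ?p"
      using rank_le_iff[of "n - 1" "fst ?p"] rank_le_iff[of n "snd ?p"] r n by simp_all
    then have "fst ?p = n - 1" "snd ?p = n" using r by linarith+
    then have "?p = (n - 1, n)" by (simp add: prod_eq_iff)
    then show ?thesis using la(1) by simp
  qed
  moreover obtain q ps where "qs = q # ps" using ne(2) by (cases qs) auto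
  ultimately show ?thesis
    using vs cm by (intro exI[of _ ps]) simp
qed

lemma crossing_path_accepted:
  assumes "successively (crossing_move n d w) ((1, 2) # ps)" "last ((1, 2) # ps) = (n - 1, n)"
  shows "accepts n False 0 (1, 2) ps"
proof -
  have path: "successively pair_move ((1, 2) # ps)"
    by (rule successively_mono[OF assms(1)]) (simp add: crossing_move_def)
  have "\<forall>e\<in>set (consec pair_step qs). \<exists>\<mu>. crossing d w {1..n} \<mu> e" if "successively (crossing_move n d w) qs" for qs
    using that
  proof (induction qs rule: induct_list012)
    case (3 p q qs)
    then have "crossing_move n d w p q" "successively (crossing_move n d w) (q # qs)" by simp_all
    from "3.IH"(2)[OF this(2)] this(1)[unfolded crossing_move_def]
    show ?case unfolding consec.simps list.set by blast
  qed simp_all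
  moreover have "\<forall>q\<in>set ((1, 2) # ps). {fst q, snd q} \<subseteq> {1..n}"
  proof
    fix q assume "q \<in> set ((1, 2) # ps)"
    from pair_path_range[OF path assms(2) this] show "{fst q, snd q} \<subseteq> {1..n}" by simp
  qed
  ultimately have "sorted_wrt compatible (consec pair_step ((1, 2) # ps))"
    using crossings_imp_compatible[OF path _ _ mono] assms(1) by blast
  then show ?thesis unfolding accepts_iff using path assms(2) by blast
qed

lemma accepted_crossing_path:
  assumes "accepts n False 0 (1, 2) ps"
  shows "\<exists>\<omega> :: real ^ 'n. successively (crossing_move n d (ranked \<omega>)) ((1, 2) # ps)"
proof -
  have path: "successively pair_move ((1, 2) # ps)" "last ((1, 2) # ps) = (n - 1, n)"
    using assms unfolding accepts_iff by blast+
  obtain w where w: "\<forall>e\<in>set (consec pair_step ((1, 2) # ps)). \<exists>\<mu>. crossing d w {1..n} \<mu> e"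
    using accepts_imp_realizable[OF assms mono n] by blast
  \<comment> \<open>The weights of the lines, carried back to the coordinates along
    \<sigma>.\<close>
  define \<omega> :: "real ^ 'n" where "\<omega> = (\<chi> i. w (inv_into {1..n} \<sigma> i))"
  have \<omega>: "\<omega> $ \<sigma> x = w x" if "x \<in> {1..n}" for x
    using that bij by (simp add: \<omega>_def bij_betw_def inv_into_f_f)
  have ln: "line d (ranked \<omega>) \<mu> x = line d w \<mu> x" if "x \<in> {1..n}" for \<mu> x
    using \<omega>[OF that] by (simp add: line_def)
  have "crossing_move n d (ranked \<omega>) p q"
    if pq: "pair_move p q" "p \<in> set ((1, 2) # ps)" "q \<in> set ((1, 2) # ps)"
      "\<exists>\<mu>. crossing d w {1..n} \<mu> (pair_step p q)" for p q
  proof -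
    obtain \<mu> where \<mu>: "crossing d w {1..n} \<mu> (pair_step p q)" using pq(4) by blast
    obtain i j a where e: "pair_step p q = (i, j, a)" by (cases "pair_step p q")
    have "{fst p, snd p} \<subseteq> {1..n}" "{fst q, snd q} \<subseteq> {1..n}"
      using pair_path_range[OF path pq(2)] pair_path_range[OF path pq(3)] by auto
    then have U: "i \<in> {1..n}" "j \<in> {1..n}" "a \<in> {1..n}"
      unfolding pair_step_cases(4,5)[OF pq(1) e] by auto
    have "crossing d (ranked \<omega>) {1..n} \<mu> (i, j, a)"
      using \<mu> ln unfolding e crossing.simps ln[OF U(1)] ln[OF U(2)] ln[OF U(3)] by auto
    then show ?thesis using pq(1) e unfolding crossing_move_def by auto
  qed
  note move = this
  have "successively (crossing_move n d (ranked \<omega>)) qs"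
    if "successively pair_move qs" "set qs \<subseteq> set ((1, 2) # ps)"
      "\<forall>e\<in>set (consec pair_step qs). \<exists>\<mu>. crossing d w {1..n} \<mu> e" for qs
    using that
  proof (induction qs rule: induct_list012)
    case (3 p q qs)
    then have "pair_move p q" "\<exists>\<mu>. crossing d w {1..n} \<mu> (pair_step p q)" "p \<in> set ((1, 2) # ps)" "q \<in> set ((1, 2) # ps)"
      by simp_all
    moreover have "successively (crossing_move n d (ranked \<omega>)) (q # qs)"
      using "3.prems" by (intro "3.IH"(2)) simp_all
    ultimately show ?case using move[of p q] by simp
  qed simp_all
  then show ?thesis using path(1) w by blast
qed

lemma coherent_monotone_paths_eq:
  "coherent_paths =
     (\<lambda>ps. map vertex ((1, 2) # ps)) ` accepted_paths"
proof (intro set_eqI iffI)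
  fix vs assume "vs \<in> coherent_paths"
  then have "\<exists>\<omega>. coherent_via (hypersimplex 2) c \<omega> vs"
    unfolding coherent_monotone_path_iff[OF convex_hypersimplex] by simp
  then obtain \<omega> where "coherent_via (hypersimplex 2) c \<omega> vs" by blast
  from coherent_path_crossing[OF this] show "vs \<in> (\<lambda>ps. map vertex ((1, 2) # ps)) ` accepted_paths"
    using crossing_path_accepted by blast
next
  fix vs assume "vs \<in> (\<lambda>ps. map vertex ((1, 2) # ps)) ` accepted_paths"
  then obtain ps where ps: "vs = map vertex ((1, 2) # ps)" "accepts n False 0 (1, 2) ps" by blast
  obtain \<omega> :: "real ^ 'n" where "successively (crossing_move n d (ranked \<omega>)) ((1, 2) # ps)"
    using accepted_crossing_path[OF ps(2)] by blast
  then have "coherent_via (hypersimplex 2) c \<omega> vs"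
    unfolding ps(1) using ps(2) unfolding accepts_iff by (intro crossing_path_coherent) auto
  then show "vs \<in> coherent_paths"
    unfolding coherent_monotone_path_iff[OF convex_hypersimplex] by blast
qed

lemma inj_on_pair_vertex_paths:
  "inj_on (\<lambda>ps. map vertex ((1, 2) # ps)) accepted_paths"
proof (rule inj_onI)
  fix ps qs assume *: "ps \<in> accepted_paths" "qs \<in> accepted_paths"
    and eq: "map vertex ((1, 2) # ps) = map vertex ((1, 2) # qs)"
  have r: "1 \<le> fst p \<and> fst p < snd p \<and> snd p \<le> n" if "p \<in> set ps \<union> set qs" for p
    using * that pair_path_range[of ps p] pair_path_range[of qs p] unfolding accepts_iff by auto
  have "inj_on vertex (set ps \<union> set qs)"
    by (rule inj_onI) (use r pair_vertex_inj in blast)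
  then show "ps = qs" using eq by (simp add: inj_on_map_eq_map)
qed

text \<open>Each coincidence of two crossing times is one linear equation in \<omega> with normal
  vector \<open>a t\<close>. Finitely many hyperplanes form a negligible set and cannot cover a
  nonempty open set.\<close>

lemma generic_weights_dense:
  assumes "open W" "W \<noteq> {}"
  shows "\<exists>\<omega>\<in>W. generic_weights n d (ranked \<omega>)"
proof -
  define a where "a = (\<lambda>(i, j, k, l). (d l - d k) *\<^sub>R (axis (\<sigma> i) 1 - axis (\<sigma> j) 1)
    - (d j - d i) *\<^sub>R (axis (\<sigma> k) 1 - axis (\<sigma> l) 1 :: real ^ 'n))"
  define T where "T = {(i, j, k, l). {i, j, k, l} \<subseteq> {1..n} \<and> i < j \<and> k < l \<and> (i, j) \<noteq> (k, l)}"
  have "a t \<noteq> 0" if t: "t \<in> T" for t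
  proof -
    obtain i j k l where ijkl: "t = (i, j, k, l)" by (cases t)
    have U: "i \<in> {1..n}" "j \<in> {1..n}" "k \<in> {1..n}" "l \<in> {1..n}" "i < j" "k < l" "(i, j) \<noteq> (k, l)"
      using t unfolding T_def ijkl by auto
    have pos: "d l - d k \<noteq> 0" using rank_less[OF U(3,4,6)] by simp
    have coord: "a t $ \<sigma> x = (d l - d k) * ((if x = i then 1 else 0) - (if x = j then 1 else 0))
        - (d j - d i) * ((if x = k then 1 else 0) - (if x = l then 1 else 0))" if "x \<in> {1..n}" for x
      unfolding a_def ijkl using rank_eq_iff that U by (simp add: axis_def)
    \<comment> \<open>Different increasing pairs share at most one index. At an index of the first
      pair outside the second, the normal vector has the nonzero coordinate \<open>d l - d k\<close>
      up to sign.\<close>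
    have "i \<notin> {k, l} \<or> j \<notin> {k, l}" using U(5-7) by auto
    then show ?thesis
    proof
      assume "i \<notin> {k, l}"
      then have "a t $ \<sigma> i = d l - d k" using coord[OF U(1)] U(5) by auto
      then show ?thesis using pos by auto
    next
      assume "j \<notin> {k, l}"
      then have "a t $ \<sigma> j = - (d l - d k)" using coord[OF U(2)] U(5) by auto
      then show ?thesis using pos by auto
    qed
  qed
  then have "negligible (\<Union>t\<in>T. {\<omega>. a t \<bullet> \<omega> = 0})"
  proof (intro negligible_Union)
    have "T \<subseteq> {1..n} \<times> {1..n} \<times> {1..n} \<times> {1..n}" unfolding T_def by auto
    then show "finite ((\<lambda>t. {\<omega>. a t \<bullet> \<omega> = 0}) ` T)" by (intro finite_imageI) (rule finite_subset, auto)
  qed (auto intro: negligible_hyperplane)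
  moreover have "\<not> negligible W" using assms open_not_negligible by blast
  ultimately obtain \<omega> where \<omega>: "\<omega> \<in> W" "\<omega> \<notin> (\<Union>t\<in>T. {\<omega>. a t \<bullet> \<omega> = 0})"
    using negligible_subset by blast
  have "generic_weights n d (ranked \<omega>)"
    unfolding generic_weights_def
  proof (intro allI impI)
    fix i j k l assume "{i, j, k, l} \<subseteq> {1..n} \<and> i < j \<and> k < l \<and> (i, j) \<noteq> (k, l)"
    then have "(i, j, k, l) \<in> T" unfolding T_def by simp
    then have "a (i, j, k, l) \<bullet> \<omega> \<noteq> 0" using \<omega>(2) by blast
    then show "(\<omega> $ \<sigma> i - \<omega> $ \<sigma> j) * (d l - d k) \<noteq> (\<omega> $ \<sigma> k - \<omega> $ \<sigma> l) * (d j - d i)"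
      unfolding a_def by (simp add: inner_diff_left inner_axis' mult.commute)
  qed
  then show ?thesis using \<omega>(1) by blast
qed

lemma coherent_via_dense:
  assumes "open W" "W \<noteq> {}"
  shows "\<exists>\<omega>\<in>W. \<exists>vs. coherent_via (hypersimplex 2) c \<omega> vs"
  using generic_weights_dense[OF assms] generic_path_from_start[OF mono _ n] crossing_path_coherent by blast

lemma hypersimplex2_nonconstant:
  assumes "n \<ge> 3"
  shows "\<exists>x\<in>hypersimplex 2. \<exists>y\<in>hypersimplex 2. x \<bullet> c < y \<bullet> c"
proof -
  have "vertex (1, 2) \<in> hypersimplex 2" "vertex (1, 3) \<in> hypersimplex 2"
    using pair_vertex_extreme[of "(1, 2)"] pair_vertex_extreme[of "(1, 3)"] assms
    unfolding extreme_point_of_def by auto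
  moreover have "vertex (1, 2) \<bullet> c < vertex (1, 3) \<bullet> c"
    using rank_less[of 2 3] assms by (simp add: pair_vertex_inner)
  ultimately show ?thesis by blast
qed

lemma card_coherent_monotone_paths:
  assumes "n \<ge> 4"
  shows "finite coherent_paths"
    and "real (card coherent_paths) = (25 * 4 ^ (n - 4) - 1) / 3"
    and "real (card {v. v extreme_point_of monotone_path_polytope (hypersimplex 2) c}) = (25 * 4 ^ (n - 4) - 1) / 3"
proof -
  show fin: "finite coherent_paths"
    unfolding coherent_monotone_paths_eq using card_accepts(1)[OF assms] by (rule finite_imageI)
  have "card coherent_paths = card accepted_paths"
    unfolding coherent_monotone_paths_eq by (rule card_image[OF inj_on_pair_vertex_paths])
  then show paths: "real (card coherent_paths) = (25 * 4 ^ (n - 4) - 1) / 3"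
    using card_accepts(2)[OF assms] by simp
  have "n \<ge> 3" using assms by simp
  from bij_betw_same_card[OF bij_betw_path_average[OF convex_hypersimplex hypersimplex2_nonconstant[OF this] fin coherent_via_dense]]
  show "real (card {v. v extreme_point_of monotone_path_polytope (hypersimplex 2) c}) = (25 * 4 ^ (n - 4) - 1) / 3"
    using paths by simp
qed

end

lemma card_coherent_lattice_paths:
  assumes "n \<ge> 4"
  shows "real (card {ls. coherent_lattice_path n ls}) = (25 * 4 ^ (n - 4) - 1) / 3"
proof -
  have "card {ls. coherent_lattice_path n ls} = card (Cons (1::nat, 2::nat) ` {ps. accepts n False 0 (1, 2) ps})"
    using bij_betw_coherent_lattice_path[of n] assms by (intro bij_betw_same_card) auto
  also have "\<dots> = card {ps. accepts n False 0 (1, 2) ps}"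
    by (rule card_image) auto
  finally show ?thesis using card_accepts(2)[OF assms] by simp
qed

theorem theorem5p2:
  fixes n :: nat
  assumes "n \<ge> 4"
  shows "real (card {ls. coherent_lattice_path n ls}) = (25 * 4 ^ (n - 4) - 1) / 3 \<and>
    (\<forall>c :: real ^ 'n. CARD('n) = n \<longrightarrow> generic_direction c \<longrightarrow>
       real (card {vs. coherent_monotone_path (hypersimplex 2) c vs}) = (25 * 4 ^ (n - 4) - 1) / 3 \<and>
       real (card {v. v extreme_point_of monotone_path_polytope (hypersimplex 2) c})
         = (25 * 4 ^ (n - 4) - 1) / 3)"
proof (intro conjI allI impI)
  show "real (card {ls. coherent_lattice_path n ls}) = (25 * 4 ^ (n - 4) - 1) / 3"
    by (rule card_coherent_lattice_paths[OF assms])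
next
  fix c :: "real ^ 'n" assume card: "CARD('n) = n" and gen: "generic_direction c"
  obtain \<sigma> where \<sigma>: "bij_betw \<sigma> {1..n} UNIV" "strict_mono_on {1..n} (\<lambda>x. c $ \<sigma> x)"
    using generic_direction_ranking[OF gen] unfolding card by blast
  have "n \<ge> 2" using assms by simp
  \<comment> \<open>Resolving with \<open>refl\<close> instantiates \<open>d\<close> by the ranked
    coordinates of \<open>c\<close>.\<close>
  note * = card_coherent_monotone_paths[OF this \<sigma>(1) refl \<sigma>(2) assms]
  show "real (card {vs. coherent_monotone_path (hypersimplex 2) c vs}) = (25 * 4 ^ (n - 4) - 1) / 3"
    "real (card {v. v extreme_point_of monotone_path_polytope (hypersimplex 2) c}) = (25 * 4 ^ (n - 4) - 1) / 3"
    by (rule *)+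
qed

end
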